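(* Let $n\ge1$ be an integer, let $\alpha_1,\alpha_2,\alpha_3,\delta,s_1,s_2,s_3$ and $x$ be as in the context, and let $\triangle_n$, $\triangle_{n+1}$ be the Hankel determinants defined in the context. If $\triangle_n\neq0$ and $\triangle_{n+1}=0$, then the Riemann–Hilbert problem stated in the context determines a polynomial solution of degree $n$ of the Heun equation (a Heun polynomial). Namely, its solution $\Phi$ has an entry $\Phi_{11}(\lambda)$ which is a polynomial of degree $n$ and which satisfies, with some constant $\nu\in\mathbb C$, the general Heun equation with fourth singular point $a=x$ $$w''+\Big(\frac{1+2\alpha_1}{\lambda}+\frac{1+2\alpha_2}{\lambda-x}+\frac{1+2\alpha_3}{\lambda-1}\Big)w'+\frac{n(n+2\delta-2)\lambda+\nu}{\lambda(\lambda-1)(\lambda-x)}w=0.$$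
   Context: Notation and assumptions: $\sigma_3=\operatorname{diag}(1,-1)$, $\sigma_+=\begin{pmatrix}0&1\\0&0\end{pmatrix}$. Let $\lambda_1=0$, $\lambda_2=x$, $\lambda_3=1$, where $x\in\mathbb C\setminus\big((-\infty,0]\cup[1,\infty)\big)$, so that the broken line $[\lambda_1,\lambda_2]\cup[\lambda_2,\lambda_3]\cup[\lambda_3,\infty)$, oriented from $\lambda_1$ to $\infty$, is simple; the $+$ side is the left side. Let $\alpha_1,\alpha_2,\alpha_3,\delta\in\mathbb C$ satisfy $\operatorname{Re}\alpha_j\in[0,\frac12)$, $2\alpha_j\notin\mathbb Z$, $2\delta\notin\mathbb Z$ and $\alpha_1+\alpha_2+\alpha_3+\delta=-n$. Let $s_1,s_2,s_3\in\mathbb C\setminus\{0\}$ satisfy $s_1e^{2\pi i\alpha_2}+s_2e^{-2\pi i\alpha_1}+s_3e^{2\pi i\delta}=0$ (these are the off-diagonal entries of upper triangular monodromy matrices $\begin{pmatrix}e^{-2\pi i\alpha_j}&s_j\\0&e^{2\pi i\alpha_j}\end{pmatrix}$). Let $f(\lambda)=(\lambda-\lambda_1)^{\alpha_1}(\lambda-\lambda_2)^{\alpha_2}(\lambda-\lambda_3)^{\alpha_3}$ be analytic off the broken line, with $\arg(\lambda-\lambda_j)\to\pi$ as $\lambda\to-\infty$. The weight is $$g(\lambda)=\begin{cases}s_1f_+(\lambda)f_-(\lambda),&\lambda\in(\lambda_1,\lambda_2),\\-s_3e^{2\pi i\delta}f_+(\lambda)f_-(\lambda),&\lambda\in(\lambda_2,\lambda_3),\end{cases}$$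 and $\phi_k=-\frac1{2\pi i}\int_{\lambda_1}^{\lambda_3}g(\zeta)\zeta^{k-1}d\zeta$, $k\ge1$, the integral being along $[\lambda_1,\lambda_2]\cup[\lambda_2,\lambda_3]$. For $m\ge1$, $\triangle_m=\det\{\phi_{i+j-1}\}_{i,j=1}^m$. Riemann–Hilbert problem: find a $2\times2$ matrix function $\Phi(\lambda)$ holomorphic in $\mathbb C\setminus([\lambda_1,\lambda_2]\cup[\lambda_2,\lambda_3])$ such that (1) $\Phi(\lambda)=(I+O(\lambda^{-1}))\lambda^{n\sigma_3}$ as $\lambda\to\infty$; (2) $\Phi(\lambda)$ is bounded as $\lambda\to\lambda_j$, $j=1,2,3$; (3) $\Phi_+(\lambda)=\Phi_-(\lambda)(I+g(\lambda)\sigma_+)$ for $\lambda\in(\lambda_1,\lambda_2)\cup(\lambda_2,\lambda_3)$. *)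

theory Defs
  imports
    "HOL-Complex_Analysis.Complex_Analysis"
    "Jordan_Normal_Form.Determinant"
begin

text \<open>
  Both \<^const>\<open>Finite_Cartesian_Product.vec_nth\<close> and the indexing of Jordan-Normal-Form vectors
  are written with a dollar sign; only the former is used below.
\<close>
no_notation Matrix.vec_index (infixl "$" 100)

definition short_line :: "complex \<Rightarrow> complex set" where
  "short_line x = closed_segment 0 x \<union> closed_segment x 1"

definition broken_line :: "complex \<Rightarrow> complex set" where
  "broken_line x = short_line x \<union> complex_of_real ` {1..}"

text \<open>
  The open half-planes to the left and to the right of the oriented line from \<open>a\<close> to \<open>b\<close>.
  Near a point of an open edge of the broken line they coincide with its two sides.
\<close>
definition left_side :: "complex \<Rightarrow> complex \<Rightarrow> complex set" where
  "left_side a b = {z. Im ((z - a) / (b - a)) > 0}"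

definition right_side :: "complex \<Rightarrow> complex \<Rightarrow> complex set" where
  "right_side a b = {z. Im ((z - a) / (b - a)) < 0}"

text \<open>\<open>Im (L z)\<close> is the continuous determination of \<open>arg (z - a)\<close> that tends to \<open>\<pi>\<close> as \<open>z \<rightarrow> -\<infinity>\<close>.\<close>
definition log_branch :: "complex \<Rightarrow> complex \<Rightarrow> (complex \<Rightarrow> complex) \<Rightarrow> bool" where
  "log_branch x a L \<longleftrightarrow>
     L holomorphic_on (- broken_line x) \<and>
     (\<forall>z\<in>- broken_line x. exp (L z) = z - a) \<and>
     ((\<lambda>t. Im (L (complex_of_real t))) \<longlongrightarrow> pi) at_bot"

text \<open>
  The product of the powers, with each \<open>(z - a)\<^sup>\<alpha>\<close> read as \<open>exp (\<alpha> log (z - a))\<close>. This determines \<open>f\<close> uniquely off the broken line; the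
  values on the line itself are irrelevant, since only one-sided limits there are used.
\<close>
definition power_product ::
    "complex \<Rightarrow> complex \<Rightarrow> complex \<Rightarrow> complex \<Rightarrow> (complex \<Rightarrow> complex) \<Rightarrow> bool" where
  "power_product x \<alpha>1 \<alpha>2 \<alpha>3 f \<longleftrightarrow>
     (\<exists>L1 L2 L3. log_branch x 0 L1 \<and> log_branch x x L2 \<and> log_branch x 1 L3 \<and>
        (\<forall>z\<in>- broken_line x. f z = exp (\<alpha>1 * L1 z) * exp (\<alpha>2 * L2 z) * exp (\<alpha>3 * L3 z)))"

text \<open>The value \<open>0\<close> off the two open edges is a dummy.\<close>
definition weight ::
    "complex \<Rightarrow> complex \<Rightarrow> complex \<Rightarrow> complex \<Rightarrow> (complex \<Rightarrow> complex) \<Rightarrow> complex \<Rightarrow> complex" where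
  "weight x \<delta> s1 s3 f z =
     (if z \<in> open_segment 0 x then
        s1 * Lim (at z within left_side 0 x) f * Lim (at z within right_side 0 x) f
      else if z \<in> open_segment x 1 then
        - s3 * exp (2 * pi * \<i> * \<delta>) *
          Lim (at z within left_side x 1) f * Lim (at z within right_side x 1) f
      else 0)"

definition moment :: "complex \<Rightarrow> (complex \<Rightarrow> complex) \<Rightarrow> nat \<Rightarrow> complex" where
  "moment x g k =
     - (1 / (2 * pi * \<i>)) *
       contour_integral (linepath 0 x +++ linepath x 1) (\<lambda>\<zeta>. g \<zeta> * \<zeta> ^ (k - 1))"

text \<open>Matrix indices start at \<open>0\<close> here, so \<open>\<phi>\<close> with index \<open>i + j - 1\<close> becomes \<open>\<phi>\<close> with index \<open>i + j + 1\<close>.\<close>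
definition hankel :: "complex \<Rightarrow> (complex \<Rightarrow> complex) \<Rightarrow> nat \<Rightarrow> complex" where
  "hankel x g m = Determinant.det (Matrix.mat m m (\<lambda>(i, j). moment x g (i + j + 1)))"

definition mat2 :: "complex \<Rightarrow> complex \<Rightarrow> complex \<Rightarrow> complex \<Rightarrow> complex^2^2" where
  "mat2 a b c d = vector [vector [a, b], vector [c, d]]"

text \<open>
  Boundary values are limits over the full one-sided neighbourhoods, required to exist at every
  point of the open edge.
\<close>
definition has_jump ::
    "complex \<Rightarrow> complex \<Rightarrow> (complex \<Rightarrow> complex) \<Rightarrow> (complex \<Rightarrow> complex^2^2) \<Rightarrow> bool" where
  "has_jump a b g \<Phi> \<longleftrightarrow>
     (\<forall>z\<in>open_segment a b. \<exists>\<Phi>p \<Phi>m.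
        (\<Phi> \<longlongrightarrow> \<Phi>p) (at z within left_side a b) \<and>
        (\<Phi> \<longlongrightarrow> \<Phi>m) (at z within right_side a b) \<and>
        \<Phi>p = \<Phi>m ** mat2 1 (g z) 0 1)"

definition solves_RHP ::
    "nat \<Rightarrow> complex \<Rightarrow> (complex \<Rightarrow> complex) \<Rightarrow> (complex \<Rightarrow> complex^2^2) \<Rightarrow> bool" where
  "solves_RHP n x g \<Phi> \<longleftrightarrow>
     (\<forall>i j. (\<lambda>z. \<Phi> z $ i $ j) holomorphic_on (- short_line x)) \<and>
     (\<exists>E. (\<lambda>z. norm (E z)) \<in> O[at_infinity](\<lambda>z. 1 / norm z) \<and>
        (\<forall>\<^sub>F z in at_infinity.
           \<Phi> z = (Finite_Cartesian_Product.mat 1 + E z) ** mat2 (z ^ n) 0 0 (inverse (z ^ n)))) \<and>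
     (\<forall>a\<in>{0, x, 1}. Bfun \<Phi> (at a within - short_line x)) \<and>
     has_jump 0 x g \<Phi> \<and> has_jump x 1 g \<Phi>"

lemma ratio_nonpos:
  fixes z a b :: complex
  assumes "(z - a) / (z - b) \<in> \<real>\<^sub>\<le>\<^sub>0"
  shows "z \<in> closed_segment a b"
proof (cases "z = b")
  case False
  from assms obtain r where r: "(z - a) / (z - b) = of_real r" "r \<le> 0"
    by (auto elim!: nonpos_Reals_cases)
  hence eq: "z - a = of_real r * (z - b)" using False by (simp add: field_simps)
  define u where "u = 1 / (1 - r)"
  have u: "0 \<le> u" "u \<le> 1" "u * (1 - r) = 1" using r(2) by (auto simp: u_def field_simps)
  have "z * of_real (1 - r) = a - of_real r * b" using eq by (simp add: algebra_simps)
  moreover have "of_real (1 - r) * of_real u = (1::complex)"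
    using u(3) by (metis mult.commute of_real_1 of_real_mult)
  ultimately have "z = (a - of_real r * b) * of_real u"
    by (metis mult.assoc mult.right_neutral)
  also have "\<dots> = of_real u * a + of_real (- r * u) * b"
    by (simp add: algebra_simps)
  also have "- r * u = 1 - u" using u(3) by (simp add: algebra_simps)
  finally have "z = (1 - (1 - u)) *\<^sub>R a + (1 - u) *\<^sub>R b"
    by (simp add: scaleR_conv_of_real)
  thus ?thesis unfolding closed_segment_def using u by (intro CollectI exI[of _ "1 - u"]) auto
qed simp

lemma one_minus_nonpos:
  assumes "z \<notin> broken_line x"
  shows "1 - z \<notin> \<real>\<^sub>\<le>\<^sub>0"
proof
  assume "1 - z \<in> \<real>\<^sub>\<le>\<^sub>0"
  then obtain r where r: "1 - z = of_real r" "r \<le> 0" by (auto elim!: nonpos_Reals_cases)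
  have "z = of_real (1 - r)" using r(1) by (simp add: algebra_simps)
  moreover have "1 - r \<in> {1..}" using r(2) by simp
  ultimately have "z \<in> complex_of_real ` {1..}" by blast
  thus False using assms by (simp add: broken_line_def)
qed

lemma Im_Ln_ratio_tendsto:
  fixes a b :: complex
  shows "((\<lambda>t. Im (Ln ((of_real t - a) / (of_real t - b)))) \<longlongrightarrow> 0) at_bot"
proof -
  have inf: "filterlim (\<lambda>t. complex_of_real t - b) at_infinity at_bot"
  proof -
    have "filterlim (\<lambda>t. norm (complex_of_real t)) at_top at_bot"
      unfolding norm_of_real filterlim_at_bot_mirror abs_minus_cancel
      by (rule filterlim_abs_real)
    hence "filterlim complex_of_real at_infinity at_bot"
      by (rule filterlim_norm_at_top_imp_at_infinity)
    thus ?thesis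
      using tendsto_add_filterlim_at_infinity'[OF _ tendsto_const, of complex_of_real at_bot "- b"]
      by simp
  qed
  have "((\<lambda>t. (b - a) / (complex_of_real t - b)) \<longlongrightarrow> 0) at_bot"
    by (rule tendsto_divide_0[OF tendsto_const inf])
  hence "((\<lambda>t. 1 + (b - a) / (complex_of_real t - b)) \<longlongrightarrow> 1 + 0) at_bot"
    by (intro tendsto_intros)
  moreover have "\<forall>\<^sub>F t in at_bot. complex_of_real t - b \<noteq> 0"
    using filterlim_at_infinity_imp_eventually_ne[OF inf, of 0] by simp
  hence "\<forall>\<^sub>F t in at_bot. 1 + (b - a) / (complex_of_real t - b) = (of_real t - a) / (of_real t - b)"
    by eventually_elim (simp add: field_simps)
  ultimately have "((\<lambda>t. (of_real t - a) / (of_real t - b)) \<longlongrightarrow> (1::complex)) at_bot"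
    using tendsto_cong by force
  hence "((\<lambda>t. Im (Ln ((of_real t - a) / (of_real t - b)))) \<longlongrightarrow> Im (Ln 1)) at_bot"
    by (intro tendsto_Im tendsto_Ln) auto
  thus ?thesis by simp
qed

lemma log_branch_1: "log_branch x 1 (\<lambda>z. Ln (1 - z) + \<i> * pi)"
  unfolding log_branch_def
proof (intro conjI ballI)
  show "(\<lambda>z. Ln (1 - z) + \<i> * pi) holomorphic_on - broken_line x"
    by (intro holomorphic_intros) (auto dest: one_minus_nonpos)
  show "exp (Ln (1 - z) + \<i> * pi) = z - 1" if "z \<in> - broken_line x" for z
  proof -
    have "1 - z \<noteq> 0" using that one_minus_nonpos[of z x] by auto
    thus ?thesis by (simp add: exp_add mult.commute[of \<i>])
  qed
  have "\<forall>\<^sub>F t in at_bot. Im (Ln (1 - complex_of_real t) + \<i> * pi) = pi"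
    using eventually_le_at_bot[of 0]
  proof eventually_elim
    case (elim t)
    have "Ln (complex_of_real (1 - t)) = of_real (ln (1 - t))"
      using elim by (intro Ln_of_real) auto
    hence "Im (Ln (1 - complex_of_real t)) = 0" by simp
    thus ?case by simp
  qed
  thus "((\<lambda>t. Im (Ln (1 - complex_of_real t) + \<i> * pi)) \<longlongrightarrow> pi) at_bot"
    by (rule tendsto_eventually)
qed

lemma log_branch_step:
  assumes L: "log_branch x b L"
    and sub: "closed_segment a b \<subseteq> broken_line x"
  shows "log_branch x a (\<lambda>z. Ln ((z - a) / (z - b)) + L z)"
  unfolding log_branch_def
proof (intro conjI ballI)
  have nz: "z \<noteq> a \<and> z \<noteq> b \<and> (z - a) / (z - b) \<notin> \<real>\<^sub>\<le>\<^sub>0" if "z \<in> - broken_line x" for z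
    using that sub ratio_nonpos by fastforce
  show "(\<lambda>z. Ln ((z - a) / (z - b)) + L z) holomorphic_on - broken_line x"
    using L nz by (auto simp: log_branch_def intro!: holomorphic_intros)
  show "exp (Ln ((z - a) / (z - b)) + L z) = z - a" if "z \<in> - broken_line x" for z
    using L nz[OF that] that by (simp add: exp_add log_branch_def)
  have "((\<lambda>t. Im (Ln ((of_real t - a) / (of_real t - b))) + Im (L (of_real t))) \<longlongrightarrow> 0 + pi) at_bot"
    using L by (intro tendsto_add Im_Ln_ratio_tendsto) (simp add: log_branch_def)
  thus "((\<lambda>t. Im (Ln ((of_real t - a) / (of_real t - b)) + L (of_real t))) \<longlongrightarrow> pi) at_bot"
    by simp
qed

lemma power_product_exists: "\<exists>f. power_product x \<alpha>1 \<alpha>2 \<alpha>3 f"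
proof -
  obtain L3 where L3: "log_branch x 1 L3" using log_branch_1 by blast
  then obtain L2 where L2: "log_branch x x L2"
    using log_branch_step[of x 1 L3 x] by (auto simp: broken_line_def short_line_def)
  then obtain L1 where L1: "log_branch x 0 L1"
    using log_branch_step[of x x L2 0] by (auto simp: broken_line_def short_line_def)
  have "power_product x \<alpha>1 \<alpha>2 \<alpha>3
      (\<lambda>z. exp (\<alpha>1 * L1 z) * exp (\<alpha>2 * L2 z) * exp (\<alpha>3 * L3 z))"
    unfolding power_product_def using L1 L2 L3 by blast
  thus ?thesis by blast
qed

end

theory Submission imports Defs begin

text \<open>
  Let \<open>\<Lambda> q\<close> be the integral of \<open>g q\<close> along the two edges. On each edge \<open>g\<close> is a constant multiple of a
  branch of \<open>\<zeta>\<^sup>2\<^sup>\<alpha>\<^sup>1 (\<zeta> - x)\<^sup>2\<^sup>\<alpha>\<^sup>2 (\<zeta> - 1)\<^sup>2\<^sup>\<alpha>\<^sup>3\<close>, because the two one-sided limits of \<open>f\<close> are multiples of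
  one and the same branch (\<open>boundary_value_product\<close>). With \<open>W = \<zeta> (\<zeta> - x) (\<zeta> - 1)\<close> this gives
  \<open>(W g)' = V g\<close> for a polynomial \<open>V\<close> of degree at most two, and \<open>W g\<close> vanishes at the three endpoints. Hence
  \<open>\<Lambda> (W q' + V q) = 0\<close> for every polynomial \<open>q\<close> (\<open>pearson\<close>), which says exactly that the Heun operator
  \<open>L p = W p'' + V p'\<close> is symmetric for the bilinear form \<open>\<Lambda> (p q)\<close>.

  A null vector of the Hankel matrix of size \<open>n + 1\<close> is a polynomial \<open>p\<close> orthogonal to all
  polynomials of degree at most \<open>n\<close>; since the Hankel determinant of size \<open>n\<close> does not vanish, \<open>p\<close> has degree
  exactly \<open>n\<close>. The operator \<open>L\<close> raises degrees by at most one, so by symmetry \<open>L p\<close> is orthogonal to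
  all polynomials of degree less than \<open>n\<close>. So is \<open>(a \<zeta> + b) p\<close>, and \<open>a\<close> and \<open>b\<close> can be chosen such that
  \<open>L p - (a \<zeta> + b) p\<close> has degree less than \<open>n\<close>. Again by the Hankel determinant of size \<open>n\<close> this difference is
  zero, and \<open>L p = (a \<zeta> + b) p\<close> is the Heun equation (\<open>orthogonal_polynomial_heun\<close>).

  The solution of the Riemann--Hilbert problem has the rows \<open>(p, C p)\<close> and \<open>(q, C q)\<close>, where \<open>C r\<close> is the Cauchy
  transform of \<open>g r\<close> and \<open>q\<close> has degree less than \<open>n\<close>, is orthogonal to lower powers than \<open>\<zeta>\<^sup>n\<^sup>-\<^sup>1\<close> and is
  normalised against that one (\<open>RHP_solution\<close>). The jump is the Plemelj formula \<open>plemelj_jump\<close>, and orthogonality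
  is the decay at infinity. The delicate point is boundedness at the endpoints: if
  \<open>Re \<alpha>\<^sub>j = 0\<close>, then \<open>g\<close> does not tend to zero there but oscillates. Near an endpoint the Cauchy
  transform of \<open>t\<^sup>\<mu>\<close> differs by a holomorphic function from a multiple of the branch of \<open>w\<^sup>\<mu>\<close> cut along the
  edge, which is bounded; that multiple exists because \<open>\<mu> = 2 \<alpha>\<^sub>j\<close> is not an integer
  (\<open>cauchy_transform_bounded_at_0\<close>).

  For uniqueness, the \<open>2 \<times> 2\<close> determinants formed from a row of one solution and a row of another are entire
  with known limits at infinity, hence constant (\<open>RHP_bracket_constant\<close>); expanding the rows of one
  solution in those of the other then shows that the solutions agree.
\<close>

no_notation fps_nth (infixl "$" 75)

section \<open>Cauchy transforms of bounded densities on the unit interval\<close>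

abbreviation unit_leb :: "real measure" where
  "unit_leb \<equiv> lebesgue_on {0<..<1}"

definition bounded_density :: "(real \<Rightarrow> complex) \<Rightarrow> bool" where
  "bounded_density \<rho> \<longleftrightarrow>
     \<rho> \<in> borel_measurable unit_leb \<and> (\<exists>B. \<forall>t\<in>{0<..<1}. norm (\<rho> t) \<le> B)"

definition cauchy_transform :: "(real \<Rightarrow> complex) \<Rightarrow> complex \<Rightarrow> complex" where
  "cauchy_transform \<rho> w = (\<integral>t. \<rho> t / (of_real t - w) \<partial>unit_leb)"

lemma bounded_densityI:
  assumes "\<rho> \<in> borel_measurable unit_leb" "\<And>t. t \<in> {0<..<1} \<Longrightarrow> norm (\<rho> t) \<le> B"
  shows "bounded_density \<rho>"
  using assms unfolding bounded_density_def by blast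

abbreviation unit_segment :: "complex set" where
  "unit_segment \<equiv> complex_of_real ` {0..1}"

lemma finite_measure_unit_leb: "finite_measure unit_leb"
  by (intro finite_measureI) (simp add: emeasure_restrict_space)

lemma measure_unit_leb [simp]: "measure unit_leb {0<..<1} = 1"
  by (simp add: measure_restrict_space)

lemma measurable_continuous_unit_leb:
  fixes f :: "real \<Rightarrow> complex"
  shows "continuous_on {0<..<1} f \<Longrightarrow> f \<in> borel_measurable unit_leb"
  by (rule continuous_imp_measurable_on_sets_lebesgue) auto

lemma measurable_of_real_unit_leb [measurable]: "complex_of_real \<in> borel_measurable unit_leb"
  by (intro measurable_continuous_unit_leb continuous_intros)

lemma AE_unit_leb_neq: "AE t in unit_leb. t \<noteq> c"
proof -
  have "AE t in lebesgue. t \<noteq> c"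
    by (rule AE_completion) (rule AE_lborel_singleton)
  thus ?thesis by (subst AE_restrict_space_iff) auto
qed

lemma bounded_density_integrable:
  assumes "bounded_density \<rho>"
  shows "integrable unit_leb \<rho>"
proof -
  interpret finite_measure unit_leb by (rule finite_measure_unit_leb)
  from assms obtain B where "\<rho> \<in> borel_measurable unit_leb" "\<forall>t\<in>{0<..<1}. norm (\<rho> t) \<le> B"
    by (auto simp: bounded_density_def)
  thus ?thesis by (intro integrable_const_bound[of _ B]) auto
qed

lemma unit_leb_integral_bound:
  assumes "\<rho> \<in> borel_measurable unit_leb" "\<And>t. t \<in> {0<..<1} \<Longrightarrow> norm (\<rho> t) \<le> B"
  shows "norm (\<integral>t. (\<rho> t :: complex) \<partial>unit_leb) \<le> B"
proof -
  interpret finite_measure unit_leb by (rule finite_measure_unit_leb)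
  have "bounded_density \<rho>" using assms by (rule bounded_densityI)
  hence "norm (\<integral>t. \<rho> t \<partial>unit_leb) \<le> (\<integral>t. B \<partial>unit_leb)"
    by (intro Bochner_Integration.integral_norm_bound_integral bounded_density_integrable integrable_const) (use assms in auto)
  thus ?thesis by simp
qed

text \<open>
  The exceptional point \<open>c\<close> is there for difference quotients in \<open>t\<close>, whose limit is not controlled where
  the denominator vanishes.
\<close>
lemma unit_leb_dominated_convergence:
  fixes f :: "complex \<Rightarrow> real \<Rightarrow> complex"
  assumes meas: "\<forall>\<^sub>F w in at a within S. f w \<in> borel_measurable unit_leb"
    and bound: "\<forall>\<^sub>F w in at a within S. \<forall>t\<in>{0<..<1}. norm (f w t) \<le> B"
    and lim: "\<And>t. t \<in> {0<..<1} \<Longrightarrow> t \<noteq> c \<Longrightarrow> ((\<lambda>w. f w t) \<longlongrightarrow> l t) (at a within S)"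
    and l: "l \<in> borel_measurable unit_leb"
  shows "((\<lambda>w. \<integral>t. f w t \<partial>unit_leb) \<longlongrightarrow> (\<integral>t. l t \<partial>unit_leb)) (at a within S)"
  unfolding tendsto_at_iff_sequentially comp_def
proof (intro allI impI)
  interpret finite_measure unit_leb by (rule finite_measure_unit_leb)
  fix X assume X: "\<forall>i. X i \<in> S - {a}" "X \<longlonglongrightarrow> a"
  hence filt: "filterlim X (at a within S) sequentially"
    by (auto simp: filterlim_at intro!: always_eventually)
  have "\<forall>\<^sub>F i in sequentially. f (X i) \<in> borel_measurable unit_leb \<and>
          (\<forall>t\<in>{0<..<1}. norm (f (X i) t) \<le> B)"
    using meas bound filt unfolding filterlim_iff by (auto intro: eventually_conj)
  then obtain N where N: "\<And>i. i \<ge> N \<Longrightarrow> f (X i) \<in> borel_measurable unit_leb"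
      "\<And>i t. i \<ge> N \<Longrightarrow> t \<in> {0<..<1} \<Longrightarrow> norm (f (X i) t) \<le> B"
    unfolding eventually_sequentially by blast
  have "(\<lambda>i. \<integral>t. f (X (i + N)) t \<partial>unit_leb) \<longlonglongrightarrow> (\<integral>t. l t \<partial>unit_leb)"
  proof (rule integral_dominated_convergence[where w = "\<lambda>_. B"])
    show "AE t in unit_leb. (\<lambda>i. f (X (i + N)) t) \<longlonglongrightarrow> l t"
    proof (use AE_unit_leb_neq[of c] AE_space in eventually_elim)
      case (elim t)
      hence "((\<lambda>w. f w t) \<longlongrightarrow> l t) (at a within S)" by (intro lim) auto
      from filterlim_compose[OF this filt] show ?case by (rule LIMSEQ_ignore_initial_segment)
    qed
    show "AE t in unit_leb. norm (f (X (i + N)) t) \<le> B" for i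
      using AE_space by eventually_elim (auto intro: N)
  qed (use N l in auto)
  thus "(\<lambda>i. \<integral>t. f (X i) t \<partial>unit_leb) \<longlonglongrightarrow> (\<integral>t. l t \<partial>unit_leb)"
    by (rule LIMSEQ_offset)
qed

lemma open_Compl_unit_segment: "open (- unit_segment)"
  by (intro open_Compl compact_imp_closed compact_continuous_image continuous_intros) auto

lemma holomorphic_on_imp_isCont:
  "f holomorphic_on S \<Longrightarrow> open S \<Longrightarrow> z \<in> S \<Longrightarrow> isCont f z"
  by (metis at_within_open continuous_on_eq_continuous_within holomorphic_on_imp_continuous_on)

lemma unit_segment_distance:
  assumes "w \<notin> unit_segment"
  obtains d where "d > 0" "\<And>t z. t \<in> {0<..<1} \<Longrightarrow> dist w z < d \<Longrightarrow> norm (of_real t - z) \<ge> d"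
proof -
  obtain e where e: "e > 0" "ball w e \<subseteq> - unit_segment"
    using assms open_Compl_unit_segment by (meson ComplI openE)
  show ?thesis
  proof (rule that[of "e / 2"])
    fix t z assume tz: "t \<in> {0<..<1::real}" "dist w z < e / 2"
    have "complex_of_real t \<in> unit_segment" using tz by auto
    hence "complex_of_real t \<notin> ball w e" using e(2) by blast
    hence "dist w (of_real t) \<ge> e" by simp
    moreover have "dist w (of_real t) \<le> dist w z + dist z (of_real t)" by (rule dist_triangle)
    ultimately show "norm (of_real t - z) \<ge> e / 2"
      using tz by (simp add: dist_norm norm_minus_commute)
  qed (use e in auto)
qed

lemma bounded_density_kernel:
  assumes "bounded_density \<rho>" "w \<notin> unit_segment"
  shows "bounded_density (\<lambda>t. \<rho> t / (of_real t - w))"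
proof -
  obtain B where [measurable]: "\<rho> \<in> borel_measurable unit_leb" and B': "\<forall>t\<in>{0<..<1}. norm (\<rho> t) \<le> B"
    using assms(1) unfolding bounded_density_def by blast
  note B = B'[rule_format]
  obtain d where d: "d > 0" "\<And>t z. t \<in> {0<..<1} \<Longrightarrow> dist w z < d \<Longrightarrow> norm (of_real t - z) \<ge> d"
    using unit_segment_distance[OF assms(2)] by metis
  have "norm (\<rho> t / (of_real t - w)) \<le> B / d" if "t \<in> {0<..<1}" for t
    using B that d(2)[OF that, of w] d(1) unfolding norm_divide
    by (intro frac_le) (auto intro: order_trans[OF norm_ge_zero])
  thus ?thesis unfolding bounded_density_def by (auto intro!: exI[of _ "B / d"])
qed

lemma cauchy_transform_holomorphic:
  assumes \<rho>: "bounded_density \<rho>"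
  shows "cauchy_transform \<rho> holomorphic_on - unit_segment"
  unfolding holomorphic_on_def field_differentiable_def
proof
  fix w assume "w \<in> - unit_segment"
  hence w: "w \<notin> unit_segment" by simp
  obtain B where [measurable]: "\<rho> \<in> borel_measurable unit_leb" and B': "\<forall>t\<in>{0<..<1}. norm (\<rho> t) \<le> B"
    using \<rho> unfolding bounded_density_def by blast
  note B = B'[rule_format]
  obtain d where d: "d > 0" "\<And>t z. t \<in> {0<..<1} \<Longrightarrow> dist w z < d \<Longrightarrow> norm (of_real t - z) \<ge> d"
    using unit_segment_distance[OF w] by metis
  define D where "D = (\<integral>t. \<rho> t / (of_real t - w) / (of_real t - w) \<partial>unit_leb)"
  have ev: "\<forall>\<^sub>F z in at w. dist w z < d"
    using d(1) by (auto simp: eventually_at dist_commute)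
  have ev': "\<forall>\<^sub>F z in at w. z \<notin> unit_segment"
    using open_Compl_unit_segment w by (auto simp: eventually_at_topological)
  have "((\<lambda>z. \<integral>t. \<rho> t / (of_real t - w) / (of_real t - z) \<partial>unit_leb) \<longlongrightarrow> D) (at w)"
    unfolding D_def
  proof (rule unit_leb_dominated_convergence[where c = 0 and B = "B / d / d"])
    show "\<forall>\<^sub>F z in at w. \<forall>t\<in>{0<..<1}. norm (\<rho> t / (of_real t - w) / (of_real t - z)) \<le> B / d / d"
      using ev
    proof eventually_elim
      case (elim z)
      show ?case
      proof
        fix t :: real assume t: "t \<in> {0<..<1}"
        show "norm (\<rho> t / (of_real t - w) / (of_real t - z)) \<le> B / d / d"
          unfolding norm_divide
          using B[OF t] d(1) d(2)[OF t elim] d(2)[OF t, of w]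
          by (intro frac_le divide_nonneg_nonneg) (auto intro: order_trans[OF norm_ge_zero])
      qed
    qed
    show "((\<lambda>z. \<rho> t / (of_real t - w) / (of_real t - z)) \<longlongrightarrow> \<rho> t / (of_real t - w) / (of_real t - w)) (at w)"
      if "t \<in> {0<..<1}" for t
      using d(2)[OF that, of w] d(1) by (intro tendsto_intros) auto
  qed auto
  moreover have "\<forall>\<^sub>F z in at w. (\<integral>t. \<rho> t / (of_real t - w) / (of_real t - z) \<partial>unit_leb) =
      (cauchy_transform \<rho> z - cauchy_transform \<rho> w) / (z - w)"
    using ev ev' eventually_neq_at_within[of w w UNIV]
  proof eventually_elim
    case (elim z)
    have "cauchy_transform \<rho> z - cauchy_transform \<rho> w =
        (\<integral>t. \<rho> t / (of_real t - z) - \<rho> t / (of_real t - w) \<partial>unit_leb)"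
      unfolding cauchy_transform_def
      by (intro Bochner_Integration.integral_diff[symmetric] bounded_density_integrable
            bounded_density_kernel \<rho> w elim)
    also have "\<dots> = (\<integral>t. (z - w) * (\<rho> t / (of_real t - w) / (of_real t - z)) \<partial>unit_leb)"
    proof (intro Bochner_Integration.integral_cong refl)
      fix t assume "t \<in> space unit_leb"
      hence "of_real t - z \<noteq> 0" "of_real t - w \<noteq> 0"
        using d(1) d(2)[of t z] d(2)[of t w] elim by auto
      thus "\<rho> t / (of_real t - z) - \<rho> t / (of_real t - w) =
          (z - w) * (\<rho> t / (of_real t - w) / (of_real t - z))"
        by (simp add: divide_simps) (simp add: algebra_simps)
    qed
    also have "\<dots> = (z - w) * (\<integral>t. \<rho> t / (of_real t - w) / (of_real t - z) \<partial>unit_leb)"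
      by (rule integral_mult_right_zero)
    finally have eq: "cauchy_transform \<rho> z - cauchy_transform \<rho> w =
        (z - w) * (\<integral>t. \<rho> t / (of_real t - w) / (of_real t - z) \<partial>unit_leb)" .
    have "z - w \<noteq> 0" using elim by simp
    thus ?case unfolding eq by (rule nonzero_mult_div_cancel_left[symmetric])
  qed
  ultimately have "((\<lambda>z. (cauchy_transform \<rho> z - cauchy_transform \<rho> w) / (z - w)) \<longlongrightarrow> D) (at w)"
    using tendsto_cong by force
  hence "(cauchy_transform \<rho> has_field_derivative D) (at w)"
    by (simp add: has_field_derivative_iff)
  thus "\<exists>D. (cauchy_transform \<rho> has_field_derivative D) (at w within - unit_segment)"
    using has_field_derivative_at_within by blast
qed

lemma bounded_density_times_bounded:
  assumes "bounded_density \<rho>" "continuous_on {0..1} q"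
  shows "bounded_density (\<lambda>t. q t * \<rho> t)"
proof -
  have "compact (q ` {0..1})" using assms(2) by (intro compact_continuous_image) auto
  then obtain C where C: "\<And>t. t \<in> {0..1} \<Longrightarrow> norm (q t) \<le> C"
    using compact_imp_bounded bounded_iff by (metis imageI)
  obtain B where [measurable]: "\<rho> \<in> borel_measurable unit_leb" and B': "\<forall>t\<in>{0<..<1}. norm (\<rho> t) \<le> B"
    using assms(1) unfolding bounded_density_def by blast
  note B = B'[rule_format]
  have [measurable]: "q \<in> borel_measurable unit_leb"
    by (rule measurable_continuous_unit_leb) (rule continuous_on_subset[OF assms(2)], auto)
  have *: "norm (q t * \<rho> t) \<le> C * B" if "t \<in> {0<..<1}" for t
    unfolding norm_mult using C[of t] B[OF that] that
    by (intro mult_mono) (auto intro: order_trans[OF norm_ge_zero])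
  show ?thesis by (rule bounded_densityI[OF _ *]) simp_all
qed

text \<open>
  Since \<open>t / (t - w) = 1 + w / (t - w)\<close>, multiplying the density by the variable multiplies the transform by
  \<open>w\<close> up to a moment. Iterated, this turns vanishing moments into decay at infinity.
\<close>
lemma cauchy_transform_mult_of_real:
  assumes \<rho>: "bounded_density \<rho>" and w: "w \<notin> unit_segment"
  shows "cauchy_transform (\<lambda>t. of_real t * \<rho> t) w = w * cauchy_transform \<rho> w + (\<integral>t. \<rho> t \<partial>unit_leb)"
proof -
  have "w * cauchy_transform \<rho> w + (\<integral>t. \<rho> t \<partial>unit_leb)
      = (\<integral>t. w * (\<rho> t / (of_real t - w)) \<partial>unit_leb) + (\<integral>t. \<rho> t \<partial>unit_leb)"
    unfolding cauchy_transform_def by (subst integral_mult_right_zero) (rule refl)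
  also have "\<dots> = (\<integral>t. w * (\<rho> t / (of_real t - w)) + \<rho> t \<partial>unit_leb)"
    by (intro Bochner_Integration.integral_add[symmetric] integrable_mult_right
          bounded_density_integrable bounded_density_kernel \<rho> w)
  also have "\<dots> = cauchy_transform (\<lambda>t. of_real t * \<rho> t) w"
    unfolding cauchy_transform_def
  proof (intro Bochner_Integration.integral_cong refl)
    fix t :: real assume t: "t \<in> space unit_leb"
    hence "complex_of_real t \<in> unit_segment" by auto
    hence "of_real t - w \<noteq> 0" using w by auto
    thus "w * (\<rho> t / (of_real t - w)) + \<rho> t = of_real t * \<rho> t / (of_real t - w)"
      by (simp add: field_simps)
  qed
  finally show ?thesis by simp
qed

lemma cauchy_transform_bounded_far:
  assumes "bounded_density \<rho>"
  obtains B where "\<And>w. norm w \<ge> 2 \<Longrightarrow> norm (cauchy_transform \<rho> w) \<le> B"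
proof -
  obtain B where [measurable]: "\<rho> \<in> borel_measurable unit_leb" and B': "\<forall>t\<in>{0<..<1}. norm (\<rho> t) \<le> B"
    using assms unfolding bounded_density_def by blast
  note B = B'[rule_format]
  show ?thesis
  proof (rule that[of B])
    fix w :: complex assume w: "norm w \<ge> 2"
    show "norm (cauchy_transform \<rho> w) \<le> B" unfolding cauchy_transform_def
    proof (rule unit_leb_integral_bound)
      fix t :: real assume t: "t \<in> {0<..<1}"
      have "norm w \<le> norm (of_real t - w) + norm (complex_of_real t)"
        using norm_triangle_ineq4[of "of_real t" "of_real t - w"] by simp
      hence "norm (of_real t - w) \<ge> 1" using t w by simp
      hence "norm (\<rho> t) / norm (of_real t - w) \<le> norm (\<rho> t) / 1"
        by (intro divide_left_mono) auto
      thus "norm (\<rho> t / (of_real t - w)) \<le> B" using B[OF t] by (simp add: norm_divide)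
    qed auto
  qed
qed

section \<open>Holomorphic extension across a line\<close>
lemma right_side_eq_left_side: "a \<noteq> b \<Longrightarrow> right_side a b = left_side b a"
proof -
  assume "a \<noteq> b"
  hence "(z - b) / (a - b) = 1 - (z - a) / (b - a)" for z
    by (simp add: field_simps)
  thus ?thesis by (simp add: right_side_def left_side_def)
qed

lemma left_side_islimpt:
  assumes "a \<noteq> b" "Im ((z - a) / (b - a)) = 0"
  shows "at z within left_side a b \<noteq> bot"
proof -
  have "z islimpt left_side a b"
    unfolding islimpt_approachable
  proof (intro allI impI)
    fix e :: real assume e: "e > 0"
    define r where "r = e / (2 * norm (b - a))"
    have r: "r > 0" using e assms(1) by (simp add: r_def)
    define z' where "z' = z + of_real r * \<i> * (b - a)"
    have "(z' - a) / (b - a) = (z - a) / (b - a) + of_real r * \<i>"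
      using assms(1) by (simp add: z'_def field_simps)
    hence "z' \<in> left_side a b" using assms(2) r by (simp add: left_side_def)
    moreover have "dist z' z = r * norm (b - a)"
      using r by (simp add: z'_def dist_norm norm_mult)
    hence "dist z' z = e / 2" using assms(1) by (simp add: r_def)
    ultimately show "\<exists>x'\<in>left_side a b. x' \<noteq> z \<and> dist x' z < e"
      using e by (intro bexI[of _ z']) auto
  qed
  thus ?thesis by (simp add: trivial_limit_within)
qed

lemma right_side_islimpt:
  assumes "a \<noteq> b" "Im ((z - a) / (b - a)) = 0"
  shows "at z within right_side a b \<noteq> bot"
proof -
  have "(z - b) / (a - b) = 1 - (z - a) / (b - a)"
    using assms(1) by (simp add: field_simps)
  hence "Im ((z - b) / (a - b)) = 0" using assms(2) by simp
  thus ?thesis using left_side_islimpt[of b a z] assms(1) by (simp add: right_side_eq_left_side)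
qed

lemma side_inner:
  assumes "a \<noteq> b"
  shows "Im ((z - a) / (b - a)) = ((\<i> * (b - a)) \<bullet> z - (\<i> * (b - a)) \<bullet> a) / (norm (b - a))\<^sup>2"
  by (simp add: Im_divide cmod_power2 inner_complex_def algebra_simps)

lemma left_side_halfplane:
  assumes "a \<noteq> b"
  shows "left_side a b = {z. (\<i> * (b - a)) \<bullet> a < (\<i> * (b - a)) \<bullet> z}"
  using assms unfolding left_side_def side_inner[OF assms] by (auto simp: field_simps)

lemma right_side_halfplane:
  assumes "a \<noteq> b"
  shows "right_side a b = {z. (\<i> * (b - a)) \<bullet> z < (\<i> * (b - a)) \<bullet> a}"
  using assms unfolding right_side_def side_inner[OF assms] by (auto simp: field_simps)

text \<open>
  Bounds are proved off the line, where the functions are given explicitly; continuity carries them to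
  the line.
\<close>
lemma norm_le_on_line:
  assumes "a \<noteq> b" "Im ((z - a) / (b - a)) = 0" "isCont F z"
    and "\<forall>\<^sub>F w in at z within left_side a b. norm (F w) \<le> B"
  shows "norm (F z) \<le> B"
proof (rule tendsto_upperbound)
  show "((\<lambda>w. norm (F w)) \<longlongrightarrow> norm (F z)) (at z within left_side a b)"
    using assms(3) by (intro tendsto_norm) (auto simp: isCont_def intro: Lim_at_imp_Lim_at_within)
qed (use assms left_side_islimpt in auto)

lemma continuous_on_limit_extension:
  fixes f F :: "'a::metric_space \<Rightarrow> 'b::metric_space"
  assumes S: "open S"
    and lim: "\<And>z. z \<in> S \<Longrightarrow> (f \<longlongrightarrow> F z) (at z within P)"
    and nontriv: "\<And>z. z \<in> S \<Longrightarrow> at z within P \<noteq> bot"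
  shows "continuous_on S F"
proof (rule continuous_at_imp_continuous_on, rule ballI)
  fix z assume z: "z \<in> S"
  show "isCont F z"
    unfolding continuous_at_eps_delta
  proof (intro allI impI)
    fix e :: real assume e: "e > 0"
    have "\<forall>\<^sub>F w in at z within P. dist (f w) (F z) < e / 2"
      using lim[OF z] e by (intro tendstoD) auto
    then obtain d1 where d1: "d1 > 0"
        "\<And>w. w \<in> P \<Longrightarrow> w \<noteq> z \<Longrightarrow> dist w z < d1 \<Longrightarrow> dist (f w) (F z) < e / 2"
      unfolding eventually_at by blast
    obtain d2 where d2: "d2 > 0" "ball z d2 \<subseteq> S" using S z openE by blast
    have "dist (F w) (F z) < e" if w: "dist w z < min d1 d2" "w \<noteq> z" for w
    proof -
      have "w \<in> S" using w d2 by (auto simp: dist_commute)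
      moreover have "\<forall>\<^sub>F v in at w within P. dist (f v) (F z) \<le> e / 2"
        unfolding eventually_at_topological
      proof (intro exI[of _ "ball z d1 - {z}"] conjI ballI impI)
        fix v assume "v \<in> ball z d1 - {z}" "v \<in> P"
        thus "dist (f v) (F z) \<le> e / 2"
          using d1(2)[of v] by (simp add: dist_commute less_imp_le)
      qed (use w in \<open>auto simp: dist_commute intro: open_delete\<close>)
      ultimately have "dist (F w) (F z) \<le> e / 2"
        by (intro tendsto_upperbound[OF tendsto_dist[OF lim tendsto_const] _ nontriv]) auto
      thus ?thesis using e by simp
    qed
    thus "\<exists>d>0. \<forall>w. dist w z < d \<longrightarrow> dist (F w) (F z) < e"
      using d1(1) d2(1) e by (intro exI[of _ "min d1 d2"]) (metis dist_self min_less_iff_conj)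
  qed
qed

text \<open>
  Equal boundary values from the two sides give a continuous extension, and a continuous function that is
  holomorphic off a line is holomorphic.
\<close>
lemma holomorphic_extension_across_line:
  assumes S: "open S" and ab: "a \<noteq> b"
    and hol: "f holomorphic_on S - {z. Im ((z - a) / (b - a)) = 0}"
    and lim: "\<And>z. z \<in> S \<Longrightarrow> Im ((z - a) / (b - a)) = 0 \<Longrightarrow>
      \<exists>l. (f \<longlongrightarrow> l) (at z within left_side a b) \<and> (f \<longlongrightarrow> l) (at z within right_side a b)"
  obtains F where "F holomorphic_on S" "\<And>z. z \<in> S \<Longrightarrow> Im ((z - a) / (b - a)) \<noteq> 0 \<Longrightarrow> F z = f z"
proof -
  define P where "P = left_side a b \<union> right_side a b"
  have P: "z \<in> P \<longleftrightarrow> Im ((z - a) / (b - a)) \<noteq> 0" for z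
    by (auto simp: P_def left_side_def right_side_def)
  have openP: "open P"
    unfolding P_def left_side_halfplane[OF ab] right_side_halfplane[OF ab]
    by (intro open_Un open_halfspace_lt open_halfspace_gt)
  have holP: "f holomorphic_on S \<inter> P"
    using hol by (rule holomorphic_on_subset) (auto simp: P)
  define F where "F z = (if z \<in> P then f z else Lim (at z within P) f)" for z
  have nontriv: "at z within P \<noteq> bot" for z
  proof (cases "z \<in> P")
    case True
    show ?thesis by (subst at_within_open[OF True openP]) simp
  next
    case False
    hence "at z within left_side a b \<noteq> bot" using ab P by (intro left_side_islimpt) auto
    thus ?thesis unfolding P_def at_within_union by simp
  qed
  have limF: "(f \<longlongrightarrow> F z) (at z within P)" if z: "z \<in> S" for z
  proof (cases "z \<in> P")
    case True
    hence "isCont f z"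
      using holP S openP z by (intro continuous_on_interior[OF holomorphic_on_imp_continuous_on[OF holP]])
        (simp add: interior_open open_Int)
    thus ?thesis using True by (auto simp: F_def isCont_def intro: Lim_at_imp_Lim_at_within)
  next
    case False
    then obtain l where "(f \<longlongrightarrow> l) (at z within left_side a b)" "(f \<longlongrightarrow> l) (at z within right_side a b)"
      using lim z P by blast
    hence "(f \<longlongrightarrow> l) (at z within P)"
      unfolding P_def at_within_union by (rule filterlim_sup)
    thus ?thesis using False nontriv by (simp add: F_def tendsto_Lim)
  qed
  have cont: "continuous_on S F"
    by (rule continuous_on_limit_extension[OF S limF nontriv])
  have "F holomorphic_on S \<inter> P"
    using holP by (rule holomorphic_transform) (simp add: F_def)
  hence "F holomorphic_on S \<inter> left_side a b" "F holomorphic_on S \<inter> right_side a b"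
    by (auto simp: P_def elim!: holomorphic_on_subset)
  hence "F holomorphic_on S"
    using ab cont
    by (intro holomorphic_on_paste_across_line[OF S, of "\<i> * (b - a)" F "(\<i> * (b - a)) \<bullet> a"])
      (auto simp: left_side_halfplane right_side_halfplane)
  thus ?thesis using that[of F] by (simp add: F_def P)
qed

section \<open>The Plemelj formula\<close>
lemma left_side_0_1: "left_side 0 1 = {w. Im w > 0}" and right_side_0_1: "right_side 0 1 = {w. Im w < 0}"
  by (auto simp: left_side_def right_side_def)

lemma not_unit_segment: "Im w \<noteq> 0 \<Longrightarrow> w \<notin> unit_segment"
  by auto

text \<open>
  For non-real \<open>w\<close> the points \<open>t - w\<close> stay in one open half-plane, so \<open>Ln (t - w)\<close> is a primitive
  on the whole interval.
\<close>
lemma cauchy_transform_1: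
  assumes "Im w \<noteq> 0"
  shows "cauchy_transform (\<lambda>_. 1) w = Ln (1 - w) - Ln (- w)"
proof -
  have ni: "complex_of_real t - w \<notin> \<real>\<^sub>\<le>\<^sub>0" for t
    using assms by (auto simp: complex_nonpos_Reals_iff)
  have "((\<lambda>t. 1 / (complex_of_real t - w)) has_integral Ln (of_real 1 - w) - Ln (of_real 0 - w)) {0..1}"
  proof (rule fundamental_theorem_of_calculus)
    fix t :: real
    have "((\<lambda>t. Ln (t - w)) has_field_derivative 1 / (of_real t - w)) (at (complex_of_real t))"
      using ni by (auto intro!: derivative_eq_intros simp: divide_inverse)
    thus "((\<lambda>t. Ln (of_real t - w)) has_vector_derivative 1 / (of_real t - w)) (at t within {0..1})"
      by (rule has_vector_derivative_real_field)
  qed simp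
  hence "((\<lambda>t. 1 / (complex_of_real t - w)) has_integral Ln (1 - w) - Ln (- w)) {0<..<1}"
    by (simp add: has_integral_Icc_iff_Ioo)
  moreover have "integrable unit_leb (\<lambda>t. 1 / (complex_of_real t - w))"
    by (intro bounded_density_integrable bounded_density_kernel not_unit_segment assms bounded_densityI[of _ 1]) auto
  ultimately show ?thesis unfolding cauchy_transform_def
    by (subst lebesgue_integral_eq_integral) (auto simp: integral_unique)
qed

lemma Ln_minus_upper: "Im w > 0 \<Longrightarrow> Ln (- w) = Ln w - \<i> * pi"
  by (subst Ln_minus) auto

lemma Ln_minus_lower: "Im w < 0 \<Longrightarrow> Ln (- w) = Ln w + \<i> * pi"
  by (subst Ln_minus) auto

lemma bounded_density_const: "bounded_density (\<lambda>_. c)"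
  by (rule bounded_densityI[of _ "norm c"]) auto

text \<open>
  Subtracting the constant \<open>c\<close> from the density isolates the logarithm, which carries the whole jump
  if \<open>c\<close> is the value at \<open>w\<close> of a holomorphic continuation of the density.
\<close>
lemma cauchy_transform_split:
  assumes \<rho>: "bounded_density \<rho>" and w: "Im w \<noteq> 0"
  shows "cauchy_transform \<rho> w = cauchy_transform (\<lambda>t. \<rho> t - c) w + c * (Ln (1 - w) - Ln (- w))"
proof -
  have w': "w \<notin> unit_segment" using w by (rule not_unit_segment)
  have "cauchy_transform (\<lambda>t. \<rho> t - c) w =
      (\<integral>t. \<rho> t / (of_real t - w) - c * (1 / (of_real t - w)) \<partial>unit_leb)"
    unfolding cauchy_transform_def by (simp add: diff_divide_distrib)
  also have "\<dots> = cauchy_transform \<rho> w - c * cauchy_transform (\<lambda>_. 1) w"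
    unfolding cauchy_transform_def integral_mult_right_zero[symmetric]
    by (intro Bochner_Integration.integral_diff integrable_mult_right
          bounded_density_integrable bounded_density_kernel \<rho> w' bounded_density_const)
  finally show ?thesis using w by (simp add: cauchy_transform_1)
qed

lemma eventually_dist_less: "0 < e \<Longrightarrow> \<forall>\<^sub>F w in at z within S. dist w z < e"
  by (auto simp: eventually_at)

lemma Lipschitz_near:
  assumes "open D" "H holomorphic_on D" "z0 \<in> D"
  obtains r L C where "r > 0" "cball z0 r \<subseteq> D" "0 \<le> L" "0 \<le> C"
    "\<forall>u\<in>cball z0 r. \<forall>v\<in>cball z0 r. norm (H u - H v) \<le> L * norm (u - v)"
    "\<forall>u\<in>cball z0 r. norm (H u) \<le> C"
proof -
  obtain r where r: "r > 0" "cball z0 r \<subseteq> D"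
    using assms open_contains_cball by blast
  have comp: "compact (g ` cball z0 r)" if "g holomorphic_on D" for g :: "complex \<Rightarrow> complex"
    using that r by (intro compact_continuous_image holomorphic_on_imp_continuous_on)
      (auto elim: holomorphic_on_subset)
  have "deriv H holomorphic_on D" using assms by (intro holomorphic_deriv)
  from compact_imp_bounded[OF comp[OF this]] obtain L where
    L: "\<And>u. u \<in> cball z0 r \<Longrightarrow> norm (deriv H u) \<le> L" unfolding bounded_iff by blast
  from compact_imp_bounded[OF comp[OF assms(2)]] obtain C where
    C: "\<And>u. u \<in> cball z0 r \<Longrightarrow> norm (H u) \<le> C" unfolding bounded_iff by blast
  have "z0 \<in> cball z0 r" using r by simp
  hence "0 \<le> L" "0 \<le> C" using L C norm_ge_zero order_trans by blast+
  moreover have "norm (H u - H v) \<le> L * norm (u - v)" if "u \<in> cball z0 r" "v \<in> cball z0 r" for u v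
  proof (rule field_differentiable_bound[OF convex_cball _ L that])
    fix u assume "u \<in> cball z0 r"
    hence "(H has_field_derivative deriv H u) (at u)"
      using r assms by (intro holomorphic_derivI[of H D]) auto
    thus "(H has_field_derivative deriv H u) (at u within cball z0 r)"
      by (rule has_field_derivative_at_within)
  qed
  ultimately show ?thesis using that r C by blast
qed

text \<open>
  After the value of the holomorphic continuation \<open>H\<close> at \<open>w\<close> has been subtracted, the integrand is a difference
  quotient of \<open>H\<close> for \<open>t\<close> near \<open>w\<close>, hence bounded by a Lipschitz constant; there is no singularity left.
\<close>
lemma cauchy_transform_difference_continuous:
  assumes \<rho>: "bounded_density \<rho>"
    and D: "open D" "H holomorphic_on D" "z0 \<in> D"
    and eq: "\<And>t. t \<in> {0<..<1} \<Longrightarrow> of_real t \<in> D \<Longrightarrow> \<rho> t = H (of_real t)"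
  shows "((\<lambda>w. cauchy_transform (\<lambda>t. \<rho> t - H w) w) \<longlongrightarrow> cauchy_transform (\<lambda>t. \<rho> t - H z0) z0) (at z0)"
proof -
  obtain B where [measurable]: "\<rho> \<in> borel_measurable unit_leb" and B': "\<forall>t\<in>{0<..<1}. norm (\<rho> t) \<le> B"
    using \<rho> unfolding bounded_density_def by blast
  note B = B'[rule_format]
  obtain r L C where r: "r > 0" "cball z0 r \<subseteq> D" and LC: "0 \<le> L" "0 \<le> C"
    and L': "\<forall>u\<in>cball z0 r. \<forall>v\<in>cball z0 r. norm (H u - H v) \<le> L * norm (u - v)"
    and C': "\<forall>u\<in>cball z0 r. norm (H u) \<le> C"
    using Lipschitz_near[OF D] .
  note L = L'[rule_format] and C = C'[rule_format]
  have B0: "0 \<le> B" using order_trans[OF norm_ge_zero B[of "1/2"]] by simp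
  show ?thesis
    unfolding cauchy_transform_def
  proof (rule unit_leb_dominated_convergence[where c = "Re z0" and B = "L + (B + C) / (r / 2)"])
    have "\<forall>\<^sub>F w in at z0. dist w z0 < r / 2" using r by (intro eventually_dist_less) auto
    thus "\<forall>\<^sub>F w in at z0. \<forall>t\<in>{0<..<1}. norm ((\<rho> t - H w) / (of_real t - w)) \<le> L + (B + C) / (r / 2)"
    proof eventually_elim
      case (elim w)
      have w: "w \<in> cball z0 r" using elim r by (simp add: dist_commute)
      show ?case
      proof
        fix t :: real assume t: "t \<in> {0<..<1}"
        show "norm ((\<rho> t - H w) / (of_real t - w)) \<le> L + (B + C) / (r / 2)"
        proof (cases "of_real t \<in> cball z0 r")
          case True
          hence "norm (\<rho> t - H w) \<le> L * norm (of_real t - w)"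
            using L[OF True w] eq[OF t] r by auto
          hence "norm ((\<rho> t - H w) / (of_real t - w)) \<le> L"
            using LC by (cases "of_real t = w") (auto simp: norm_divide divide_simps)
          moreover have "0 \<le> (B + C) / (r / 2)" using B0 LC r by simp
          ultimately show ?thesis by linarith
        next
          case False
          hence "r < dist z0 (of_real t)" by simp
          also have "\<dots> \<le> dist z0 w + dist w (of_real t)" by (rule dist_triangle)
          finally have "r / 2 \<le> norm (of_real t - w)"
            using elim by (simp add: dist_commute dist_norm norm_minus_commute)
          moreover have "norm (\<rho> t - H w) \<le> B + C"
            using norm_triangle_ineq4[of "\<rho> t" "H w"] B[OF t] C[OF w] by linarith
          ultimately have "norm ((\<rho> t - H w) / (of_real t - w)) \<le> (B + C) / (r / 2)"
            unfolding norm_divide using r by (intro frac_le) (auto intro: order_trans[OF norm_ge_zero])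
          thus ?thesis using LC by linarith
        qed
      qed
    qed
    have "isCont H z0" using D by (intro holomorphic_on_imp_isCont)
    hence H: "(H \<longlongrightarrow> H z0) (at z0)" by (simp add: isCont_def)
    show "((\<lambda>w. (\<rho> t - H w) / (of_real t - w)) \<longlongrightarrow> (\<rho> t - H z0) / (of_real t - z0)) (at z0)"
      if "t \<noteq> Re z0" for t
      using that by (intro tendsto_intros H) auto
  qed auto
qed

text \<open>
  The remainder of the splitting is continuous, so only \<open>Ln (- w)\<close> jumps, by \<open>- 2 \<pi> \<i>\<close>.
\<close>
lemma plemelj_jump:
  assumes \<rho>: "bounded_density \<rho>"
    and D: "open D" "H holomorphic_on D"
    and t0: "t0 \<in> {0<..<1}" "of_real t0 \<in> D"
    and eq: "\<And>t. t \<in> {0<..<1} \<Longrightarrow> of_real t \<in> D \<Longrightarrow> \<rho> t = H (of_real t)"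
  obtains lp lm where
    "(cauchy_transform \<rho> \<longlongrightarrow> lp) (at (of_real t0) within left_side 0 1)"
    "(cauchy_transform \<rho> \<longlongrightarrow> lm) (at (of_real t0) within right_side 0 1)"
    "lp - lm = 2 * pi * \<i> * \<rho> t0"
proof -
  define z0 where "z0 = complex_of_real t0"
  define J where "J = cauchy_transform (\<lambda>t. \<rho> t - H z0) z0"
  define L where "L = Ln (1 - z0) - Ln z0"
  have "isCont H z0" using D t0(2) unfolding z0_def by (intro holomorphic_on_imp_isCont)
  hence H: "(H \<longlongrightarrow> H z0) (at z0)" by (simp add: isCont_def)
  have J: "((\<lambda>w. cauchy_transform (\<lambda>t. \<rho> t - H w) w) \<longlongrightarrow> J) (at z0)"
    unfolding J_def using t0 by (intro cauchy_transform_difference_continuous[OF \<rho> D] eq) (auto simp: z0_def)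
  have z0: "z0 \<notin> \<real>\<^sub>\<le>\<^sub>0" "1 - z0 \<notin> \<real>\<^sub>\<le>\<^sub>0"
    using t0 by (auto simp: z0_def complex_nonpos_Reals_iff)
  have Ln: "((\<lambda>w. Ln (1 - w) - Ln w) \<longlongrightarrow> L) (at z0)"
    unfolding L_def using z0 by (intro tendsto_intros) auto
  have side: "(cauchy_transform \<rho> \<longlongrightarrow> J + H z0 * (L + c)) (at z0 within S)"
    if S: "\<And>w. w \<in> S \<Longrightarrow> Im w \<noteq> 0 \<and> Ln (- w) = Ln w - c" for c S
  proof -
    have "((\<lambda>w. cauchy_transform (\<lambda>t. \<rho> t - H w) w + H w * (Ln (1 - w) - Ln w + c))
        \<longlongrightarrow> J + H z0 * (L + c)) (at z0)"
      by (intro tendsto_intros J H Ln)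
    hence "((\<lambda>w. cauchy_transform (\<lambda>t. \<rho> t - H w) w + H w * (Ln (1 - w) - Ln w + c))
        \<longlongrightarrow> J + H z0 * (L + c)) (at z0 within S)"
      by (rule Lim_at_imp_Lim_at_within)
    thus ?thesis
    proof (rule Lim_transform_within[where d = 1])
      fix w assume "w \<in> S"
      thus "cauchy_transform (\<lambda>t. \<rho> t - H w) w + H w * (Ln (1 - w) - Ln w + c) = cauchy_transform \<rho> w"
        using cauchy_transform_split[OF \<rho>, of w "H w"] S[of w] by (simp add: algebra_simps)
    qed simp
  qed
  have lp: "(cauchy_transform \<rho> \<longlongrightarrow> J + H z0 * (L + \<i> * pi)) (at z0 within left_side 0 1)"
    by (rule side) (auto simp: left_side_0_1 Ln_minus_upper)
  have lm: "(cauchy_transform \<rho> \<longlongrightarrow> J + H z0 * (L + - (\<i> * pi))) (at z0 within right_side 0 1)"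
    by (rule side) (auto simp: right_side_0_1 Ln_minus_lower)
  have "(J + H z0 * (L + \<i> * pi)) - (J + H z0 * (L + - (\<i> * pi))) = 2 * pi * \<i> * \<rho> t0"
    using eq[OF t0] by (simp add: z0_def algebra_simps)
  from that[OF lp[unfolded z0_def] lm[unfolded z0_def] this[unfolded z0_def]] show ?thesis .
qed

section \<open>Boundedness at an endpoint\<close>
lemma norm_exp_Ln_le:
  assumes "w \<noteq> 0" "norm w \<le> 1" "0 \<le> Re \<mu>"
  shows "norm (exp (\<mu> * Ln w)) \<le> exp (\<bar>Im \<mu>\<bar> * pi)"
proof -
  have "ln (norm w) \<le> 0" using assms by simp
  hence "Re \<mu> * ln (norm w) \<le> 0" using assms(3) by (simp add: mult_nonneg_nonpos)
  moreover have "- (Im \<mu> * Im (Ln w)) \<le> \<bar>Im \<mu>\<bar> * \<bar>Im (Ln w)\<bar>"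
    by (metis abs_ge_minus_self abs_mult)
  moreover have "\<bar>Im \<mu>\<bar> * \<bar>Im (Ln w)\<bar> \<le> \<bar>Im \<mu>\<bar> * pi"
    using Im_Ln_le_pi[OF assms(1)] mpi_less_Im_Ln[OF assms(1)] by (intro mult_left_mono) auto
  ultimately show ?thesis using assms(1) by (simp add: Re_Ln)
qed

lemma tendsto_times_Ln_minus: "((\<lambda>w. w * Ln (- w)) \<longlongrightarrow> 0) (at 0)"
proof (rule Lim_null_comparison)
  have bound: "norm (w * Ln (- w)) \<le> 2 * sqrt (norm w) + norm w * pi" if w: "w \<noteq> 0" "norm w < 1" for w
  proof -
    have pos: "0 < norm w" using w by simp
    have "ln (1 / sqrt (norm w)) \<le> 1 / sqrt (norm w) - 1"
      using pos by (intro ln_le_minus_one) auto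
    moreover have "ln (1 / sqrt (norm w)) = - ln (norm w) / 2"
      using pos by (simp add: ln_div ln_sqrt)
    ultimately have "- ln (norm w) \<le> 2 / sqrt (norm w)" by simp
    hence "norm w * (- ln (norm w)) \<le> norm w * (2 / sqrt (norm w))"
      using pos by (intro mult_left_mono) auto
    also have "\<dots> = 2 * sqrt (norm w)" using pos by (simp add: field_simps)
    finally have 1: "norm w * \<bar>ln (norm w)\<bar> \<le> 2 * sqrt (norm w)" using pos w by simp
    have "norm (Ln (- w)) \<le> \<bar>ln (norm w)\<bar> + \<bar>Im (Ln (- w))\<bar>"
      using cmod_le[of "Ln (- w)"] w by simp
    also have "\<dots> \<le> \<bar>ln (norm w)\<bar> + pi"
      using Im_Ln_le_pi[of "- w"] mpi_less_Im_Ln[of "- w"] w by auto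
    finally have "norm w * norm (Ln (- w)) \<le> norm w * (\<bar>ln (norm w)\<bar> + pi)"
      using pos by (intro mult_left_mono) auto
    thus ?thesis using 1 by (simp add: norm_mult algebra_simps)
  qed
  have "\<forall>\<^sub>F w in at (0::complex). w \<noteq> 0 \<and> norm w < 1"
    by (auto simp: eventually_at intro!: exI[of _ 1])
  thus "\<forall>\<^sub>F w in at 0. norm (w * Ln (- w)) \<le> 2 * sqrt (norm w) + norm w * pi"
    by eventually_elim (use bound in auto)
  have "((\<lambda>w::complex. 2 * sqrt (norm w) + norm w * pi) \<longlongrightarrow> 2 * sqrt (norm (0::complex)) + norm (0::complex) * pi) (at 0)"
    by (intro tendsto_intros)
  thus "((\<lambda>w::complex. 2 * sqrt (norm w) + norm w * pi) \<longlongrightarrow> 0) (at 0)" by simp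
qed


text \<open>
  The singularity at the endpoint is weaker than a pole. A direct estimate of the transform would have to deal
  with points \<open>w\<close> arbitrarily close to the interval. Instead \<open>w\<close> times the transform is, up to a constant,
  the transform of \<open>t \<rho> t\<close>, whose holomorphic continuation \<open>w\<^sup>1\<^sup>+\<^sup>\<mu> A w\<close> is Lipschitz up to the endpoint.
\<close>
lemma times_cauchy_transform_tendsto_0:
  assumes \<rho>: "bounded_density \<rho>" and \<mu>: "0 \<le> Re \<mu>" and R: "0 < R"
    and A: "A holomorphic_on ball 0 R"
    and eq: "\<And>t. t \<in> {0<..<1} \<Longrightarrow> t < R \<Longrightarrow> \<rho> t = exp (\<mu> * Ln (of_real t)) * A (of_real t)"
  shows "((\<lambda>w. w * cauchy_transform \<rho> w) \<longlongrightarrow> 0) (at 0 within {w. Im w \<noteq> 0})"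
proof -
  define \<sigma> where "\<sigma> t = complex_of_real t * \<rho> t" for t
  obtain B where [measurable]: "\<rho> \<in> borel_measurable unit_leb" and B': "\<forall>t\<in>{0<..<1}. norm (\<rho> t) \<le> B"
    using \<rho> unfolding bounded_density_def by blast
  note B = B'[rule_format]
  have B0: "0 \<le> B" using order_trans[OF norm_ge_zero B[of "1/2"]] by simp
  have [measurable]: "\<sigma> \<in> borel_measurable unit_leb" unfolding \<sigma>_def by measurable
  have \<sigma>B: "norm (\<sigma> t) \<le> t * B" "norm (\<sigma> t) \<le> B" if "t \<in> {0<..<1}" for t
  proof -
    show "norm (\<sigma> t) \<le> t * B" using that B[OF that] by (simp add: \<sigma>_def norm_mult mult_left_mono)
    also have "\<dots> \<le> 1 * B" using that B0 by (intro mult_right_mono) auto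
    finally show "norm (\<sigma> t) \<le> B" by simp
  qed
  have \<sigma>: "bounded_density \<sigma>" by (rule bounded_densityI[OF _ \<sigma>B(2)]) simp_all
  define R1 where "R1 = min (R / 2) (1 / 2)"
  have R1: "0 < R1" "R1 < R" "R1 < 1" "cball 0 R1 \<subseteq> ball (0::complex) R"
    using R by (auto simp: R1_def)
  have comp: "compact (g ` cball 0 R1)" if "g holomorphic_on ball 0 R" for g :: "complex \<Rightarrow> complex"
    using that R1 by (intro compact_continuous_image holomorphic_on_imp_continuous_on)
      (auto elim: holomorphic_on_subset)
  from compact_imp_bounded[OF comp[OF A]] obtain C where
    C': "\<forall>u\<in>cball 0 R1. norm (A u) \<le> C" unfolding bounded_iff by blast
  have "deriv A holomorphic_on ball 0 R" using A by (intro holomorphic_deriv) auto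
  from compact_imp_bounded[OF comp[OF this]] obtain C1 where
    C1': "\<forall>u\<in>cball 0 R1. norm (deriv A u) \<le> C1" unfolding bounded_iff by blast
  note C = C'[rule_format] and C1 = C1'[rule_format]
  have C0: "0 \<le> C" "0 \<le> C1"
    using order_trans[OF norm_ge_zero C[of 0]] order_trans[OF norm_ge_zero C1[of 0]] R1 by auto
  define E where "E = exp (\<bar>Im \<mu>\<bar> * pi)"
  have E: "norm (exp (\<mu> * Ln w)) \<le> E" if "w \<noteq> 0" "norm w \<le> 1" for w
    unfolding E_def using that \<mu> by (rule norm_exp_Ln_le)
  have E0: "0 \<le> E" by (simp add: E_def)
  define H where "H w = w * exp (\<mu> * Ln w) * A w" for w
  \<comment> \<open>In the left half-plane no subtraction is needed, as \<open>t \<le> norm (t - w)\<close> there.\<close>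
  define H0 where "H0 w = (if Re w > 0 then H w else 0)" for w
  have HB: "norm (H0 w) \<le> norm w * (E * C)" if "norm w < R1" for w
  proof (cases "Re w > 0")
    case True
    hence "norm (exp (\<mu> * Ln w)) * norm (A w) \<le> E * C"
      using that R1 E0 by (intro mult_mono E C) auto
    thus ?thesis using True by (simp add: H0_def H_def norm_mult mult.assoc mult_left_mono)
  qed (use E0 C0 in \<open>auto simp: H0_def\<close>)
  define S where "S = ball 0 R1 \<inter> {w::complex. Re w > 0}"
  have convS: "convex S" unfolding S_def by (intro convex_Int convex_ball convex_halfspace_Re_gt)
  define L where "L = E * ((norm \<mu> + 1) * C + C1)"
  have L0: "0 \<le> L" using E0 C0 by (simp add: L_def)
  have Lip: "norm (H u - H v) \<le> L * norm (u - v)" if "u \<in> S" "v \<in> S" for u v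
  proof (rule field_differentiable_bound[OF convS _ _ that])
    fix w assume w: "w \<in> S"
    hence nz: "w \<noteq> 0" and wR: "w \<in> cball 0 R1" and w1: "norm w \<le> 1" and np: "w \<notin> \<real>\<^sub>\<le>\<^sub>0"
      using R1 by (auto simp: S_def complex_nonpos_Reals_iff)
    let ?D = "exp (\<mu> * Ln w) * ((\<mu> + 1) * A w + w * deriv A w)"
    have "(A has_field_derivative deriv A w) (at w)"
      using wR R1 A by (intro holomorphic_derivI[of A "ball 0 R"]) auto
    hence "(H has_field_derivative ?D) (at w)"
      unfolding H_def using nz np
      by (auto intro!: derivative_eq_intros simp: field_simps)
    thus "(H has_field_derivative ?D) (at w within S)" by (rule has_field_derivative_at_within)
    have "norm ((\<mu> + 1) * A w) \<le> (norm \<mu> + 1) * C"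
      unfolding norm_mult using C[OF wR] C0 norm_triangle_ineq[of \<mu> 1] by (intro mult_mono) auto
    moreover have "norm (w * deriv A w) \<le> 1 * C1"
      unfolding norm_mult using C1[OF wR] w1 C0 by (intro mult_mono) auto
    ultimately have "norm ((\<mu> + 1) * A w + w * deriv A w) \<le> (norm \<mu> + 1) * C + C1"
      by (intro norm_triangle_le) auto
    thus "norm ?D \<le> L"
      unfolding L_def norm_mult[of "exp _"] using E[OF nz w1] E0 by (intro mult_mono) auto
  qed
  \<comment> \<open>The three summands dominate the integrand for \<open>w\<close> on the left, for \<open>t\<close> near \<open>0\<close> and for \<open>t\<close> away from \<open>0\<close>.\<close>
  define K where "K = L + B + (B + E * C) / (R1 / 2)"
  have lim: "((\<lambda>w. \<integral>t. (\<sigma> t - H0 w) / (of_real t - w) \<partial>unit_leb) \<longlongrightarrow> (\<integral>t. \<rho> t \<partial>unit_leb)) (at 0)"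
  proof (rule unit_leb_dominated_convergence[where c = 0 and B = K])
    have "\<forall>\<^sub>F w in at (0::complex). norm w < R1 / 2"
      using R1 eventually_dist_less[of "R1 / 2" "0::complex" UNIV] by simp
    thus "\<forall>\<^sub>F w in at 0. \<forall>t\<in>{0<..<1}. norm ((\<sigma> t - H0 w) / (of_real t - w)) \<le> K"
    proof eventually_elim
      case (elim w)
      show ?case
      proof
        fix t :: real assume t: "t \<in> {0<..<1}"
        have BC: "0 \<le> (B + E * C) / (R1 / 2)" using B0 E0 C0 R1 by simp
        consider "Re w \<le> 0" | "Re w > 0" "t < R1" | "Re w > 0" "t \<ge> R1" by linarith
        thus "norm ((\<sigma> t - H0 w) / (of_real t - w)) \<le> K"
        proof cases
          case 1
          have "t \<le> \<bar>Re (of_real t - w)\<bar>" using 1 by simp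
          also have "\<dots> \<le> norm (of_real t - w)" by (rule abs_Re_le_cmod)
          finally have "t * B \<le> norm (of_real t - w) * B" using B0 by (intro mult_right_mono)
          hence "norm (\<sigma> t) \<le> norm (of_real t - w) * B" using \<sigma>B(1)[OF t] by linarith
          hence "norm ((\<sigma> t - H0 w) / (of_real t - w)) \<le> B"
            using 1 B0 by (cases "of_real t = w") (auto simp: H0_def norm_divide divide_simps mult.commute)
          thus ?thesis using L0 BC by (simp add: K_def)
        next
          case 2
          have "of_real t \<in> S" "w \<in> S" using 2 t elim R1 by (auto simp: S_def)
          hence "norm (H (of_real t) - H w) \<le> L * norm (of_real t - w)" by (rule Lip)
          moreover have "\<sigma> t = H (of_real t)" using eq[OF t] 2 R1 by (simp add: \<sigma>_def H_def)
          ultimately have "norm (\<sigma> t - H0 w) \<le> L * norm (of_real t - w)" using 2 by (simp add: H0_def)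
          hence "norm ((\<sigma> t - H0 w) / (of_real t - w)) \<le> L"
            using L0 by (cases "of_real t = w") (auto simp: norm_divide divide_simps)
          thus ?thesis using B0 BC by (simp add: K_def)
        next
          case 3
          have "R1 \<le> norm (of_real t - w) + norm w"
            using norm_triangle_ineq[of "of_real t - w" w] 3 t by simp
          hence "R1 / 2 \<le> norm (of_real t - w)" using elim by simp
          moreover have "norm (H0 w) \<le> 1 * (E * C)"
            using E0 C0 elim R1 by (intro order_trans[OF HB] mult_right_mono) auto
          hence "norm (\<sigma> t - H0 w) \<le> B + E * C"
            using norm_triangle_ineq4[of "\<sigma> t" "H0 w"] \<sigma>B(2)[OF t] by linarith
          ultimately have "norm ((\<sigma> t - H0 w) / (of_real t - w)) \<le> (B + E * C) / (R1 / 2)"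
            unfolding norm_divide using R1 B0 E0 C0 by (intro frac_le) auto
          thus ?thesis using L0 B0 by (simp add: K_def)
        qed
      qed
    qed
    have "(H0 \<longlongrightarrow> 0) (at 0)"
    proof (rule Lim_null_comparison)
      have "\<forall>\<^sub>F w in at (0::complex). norm w < R1" using R1 by (auto simp: eventually_at)
      thus "\<forall>\<^sub>F w in at 0. norm (H0 w) \<le> norm w * (E * C)" by eventually_elim (rule HB)
      show "((\<lambda>w::complex. norm w * (E * C)) \<longlongrightarrow> 0) (at 0)" by (auto intro!: tendsto_eq_intros)
    qed
    hence "((\<lambda>w. (\<sigma> t - H0 w) / (of_real t - w)) \<longlongrightarrow> (\<sigma> t - 0) / (of_real t - 0)) (at 0)"
      if "t \<in> {0<..<1}" for t using that by (intro tendsto_intros) auto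
    thus "((\<lambda>w. (\<sigma> t - H0 w) / (of_real t - w)) \<longlongrightarrow> \<rho> t) (at 0)"
      if "t \<in> {0<..<1}" for t using that by (force simp: \<sigma>_def)
  qed auto
  have HL: "((\<lambda>w. H0 w * (Ln (1 - w) - Ln (- w))) \<longlongrightarrow> 0) (at 0)"
  proof (rule Lim_null_comparison)
    have "\<forall>\<^sub>F w in at (0::complex). norm w < R1" using R1 by (auto simp: eventually_at)
    thus "\<forall>\<^sub>F w in at 0. norm (H0 w * (Ln (1 - w) - Ln (- w))) \<le>
        (E * C) * norm (w * Ln (1 - w) - w * Ln (- w))"
    proof eventually_elim
      case (elim w)
      have "norm (H0 w) * norm (Ln (1 - w) - Ln (- w)) \<le> norm w * (E * C) * norm (Ln (1 - w) - Ln (- w))"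
        using HB[OF elim] by (rule mult_right_mono) simp
      also have "\<dots> = (E * C) * norm (w * (Ln (1 - w) - Ln (- w)))"
        by (simp add: norm_mult)
      finally have "norm (H0 w * (Ln (1 - w) - Ln (- w))) \<le> (E * C) * norm (w * (Ln (1 - w) - Ln (- w)))"
        unfolding norm_mult[of "H0 w"] .
      thus ?case by (simp only: right_diff_distrib[of w])
    qed
    have "((\<lambda>w. Ln (1 - w)) \<longlongrightarrow> Ln (1 - 0)) (at 0)" by (intro tendsto_intros) auto
    from tendsto_mult[OF tendsto_ident_at this] tendsto_times_Ln_minus
    have "((\<lambda>w. w * Ln (1 - w) - w * Ln (- w)) \<longlongrightarrow> 0 * Ln (1 - 0) - 0) (at 0)"
      by (rule tendsto_diff)
    from tendsto_mult[OF tendsto_const tendsto_norm[OF this], of "E * C"]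
    show "((\<lambda>w. (E * C) * norm (w * Ln (1 - w) - w * Ln (- w))) \<longlongrightarrow> 0) (at 0)" by simp
  qed
  let ?Q = "\<lambda>w. (\<integral>t. (\<sigma> t - H0 w) / (of_real t - w) \<partial>unit_leb) + H0 w * (Ln (1 - w) - Ln (- w))"
  have "((\<lambda>w. ?Q w) \<longlongrightarrow> (\<integral>t. \<rho> t \<partial>unit_leb) + 0) (at 0)"
    by (intro tendsto_add lim HL)
  from Lim_at_imp_Lim_at_within[OF tendsto_diff[OF this tendsto_const], of "\<integral>t. \<rho> t \<partial>unit_leb" "{w. Im w \<noteq> 0}"]
  have "((\<lambda>w. ?Q w
      - (\<integral>t. \<rho> t \<partial>unit_leb)) \<longlongrightarrow> 0) (at 0 within {w. Im w \<noteq> 0})" by simp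
  thus ?thesis
  proof (rule Lim_transform_within[where d = 1])
    fix w :: complex assume "w \<in> {w. Im w \<noteq> 0}"
    hence w: "Im w \<noteq> 0" by simp
    have "?Q w
        = cauchy_transform \<sigma> w"
      using cauchy_transform_split[OF \<sigma> w, of "H0 w"] by (simp add: cauchy_transform_def)
    also have "\<dots> = w * cauchy_transform \<rho> w + (\<integral>t. \<rho> t \<partial>unit_leb)"
      unfolding \<sigma>_def using \<rho> w by (intro cauchy_transform_mult_of_real not_unit_segment)
    finally show "?Q w
            - (\<integral>t. \<rho> t \<partial>unit_leb) = w * cauchy_transform \<rho> w" by simp
  qed simp
qed

lemma norm_le_near_0:
  assumes "isCont F w" "norm w < d" "\<And>v. Im v \<noteq> 0 \<Longrightarrow> norm v < d \<Longrightarrow> norm (F v) \<le> B"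
  shows "norm (F w) \<le> B"
proof (cases "Im w = 0")
  case True
  show ?thesis
  proof (rule norm_le_on_line[of 0 1, OF _ _ assms(1)])
    have "\<forall>\<^sub>F v in at w within left_side 0 1. v \<in> ball 0 d \<inter> left_side 0 1"
      using assms(2) by (auto simp: eventually_at_topological intro!: exI[of _ "ball 0 d"])
    thus "\<forall>\<^sub>F v in at w within left_side 0 1. norm (F v) \<le> B"
      by eventually_elim (rule assms(3), auto simp: left_side_0_1)
  qed (use True in auto)
qed (use assms in auto)

text \<open>
  A multiple of the branch of \<open>w\<^sup>\<mu> A w\<close> cut along the positive real axis is added to the transform to cancel its
  jump. The sum \<open>M\<close> extends holomorphically to a punctured disc, the puncture is removable because the
  transform is \<open>o(1/w)\<close>, and the branch itself is bounded as \<open>Re \<mu> \<ge> 0\<close>.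
\<close>
theorem cauchy_transform_bounded_at_0:
  assumes \<rho>: "bounded_density \<rho>" and \<mu>: "0 \<le> Re \<mu>" "\<mu> \<notin> \<int>" and R: "0 < R"
    and A: "A holomorphic_on ball 0 R"
    and eq: "\<And>t. t \<in> {0<..<1} \<Longrightarrow> t < R \<Longrightarrow> \<rho> t = exp (\<mu> * Ln (of_real t)) * A (of_real t)"
  shows "Bfun (cauchy_transform \<rho>) (at 0 within - unit_segment)"
proof -
  have line: "Im ((z - 0) / (1 - 0)) = Im z" for z :: complex by simp
  have sin0: "sin (of_real pi * \<mu>) \<noteq> 0"
  proof
    assume "sin (of_real pi * \<mu>) = 0"
    then obtain m :: int where "of_real pi * \<mu> = of_int m * of_real pi"
      unfolding sin_eq_0 by (auto simp: mult.commute)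
    hence "\<mu> = of_int m" by simp
    thus False using \<mu>(2) by simp
  qed
  \<comment> \<open>The one-sided values \<open>exp (\<mu> (Ln w \<mp> \<i> \<pi>))\<close> of the cut branch differ by \<open>- 2 \<i> sin (\<pi> \<mu>) w\<^sup>\<mu>\<close>; the factor turns this into \<open>- 2 \<pi> \<i> w\<^sup>\<mu>\<close>.\<close>
  define \<kappa> where "\<kappa> = of_real pi / sin (of_real pi * \<mu>)"
  define G where "G w = \<kappa> * exp (\<mu> * Ln (- w)) * A w" for w
  define M where "M w = cauchy_transform \<rho> w + G w" for w
  define R2 where "R2 = min R 1"
  have R2: "0 < R2" "R2 \<le> R" "R2 \<le> 1" using R by (auto simp: R2_def)
  define S where "S = ball 0 R2 - {0 :: complex}"
  have openS: "open S" by (auto simp: S_def intro: open_delete)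
  have A2: "A holomorphic_on S" using A by (rule holomorphic_on_subset) (use R2 in \<open>auto simp: S_def\<close>)
  define Z where "Z = complex_of_real ` {0..}"
  have Z: "z \<in> Z \<longleftrightarrow> Im z = 0 \<and> 0 \<le> Re z" for z
    by (auto simp: Z_def image_iff complex_eq_iff intro!: bexI[of _ "Re z"])
  have closedZ: "closed Z"
  proof -
    have "Z = {z. Im z = 0} \<inter> {z. 0 \<le> Re z}" using Z by auto
    thus ?thesis by (simp add: closed_Int closed_halfspace_Im_eq closed_halfspace_Re_ge)
  qed
  have GM: "G holomorphic_on S - Z" "M holomorphic_on S - Z"
  proof -
    show G: "G holomorphic_on S - Z"
      unfolding G_def using A2
      by (intro holomorphic_intros) (auto simp: Z complex_nonpos_Reals_iff elim: holomorphic_on_subset)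
    have "cauchy_transform \<rho> holomorphic_on S - Z"
      using cauchy_transform_holomorphic[OF \<rho>] by (rule holomorphic_on_subset) (auto simp: Z)
    thus "M holomorphic_on S - Z" unfolding M_def using G by (intro holomorphic_intros)
  qed
  obtain F where F: "F holomorphic_on S" "\<And>z. z \<in> S \<Longrightarrow> Im z \<noteq> 0 \<Longrightarrow> F z = M z"
  proof (rule holomorphic_extension_across_line[OF openS, of 0 1 M, unfolded line])
    show "M holomorphic_on S - {z. Im z = 0}"
      using GM(2) by (rule holomorphic_on_subset) (auto simp: Z)
    fix z assume z: "z \<in> S" "Im z = 0"
    define t where "t = Re z"
    have zt: "z = of_real t" using z by (simp add: t_def complex_eq_iff)
    have t: "\<bar>t\<bar> < R2" "t \<noteq> 0" using z by (auto simp: S_def zt)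
    show "\<exists>l. (M \<longlongrightarrow> l) (at z within left_side 0 1) \<and> (M \<longlongrightarrow> l) (at z within right_side 0 1)"
    proof (cases "t > 0")
      case False
      hence "z \<in> S - Z" using z t by (auto simp: Z zt)
      hence "isCont M z" using GM(2) openS closedZ by (intro holomorphic_on_imp_isCont[of M "S - Z"] open_Diff)
      thus ?thesis unfolding isCont_def by (blast intro: Lim_at_imp_Lim_at_within)
    next
      case True
      let ?D = "ball 0 R \<inter> {w. Re w > 0}"
      have D: "open ?D" "(\<lambda>w. exp (\<mu> * Ln w) * A w) holomorphic_on ?D"
        using A by (auto intro!: holomorphic_intros open_Int open_halfspace_Re_gt
            simp: complex_nonpos_Reals_iff elim: holomorphic_on_subset)
      obtain lp lm where lp: "(cauchy_transform \<rho> \<longlongrightarrow> lp) (at z within left_side 0 1)"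
        and lm: "(cauchy_transform \<rho> \<longlongrightarrow> lm) (at z within right_side 0 1)"
        and jump: "lp - lm = 2 * pi * \<i> * \<rho> t"
        unfolding zt
        by (rule plemelj_jump[OF \<rho> D, of t]) (use t True R2 eq in auto)
      have Az: "(A \<longlongrightarrow> A z) (at z)"
        using holomorphic_on_imp_isCont[OF A2 openS z(1)] by (simp add: isCont_def)
      have Lnz: "(Ln \<longlongrightarrow> Ln z) (at z)"
        by (intro tendsto_intros) (use True in \<open>auto simp: zt complex_nonpos_Reals_iff\<close>)
      have side: "(G \<longlongrightarrow> \<kappa> * exp (\<mu> * (Ln z + c)) * A z) (at z within T)"
        if "\<And>w. w \<in> T \<Longrightarrow> Ln (- w) = Ln w + c" for c T
      proof -
        have "((\<lambda>w. \<kappa> * exp (\<mu> * (Ln w + c)) * A w) \<longlongrightarrow> \<kappa> * exp (\<mu> * (Ln z + c)) * A z) (at z)"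
          by (intro tendsto_intros Az Lnz)
        thus ?thesis
          by (rule Lim_transform_within[where d = 1, OF Lim_at_imp_Lim_at_within]) (auto simp: G_def that)
      qed
      have up: "(M \<longlongrightarrow> lp + \<kappa> * exp (\<mu> * (Ln z + - (\<i> * pi))) * A z) (at z within left_side 0 1)"
        unfolding M_def by (intro tendsto_add lp side) (simp add: left_side_0_1 Ln_minus_upper)
      have low: "(M \<longlongrightarrow> lm + \<kappa> * exp (\<mu> * (Ln z + \<i> * pi)) * A z) (at z within right_side 0 1)"
        unfolding M_def by (intro tendsto_add lm side) (simp add: right_side_0_1 Ln_minus_lower)
      have sinexp: "exp (\<mu> * (\<i> * pi)) - exp (- (\<mu> * (\<i> * pi))) = 2 * \<i> * sin (of_real pi * \<mu>)"
        by (simp add: sin_exp_eq exp_minus field_simps mult.assoc)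
      have "\<kappa> * exp (\<mu> * (Ln z + \<i> * pi)) * A z - \<kappa> * exp (\<mu> * (Ln z + - (\<i> * pi))) * A z
          = \<kappa> * (exp (\<mu> * Ln z) * A z) * (exp (\<mu> * (\<i> * pi)) - exp (- (\<mu> * (\<i> * pi))))"
        by (simp add: distrib_left right_diff_distrib exp_add exp_diff exp_minus divide_inverse algebra_simps)
      also have "\<dots> = 2 * pi * \<i> * \<rho> t"
        unfolding sinexp using sin0 eq[of t] t True R2 by (simp add: \<kappa>_def zt)
      finally have "lp + \<kappa> * exp (\<mu> * (Ln z + - (\<i> * pi))) * A z = lm + \<kappa> * exp (\<mu> * (Ln z + \<i> * pi)) * A z"
        using jump by (simp add: algebra_simps)
      thus ?thesis using up low by auto
    qed
  qed auto
  obtain C where C: "\<forall>w\<in>cball 0 (R2 / 2). norm (A w) \<le> C"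
  proof -
    have "compact (A ` cball 0 (R2 / 2))"
      using A R2 by (intro compact_continuous_image holomorphic_on_imp_continuous_on)
        (auto elim!: holomorphic_on_subset)
    hence "bounded (A ` cball 0 (R2 / 2))" by (rule compact_imp_bounded)
    then obtain C where "\<forall>x\<in>A ` cball 0 (R2 / 2). norm x \<le> C" unfolding bounded_iff by blast
    thus ?thesis by (intro that[of C]) simp
  qed
  define KG where "KG = norm \<kappa> * exp (\<bar>Im \<mu>\<bar> * pi) * C"
  have KG: "norm (G w) \<le> KG" if "w \<noteq> 0" "norm w < R2 / 2" for w
    unfolding G_def KG_def norm_mult using that C \<mu> R2
    by (intro mult_mono order_refl norm_exp_Ln_le) auto
  have Fz: "((\<lambda>z. (z - 0) * F z) \<longlongrightarrow> 0) (at 0)"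
  proof (rule tendstoI)
    fix e :: real assume e: "e > 0"
    have "((\<lambda>w. w * cauchy_transform \<rho> w + w * G w) \<longlongrightarrow> 0 + 0) (at 0 within {w. Im w \<noteq> 0})"
    proof (intro tendsto_add times_cauchy_transform_tendsto_0[OF \<rho> \<mu>(1) R A eq])
      show "((\<lambda>w. w * G w) \<longlongrightarrow> 0) (at 0 within {w. Im w \<noteq> 0})"
      proof (rule Lim_null_comparison)
        have "\<forall>\<^sub>F w in at 0 within {w. Im w \<noteq> 0}. norm w < R2 / 2"
          using eventually_dist_less[of "R2 / 2" "0::complex" "{w. Im w \<noteq> 0}"] R2 by simp
        moreover have "\<forall>\<^sub>F w in at 0 within {w. Im w \<noteq> 0}. w \<noteq> (0::complex)"
          by (rule eventually_neq_at_within)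
        ultimately show "\<forall>\<^sub>F w in at 0 within {w. Im w \<noteq> 0}. norm (w * G w) \<le> norm w * KG"
          by eventually_elim (simp add: norm_mult mult_left_mono KG)
        show "((\<lambda>w::complex. norm w * KG) \<longlongrightarrow> 0) (at 0 within {w. Im w \<noteq> 0})"
          by (auto intro!: tendsto_eq_intros)
      qed
    qed auto
    hence "\<forall>\<^sub>F w in at 0 within {w. Im w \<noteq> 0}. dist (w * cauchy_transform \<rho> w + w * G w) 0 < e / 2"
      using e by (intro tendstoD) auto
    then obtain d where d: "d > 0" and d2: "\<forall>w\<in>{w. Im w \<noteq> 0}. w \<noteq> 0 \<and> dist w 0 < d \<longrightarrow>
        dist (w * cauchy_transform \<rho> w + w * G w) 0 < e / 2"
      unfolding eventually_at by blast
    have d3: "norm (w * M w) < e / 2" if "Im w \<noteq> 0" "norm w < d" for w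
      using bspec[OF d2, of w] that by (cases "w = 0") (auto simp: M_def distrib_left)
    define d' where "d' = min d R2"
    have off: "norm (w * F w) \<le> e / 2" if "Im w \<noteq> 0" "norm w < d'" for w
    proof -
      have "w \<in> S" using that by (auto simp: S_def d'_def)
      thus ?thesis using d3[of w] that F(2)[of w] by (simp add: d'_def)
    qed
    have "norm (w * F w) \<le> e / 2" if w: "w \<noteq> 0" "norm w < d'" for w
    proof (rule norm_le_near_0[where F = "\<lambda>w. w * F w" and w = w and d = d'])
      have "w \<in> S" using w by (auto simp: S_def d'_def)
      hence "isCont F w" by (rule holomorphic_on_imp_isCont[OF F(1) openS])
      thus "isCont (\<lambda>w. w * F w) w" by (intro continuous_intros)
    qed (use w off in auto)
    moreover have "d' > 0" using d R2 by (simp add: d'_def)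
    ultimately show "\<forall>\<^sub>F z in at 0. dist ((z - 0) * F z) 0 < e"
      using e unfolding eventually_at by (intro exI[of _ d']) force
  qed
  have "F holomorphic_on ball 0 R2 - {0}" using F(1) by (simp add: S_def)
  from holomorphic_on_extend_bounded[OF this] holomorphic_on_extend_lim[OF this] Fz R2
  obtain KF where "\<forall>\<^sub>F z in at 0. norm (F z) \<le> KF" by (auto simp: interior_open)
  then obtain d where d: "d > 0" "\<And>z. z \<noteq> 0 \<Longrightarrow> norm z < d \<Longrightarrow> norm (F z) \<le> KF"
    unfolding eventually_at by auto
  define d' where "d' = min d (R2 / 2)"
  have off: "norm (cauchy_transform \<rho> w) \<le> KF + KG" if w: "Im w \<noteq> 0" "norm w < d'" for w
  proof -
    have w0: "w \<noteq> 0" using w by auto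
    hence "w \<in> S" using w R2 by (auto simp: S_def d'_def)
    hence "cauchy_transform \<rho> w = F w - G w" using F(2)[of w] w by (simp add: M_def)
    thus ?thesis using d(2)[OF w0] KG[OF w0] w norm_triangle_ineq4[of "F w" "G w"] by (simp add: d'_def)
  qed
  have "norm (cauchy_transform \<rho> w) \<le> KF + KG" if w: "w \<notin> unit_segment" "norm w < d'" for w
    using w by (intro norm_le_near_0[OF _ w(2) off]
        holomorphic_on_imp_isCont[OF cauchy_transform_holomorphic[OF \<rho>] open_Compl_unit_segment]) auto
  moreover have "d' > 0" using d R2 by (simp add: d'_def)
  hence "\<forall>\<^sub>F w in at 0 within - unit_segment. w \<notin> unit_segment \<and> norm w < d'"
    by (auto simp: eventually_at)
  ultimately have "\<forall>\<^sub>F w in at 0 within - unit_segment. norm (cauchy_transform \<rho> w) \<le> KF + KG"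
    by (auto elim: eventually_mono)
  thus ?thesis by (rule BfunI)
qed

section \<open>Cauchy transforms along an edge\<close>
lemma cauchy_transform_reflect:
  "cauchy_transform (\<lambda>t. \<rho> (1 - t)) (1 - w) = - cauchy_transform \<rho> w"
proof -
  let ?f = "\<lambda>t. indicator {0<..<1} t *\<^sub>R (\<rho> t / (of_real t - w))"
  have "cauchy_transform (\<lambda>t. \<rho> (1 - t)) (1 - w) =
      (\<integral>t. indicator {0<..<1} t *\<^sub>R (\<rho> (1 - t) / (of_real t - (1 - w))) \<partial>lebesgue)"
    unfolding cauchy_transform_def by (subst integral_restrict_space) auto
  also have "\<dots> = (\<integral>t. - ?f (1 + - 1 * t) \<partial>lebesgue)"
  proof (intro Bochner_Integration.integral_cong refl)
    fix t :: real
    have "of_real t - (1 - w) = - (of_real (1 + - 1 * t) - w)" by simp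
    moreover have "(indicator {0<..<1} t :: real) = indicator {0<..<1} (1 + - 1 * t)"
      by (auto simp: indicator_def)
    ultimately show "indicator {0<..<1} t *\<^sub>R (\<rho> (1 - t) / (of_real t - (1 - w))) = - ?f (1 + - 1 * t)"
      by (simp only: divide_minus_right) simp
  qed
  also have "\<dots> = - (\<integral>t. ?f (1 + - 1 * t) \<partial>lebesgue)" by simp
  also have "(\<integral>t. ?f (1 + - 1 * t) \<partial>lebesgue) = (\<integral>t. ?f t \<partial>lebesgue)"
    using lebesgue_integral_real_affine[of "-1" ?f 1] by simp
  also have "\<dots> = cauchy_transform \<rho> w"
    unfolding cauchy_transform_def by (subst integral_restrict_space) auto
  finally show ?thesis .
qed

text \<open>
  The Lebesgue form of the contour integral along the segment; see \<open>has_contour_integral_edge\<close>.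
\<close>
definition edge_integral :: "complex \<Rightarrow> complex \<Rightarrow> (complex \<Rightarrow> complex) \<Rightarrow> complex" where
  "edge_integral a b F = (\<integral>t. F (linepath a b t) \<partial>unit_leb) * (b - a)"

text \<open>
  The integral of \<open>F \<zeta> / (\<zeta> - z)\<close> along the segment, pulled back to the unit interval: the factor \<open>b - a\<close> of
  \<open>d\<zeta>\<close> cancels against that of \<open>\<zeta> - z\<close>.
\<close>
definition edge_cauchy :: "complex \<Rightarrow> complex \<Rightarrow> (complex \<Rightarrow> complex) \<Rightarrow> complex \<Rightarrow> complex" where
  "edge_cauchy a b F z = cauchy_transform (\<lambda>t. F (linepath a b t)) ((z - a) / (b - a))"

abbreviation end_powers :: "complex \<Rightarrow> complex \<Rightarrow> real \<Rightarrow> complex" where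
  "end_powers \<mu> \<nu> t \<equiv> exp (\<mu> * Ln (of_real t)) * exp (\<nu> * Ln (1 - of_real t))"

text \<open>
  Power-type behaviour \<open>(\<zeta> - a)\<^sup>\<mu>\<close> and \<open>(\<zeta> - b)\<^sup>\<nu>\<close> at the two ends, with a factor \<open>k\<close> that is holomorphic near
  the whole segment. This is all that the local analysis of the Cauchy transform uses, and it is stable under
  multiplication by entire functions.
\<close>
definition power_density ::
    "complex \<Rightarrow> complex \<Rightarrow> complex \<Rightarrow> complex \<Rightarrow> (complex \<Rightarrow> complex) \<Rightarrow> bool" where
  "power_density a b \<mu> \<nu> F \<longleftrightarrow> (\<exists>U k. open U \<and> closed_segment a b \<subseteq> U \<and> k holomorphic_on U \<and>
     (\<forall>t\<in>{0<..<1}. F (linepath a b t) =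
        end_powers \<mu> \<nu> t * k (linepath a b t)))"

lemma linepath_affine: "linepath a b t = a + of_real t * (b - a :: complex)"
  by (simp add: linepath_def scaleR_conv_of_real algebra_simps)

lemma affine_coordinate: "a \<noteq> b \<Longrightarrow> (linepath a b t - a) / (b - a) = complex_of_real t"
  by (simp add: linepath_affine)

lemma mem_closed_segment_coordinate:
  assumes "a \<noteq> b"
  shows "(z - a) / (b - a) \<in> unit_segment \<longleftrightarrow> z \<in> closed_segment a b"
proof
  assume "(z - a) / (b - a) \<in> unit_segment"
  then obtain t where "t \<in> {0..1}" "(z - a) / (b - a) = of_real t" by auto
  moreover from this have "z = linepath a b t" using assms by (simp add: linepath_affine field_simps)
  ultimately show "z \<in> closed_segment a b" by (simp add: linepath_in_path)
next
  assume "z \<in> closed_segment a b"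
  then obtain t where "t \<in> {0..1}" "z = linepath a b t"
    unfolding linepath_image_01[symmetric] by blast
  thus "(z - a) / (b - a) \<in> unit_segment" using assms by (simp add: affine_coordinate)
qed

lemma open_segmentE:
  assumes "z \<in> open_segment a b"
  obtains t where "t \<in> {0<..<1}" "z = linepath a b t"
  using assms unfolding in_segment by (auto simp: linepath_def)

lemma linepath_in_open_segment:
  "a \<noteq> b \<Longrightarrow> t \<in> {0<..<1} \<Longrightarrow> linepath a b t \<in> open_segment a b"
  unfolding in_segment linepath_def by auto

lemma power_density_mult:
  assumes "power_density a b \<mu> \<nu> F" "q holomorphic_on UNIV"
  shows "power_density a b \<mu> \<nu> (\<lambda>\<zeta>. F \<zeta> * q \<zeta>)"
proof -
  obtain U k where U: "open U" "closed_segment a b \<subseteq> U" "k holomorphic_on U"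
     "\<forall>t\<in>{0<..<1}. F (linepath a b t) =
        end_powers \<mu> \<nu> t * k (linepath a b t)"
    using assms(1) unfolding power_density_def by blast
  have "(\<lambda>\<zeta>. k \<zeta> * q \<zeta>) holomorphic_on U"
    using U(3) assms(2) by (intro holomorphic_intros) (auto elim: holomorphic_on_subset)
  thus ?thesis unfolding power_density_def using U
    by (intro exI[of _ U] exI[of _ "\<lambda>\<zeta>. k \<zeta> * q \<zeta>"]) (simp add: mult.assoc)
qed

lemma linepath_swap: "linepath b a t = linepath a b (1 - t)"
  by (simp add: linepath_def)

lemma power_density_swap:
  assumes "power_density a b \<mu> \<nu> F"
  shows "power_density b a \<nu> \<mu> F"
proof -
  obtain U k where U: "open U" "closed_segment a b \<subseteq> U" "k holomorphic_on U"
     "\<forall>t\<in>{0<..<1}. F (linepath a b t) =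
        end_powers \<mu> \<nu> t * k (linepath a b t)"
    using assms unfolding power_density_def by blast
  have *: "F (linepath b a t) = end_powers \<nu> \<mu> t * k (linepath b a t)"
    if "t \<in> {0<..<1}" for t
    using U(4)[rule_format, of "1 - t"] that unfolding linepath_swap[of b a] by (simp add: mult_ac)
  have "closed_segment b a \<subseteq> U" using U(2) by (simp add: closed_segment_commute)
  thus ?thesis unfolding power_density_def using U(1,3) *
    by (intro exI[of _ U] exI[of _ k] conjI ballI) assumption+
qed

lemma power_density_bounded:
  assumes F: "power_density a b \<mu> \<nu> F" and "0 \<le> Re \<mu>" "0 \<le> Re \<nu>"
  shows "bounded_density (\<lambda>t. F (linepath a b t))"
proof -
  obtain U k where U: "open U" "closed_segment a b \<subseteq> U" "k holomorphic_on U"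
     and eq: "\<forall>t\<in>{0<..<1}. F (linepath a b t) =
        end_powers \<mu> \<nu> t * k (linepath a b t)"
    using F unfolding power_density_def by blast
  have contk: "continuous_on (closed_segment a b) k"
    using U by (meson holomorphic_on_imp_continuous_on continuous_on_subset)
  hence "compact (k ` closed_segment a b)" by (intro compact_continuous_image) auto
  then obtain C where C: "\<forall>x\<in>k ` closed_segment a b. norm x \<le> C"
    using compact_imp_bounded bounded_iff by metis
  have in_seg: "linepath a b t \<in> closed_segment a b" if "t \<in> {0<..<1}" for t
    using that by (intro linepath_in_path) auto
  have bound: "norm (F (linepath a b t)) \<le> exp (\<bar>Im \<mu>\<bar> * pi) * exp (\<bar>Im \<nu>\<bar> * pi) * C"
    if t: "t \<in> {0<..<1}" for t
  proof -
    have "norm (1 - complex_of_real t) \<le> 1" using t norm_of_real[of "1 - t", where ?'a = complex] by simp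
    moreover have "1 - complex_of_real t \<noteq> 0" using t by (auto simp: complex_eq_iff)
    ultimately show ?thesis
      unfolding eq[rule_format, OF t] norm_mult using t C in_seg[OF t] assms
      by (intro mult_mono norm_exp_Ln_le) auto
  qed
  have "continuous_on {0<..<1} (\<lambda>t. end_powers \<mu> \<nu> t * k (linepath a b t))"
  proof (intro continuous_intros)
    show "continuous_on {0<..<1} (\<lambda>t. k (linepath a b t))"
      by (rule continuous_on_compose2[OF contk]) (use in_seg in \<open>auto intro: continuous_on_linepath\<close>)
  qed (auto simp: complex_nonpos_Reals_iff)
  hence "continuous_on {0<..<1} (\<lambda>t. F (linepath a b t))"
    using eq by (auto elim: continuous_on_eq)
  hence "(\<lambda>t. F (linepath a b t)) \<in> borel_measurable unit_leb" by (rule measurable_continuous_unit_leb)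
  thus ?thesis by (rule bounded_densityI[OF _ bound])
qed

lemma edge_cauchy_holomorphic:
  assumes "bounded_density (\<lambda>t. F (linepath a b t))" "a \<noteq> b"
  shows "edge_cauchy a b F holomorphic_on - closed_segment a b"
proof -
  have "(cauchy_transform (\<lambda>t. F (linepath a b t)) \<circ> (\<lambda>z. (z - a) / (b - a))) holomorphic_on - closed_segment a b"
    by (rule holomorphic_on_compose_gen[OF _ cauchy_transform_holomorphic[OF assms(1)]])
      (use assms(2) in \<open>auto intro!: holomorphic_intros simp: mem_closed_segment_coordinate[symmetric] simp del: image_iff\<close>)
  thus ?thesis by (simp add: edge_cauchy_def[abs_def] o_def)
qed

lemma edge_cauchy_tendsto:
  assumes "bounded_density (\<lambda>t. F (linepath a b t))" "a \<noteq> b" "z \<notin> closed_segment a b"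
  shows "(edge_cauchy a b F \<longlongrightarrow> edge_cauchy a b F z) (at z within S)"
proof -
  have "isCont (edge_cauchy a b F) z"
    using assms by (intro holomorphic_on_imp_isCont[OF edge_cauchy_holomorphic]) auto
  thus ?thesis unfolding isCont_def by (rule Lim_at_imp_Lim_at_within)
qed

lemma edge_cauchy_jump:
  assumes F: "power_density a b \<mu> \<nu> F" and \<mu>\<nu>: "0 \<le> Re \<mu>" "0 \<le> Re \<nu>" and ab: "a \<noteq> b"
    and z0: "z0 \<in> open_segment a b"
  obtains lp lm where
    "(edge_cauchy a b F \<longlongrightarrow> lp) (at z0 within left_side a b)"
    "(edge_cauchy a b F \<longlongrightarrow> lm) (at z0 within right_side a b)"
    "lp - lm = 2 * pi * \<i> * F z0"
proof -
  obtain U k where U: "open U" "closed_segment a b \<subseteq> U" "k holomorphic_on U"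
     and eq: "\<forall>t\<in>{0<..<1}. F (linepath a b t) =
        end_powers \<mu> \<nu> t * k (linepath a b t)"
    using F unfolding power_density_def by blast
  obtain t0 where t0: "t0 \<in> {0<..<1}" "z0 = linepath a b t0" by (rule open_segmentE[OF z0])
  define D where "D = - \<real>\<^sub>\<le>\<^sub>0 \<inter> (\<lambda>w. 1 - w) -` (- \<real>\<^sub>\<le>\<^sub>0) \<inter> (\<lambda>w. a + w * (b - a)) -` U"
  have openD: "open D"
    unfolding D_def using U(1)
    by (intro open_Int open_vimage) (auto intro!: continuous_intros simp: open_Compl)
  define H where "H w = exp (\<mu> * Ln w) * exp (\<nu> * Ln (1 - w)) * k (a + w * (b - a))" for w
  have "(k \<circ> (\<lambda>w. a + w * (b - a))) holomorphic_on D"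
    by (rule holomorphic_on_compose_gen[OF _ U(3)]) (auto simp: D_def intro!: holomorphic_intros)
  hence "H holomorphic_on D"
    unfolding H_def o_def by (intro holomorphic_intros) (auto simp: D_def)
  moreover have "of_real t0 \<in> D"
    using t0 U(2) linepath_in_path[of t0 a b]
    by (auto simp: D_def complex_nonpos_Reals_iff linepath_affine)
  ultimately obtain lp lm where l:
    "(cauchy_transform (\<lambda>t. F (linepath a b t)) \<longlongrightarrow> lp) (at (of_real t0) within left_side 0 1)"
    "(cauchy_transform (\<lambda>t. F (linepath a b t)) \<longlongrightarrow> lm) (at (of_real t0) within right_side 0 1)"
    "lp - lm = 2 * pi * \<i> * F (linepath a b t0)"
    by (rule plemelj_jump[OF power_density_bounded[OF F \<mu>\<nu>] openD _ t0(1)])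
      (use eq in \<open>auto simp: H_def linepath_affine\<close>)
  have coord: "((\<lambda>z. (z - a) / (b - a)) \<longlongrightarrow> of_real t0) (at z0 within S)" for S
    using ab t0(2) by (auto intro!: tendsto_eq_intros simp: affine_coordinate)
  have ne: "(z - a) / (b - a) \<noteq> of_real t0" if "z \<noteq> z0" for z
    using that ab t0(2) by (auto simp: field_simps linepath_affine)
  have "filterlim (\<lambda>z. (z - a) / (b - a)) (at (of_real t0) within left_side 0 1) (at z0 within left_side a b)"
    using coord ne by (auto simp: filterlim_at eventually_at_filter left_side_def intro!: always_eventually)
  from filterlim_compose[OF l(1) this]
  have 1: "(edge_cauchy a b F \<longlongrightarrow> lp) (at z0 within left_side a b)"
    by (simp add: edge_cauchy_def[abs_def])
  have "filterlim (\<lambda>z. (z - a) / (b - a)) (at (of_real t0) within right_side 0 1) (at z0 within right_side a b)"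
    using coord ne by (auto simp: filterlim_at eventually_at_filter right_side_def intro!: always_eventually)
  from filterlim_compose[OF l(2) this]
  have 2: "(edge_cauchy a b F \<longlongrightarrow> lm) (at z0 within right_side a b)"
    by (simp add: edge_cauchy_def[abs_def])
  from that[OF 1 2] l(3) t0 show ?thesis by simp
qed

lemma edge_cauchy_bounded_at_start:
  assumes F: "power_density a b \<mu> \<nu> F" and \<mu>\<nu>: "0 \<le> Re \<mu>" "0 \<le> Re \<nu>" "\<mu> \<notin> \<int>" and ab: "a \<noteq> b"
  shows "Bfun (edge_cauchy a b F) (at a within - closed_segment a b)"
proof -
  obtain U k where U: "open U" "closed_segment a b \<subseteq> U" "k holomorphic_on U"
     and eq: "\<forall>t\<in>{0<..<1}. F (linepath a b t) =
        end_powers \<mu> \<nu> t * k (linepath a b t)"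
    using F unfolding power_density_def by blast
  have "open ((\<lambda>w. a + w * (b - a)) -` U)"
    using U(1) by (intro open_vimage) (auto intro!: continuous_intros)
  moreover have "0 \<in> (\<lambda>w. a + w * (b - a)) -` U" using U(2) by auto
  ultimately obtain r where r: "r > 0" "ball 0 r \<subseteq> (\<lambda>w. a + w * (b - a)) -` U" by (rule openE)
  define R where "R = min r 1"
  define A where "A w = exp (\<nu> * Ln (1 - w)) * k (a + w * (b - a))" for w
  have "(k \<circ> (\<lambda>w. a + w * (b - a))) holomorphic_on ball 0 R"
    by (rule holomorphic_on_compose_gen[OF _ U(3)]) (use r in \<open>auto simp: R_def intro!: holomorphic_intros\<close>)
  moreover have "1 - w \<notin> \<real>\<^sub>\<le>\<^sub>0" if "w \<in> ball 0 R" for w :: complex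
    using that abs_Re_le_cmod[of w] by (auto simp: R_def complex_nonpos_Reals_iff)
  ultimately have "A holomorphic_on ball 0 R"
    unfolding A_def o_def by (intro holomorphic_intros) auto
  hence "Bfun (cauchy_transform (\<lambda>t. F (linepath a b t))) (at 0 within - unit_segment)"
    using eq r by (intro cauchy_transform_bounded_at_0[OF power_density_bounded[OF F \<mu>\<nu>(1,2)] \<mu>\<nu>(1,3), of R A])
      (auto simp: A_def R_def linepath_affine)
  then obtain K where K: "\<forall>\<^sub>F w in at 0 within - unit_segment. norm (cauchy_transform (\<lambda>t. F (linepath a b t)) w) \<le> K"
    by (auto elim: BfunE)
  have "filterlim (\<lambda>z. (z - a) / (b - a)) (at 0 within - unit_segment) (at a within - closed_segment a b)"
    unfolding filterlim_at
  proof
    show "\<forall>\<^sub>F z in at a within - closed_segment a b. (z - a) / (b - a) \<in> - unit_segment \<and> (z - a) / (b - a) \<noteq> 0"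
      using ab unfolding eventually_at_filter Compl_iff mem_closed_segment_coordinate[OF ab]
      by (intro always_eventually) auto
    show "((\<lambda>z. (z - a) / (b - a)) \<longlongrightarrow> 0) (at a within - closed_segment a b)"
      using ab by (auto intro!: tendsto_eq_intros)
  qed
  from eventually_compose_filterlim[OF K this] show ?thesis
    unfolding edge_cauchy_def[abs_def] by (rule BfunI)
qed

lemma edge_cauchy_swap:
  assumes "a \<noteq> b"
  shows "edge_cauchy b a F z = - edge_cauchy a b F z"
proof -
  have "(z - b) / (a - b) = 1 - (z - a) / (b - a)" using assms by (simp add: field_simps)
  thus ?thesis
    unfolding edge_cauchy_def linepath_swap[of b a]
    using cauchy_transform_reflect[of "\<lambda>t. F (linepath a b t)" "(z - a) / (b - a)"] by simp
qed

lemma edge_cauchy_bounded_at_end: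
  assumes F: "power_density a b \<mu> \<nu> F" and \<mu>\<nu>: "0 \<le> Re \<mu>" "0 \<le> Re \<nu>" "\<nu> \<notin> \<int>" and ab: "a \<noteq> b"
  shows "Bfun (edge_cauchy a b F) (at b within - closed_segment a b)"
proof -
  have "Bfun (edge_cauchy b a F) (at b within - closed_segment b a)"
    using assms by (intro edge_cauchy_bounded_at_start[OF power_density_swap[OF F]]) auto
  thus ?thesis using ab unfolding Bfun_def
    by (simp add: edge_cauchy_swap[of a b] closed_segment_commute[of b a])
qed

text \<open>
  One step of the expansion of the Cauchy transform at infinity.
\<close>
lemma edge_cauchy_times:
  assumes F: "bounded_density (\<lambda>t. F (linepath a b t))" and ab: "a \<noteq> b" and z: "z \<notin> closed_segment a b"
  shows "edge_cauchy a b (\<lambda>\<zeta>. F \<zeta> * \<zeta>) z = z * edge_cauchy a b F z + edge_integral a b F"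
proof -
  let ?\<rho> = "\<lambda>t. F (linepath a b t)"
  let ?w = "(z - a) / (b - a)"
  have w: "?w \<notin> unit_segment" using z ab mem_closed_segment_coordinate by blast
  have 1: "bounded_density (\<lambda>t. of_real t * ?\<rho> t)"
    by (intro bounded_density_times_bounded F continuous_intros)
  have gen: "r * (a + s * (b - a)) / d = a * (r / d) + (b - a) * (s * r / d)" for r s d
    by (simp add: divide_inverse algebra_simps)
  have "edge_cauchy a b (\<lambda>\<zeta>. F \<zeta> * \<zeta>) z
      = (\<integral>t. a * (?\<rho> t / (of_real t - ?w)) + (b - a) * (of_real t * ?\<rho> t / (of_real t - ?w)) \<partial>unit_leb)"
    unfolding edge_cauchy_def cauchy_transform_def
    by (intro Bochner_Integration.integral_cong refl) (simp only: linepath_affine gen)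
  also have "\<dots> = a * cauchy_transform ?\<rho> ?w + (b - a) * cauchy_transform (\<lambda>t. of_real t * ?\<rho> t) ?w"
    unfolding cauchy_transform_def integral_mult_right_zero[symmetric]
    by (intro Bochner_Integration.integral_add integrable_mult_right
          bounded_density_integrable bounded_density_kernel F w 1)
  also have "\<dots> = a * cauchy_transform ?\<rho> ?w + (b - a) * (?w * cauchy_transform ?\<rho> ?w + (\<integral>t. ?\<rho> t \<partial>unit_leb))"
    using cauchy_transform_mult_of_real[OF F w] by simp
  also have "\<dots> = z * edge_cauchy a b F z + edge_integral a b F"
    using ab by (simp add: edge_cauchy_def edge_integral_def field_simps)
  finally show ?thesis .
qed

lemma edge_cauchy_bounded_far:
  assumes "bounded_density (\<lambda>t. F (linepath a b t))" "a \<noteq> b"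
  shows "Bfun (edge_cauchy a b F) at_infinity"
proof -
  obtain B where B: "\<And>w. norm w \<ge> 2 \<Longrightarrow> norm (cauchy_transform (\<lambda>t. F (linepath a b t)) w) \<le> B"
    by (rule cauchy_transform_bounded_far[OF assms(1)]) blast
  have "norm (edge_cauchy a b F z) \<le> B" if "norm z \<ge> norm a + 2 * norm (b - a)" for z
    unfolding edge_cauchy_def
  proof (rule B)
    have "norm z \<le> norm (z - a) + norm a" using norm_triangle_sub by (simp add: add.commute)
    hence "2 * norm (b - a) \<le> norm (z - a)" using that by linarith
    thus "2 \<le> norm ((z - a) / (b - a))" using assms(2) by (simp add: norm_divide field_simps)
  qed
  hence "\<forall>\<^sub>F z in at_infinity. norm (edge_cauchy a b F z) \<le> B"
    unfolding eventually_at_infinity by blast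
  thus ?thesis by (rule BfunI)
qed

lemma has_contour_integral_edge:
  assumes "bounded_density (\<lambda>t. F (linepath a b t))"
  shows "(F has_contour_integral edge_integral a b F) (linepath a b)"
proof -
  have "((\<lambda>t. F (linepath a b t)) has_integral (\<integral>t. F (linepath a b t) \<partial>unit_leb)) {0<..<1}"
    by (rule has_integral_integral_lebesgue_on[OF bounded_density_integrable[OF assms]]) auto
  hence "((\<lambda>t. F (linepath a b t) * (b - a)) has_integral edge_integral a b F) {0<..<1}"
    unfolding edge_integral_def by (rule has_integral_mult_left)
  thus ?thesis by (simp add: has_contour_integral_linepath has_integral_Icc_iff_Ioo)
qed

section \<open>The weight on the edges\<close>

text \<open>
  A branch of \<open>(z - a)\<^sup>\<alpha> (z - b)\<^sup>\<beta> (z - c)\<^sup>\<gamma>\<close>, up to a constant factor. Each quotient is positive or, for the third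
  one, off the negative axis when \<open>z\<close> lies on the open segment from \<open>a\<close> to \<open>b\<close>, so the principal logarithms
  are holomorphic there.
\<close>
definition edge_branch ::
    "complex \<Rightarrow> complex \<Rightarrow> complex \<Rightarrow> complex \<Rightarrow> complex \<Rightarrow> complex \<Rightarrow> complex \<Rightarrow> complex" where
  "edge_branch a b c \<alpha> \<beta> \<gamma> z = exp (\<alpha> * Ln ((z - a) / (b - a))) *
     exp (\<beta> * Ln ((b - z) / (b - a))) * exp (\<gamma> * Ln ((z - c) / (a - c)))"

definition edge_domain :: "complex \<Rightarrow> complex \<Rightarrow> complex \<Rightarrow> complex set" where
  "edge_domain a b c = {z. (z - a) / (b - a) \<notin> \<real>\<^sub>\<le>\<^sub>0 \<and> (b - z) / (b - a) \<notin> \<real>\<^sub>\<le>\<^sub>0 \<and> (z - c) / (a - c) \<notin> \<real>\<^sub>\<le>\<^sub>0}"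

lemma edge_branch_nonzero: "edge_branch a b c \<alpha> \<beta> \<gamma> z \<noteq> 0"
  by (simp add: edge_branch_def)

lemma edge_branch_square: "(edge_branch a b c \<alpha> \<beta> \<gamma> z)\<^sup>2 = edge_branch a b c (2 * \<alpha>) (2 * \<beta>) (2 * \<gamma>) z"
  by (simp add: edge_branch_def power_mult_distrib exp_double[symmetric] mult.assoc)

lemma open_nonpos_vimage:
  fixes u v :: complex
  shows "open {z. (u + v * z) \<notin> \<real>\<^sub>\<le>\<^sub>0}"
proof -
  have "open ((\<lambda>z. u + v * z) -` (- \<real>\<^sub>\<le>\<^sub>0))"
    by (intro open_vimage open_Compl) (auto intro!: continuous_intros)
  thus ?thesis by (simp add: vimage_def)
qed

lemma open_edge_domain: "open (edge_domain a b c)"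
proof -
  have "edge_domain a b c = {z. (- a / (b - a) + 1 / (b - a) * z) \<notin> \<real>\<^sub>\<le>\<^sub>0} \<inter>
      {z. (b / (b - a) + (- 1 / (b - a)) * z) \<notin> \<real>\<^sub>\<le>\<^sub>0} \<inter> {z. (- c / (a - c) + 1 / (a - c) * z) \<notin> \<real>\<^sub>\<le>\<^sub>0}"
    by (auto simp: edge_domain_def diff_divide_distrib)
  thus ?thesis by (metis open_Int open_nonpos_vimage)
qed

text \<open>
  A negative quotient would put \<open>c\<close> between \<open>z\<close> and \<open>a\<close>, hence on the segment.
\<close>
lemma third_point_nonpos:
  fixes a b c z :: complex
  assumes "c \<notin> closed_segment a b" "z \<in> closed_segment a b"
  shows "(z - c) / (a - c) \<notin> \<real>\<^sub>\<le>\<^sub>0"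
proof
  assume "(z - c) / (a - c) \<in> \<real>\<^sub>\<le>\<^sub>0"
  moreover have "(z - c) / (a - c) = (c - z) / (c - a)"
    using minus_divide_divide[of "z - c" "a - c"] by simp
  ultimately have "c \<in> closed_segment z a" by (intro ratio_nonpos) simp
  also have "\<dots> \<subseteq> closed_segment a b" using assms(2) by (simp add: subset_closed_segment)
  finally show False using assms(1) by contradiction
qed

lemma open_segment_edge_domain:
  assumes "a \<noteq> b" "c \<notin> closed_segment a b"
  shows "open_segment a b \<subseteq> edge_domain a b c"
proof
  fix z assume z: "z \<in> open_segment a b"
  then obtain t where t: "t \<in> {0<..<1}" "z = linepath a b t" by (rule open_segmentE)
  have "(b - z) / (b - a) = complex_of_real (1 - t)"
    using assms(1) t by (simp add: linepath_affine field_simps)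
  moreover have "(z - a) / (b - a) = complex_of_real t" using assms(1) t by (simp add: affine_coordinate)
  moreover have "(z - c) / (a - c) \<notin> \<real>\<^sub>\<le>\<^sub>0"
    using assms(2) z by (intro third_point_nonpos) (auto simp: open_segment_def)
  ultimately show "z \<in> edge_domain a b c"
    using t unfolding edge_domain_def by (auto simp: complex_nonpos_Reals_iff)
qed

lemma edge_domain_neq:
  assumes "z \<in> edge_domain a b c"
  shows "z \<noteq> a" "z \<noteq> b" "z \<noteq> c" "a \<noteq> b" "a \<noteq> c"
  using assms by (auto simp: edge_domain_def)

lemma has_field_derivative_Ln_quotient:
  fixes d p z :: complex
  assumes "d \<noteq> 0" "z \<noteq> p" "(z - p) / d \<notin> \<real>\<^sub>\<le>\<^sub>0"
  shows "((\<lambda>z. Ln ((z - p) / d)) has_field_derivative 1 / (z - p)) (at z)"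
  using assms by (auto intro!: derivative_eq_intros simp: field_simps)

lemma has_field_derivative_edge_branch:
  assumes "z \<in> edge_domain a b c"
  shows "(edge_branch a b c \<alpha> \<beta> \<gamma> has_field_derivative
    edge_branch a b c \<alpha> \<beta> \<gamma> z * (\<alpha> / (z - a) + \<beta> / (z - b) + \<gamma> / (z - c))) (at z)"
proof -
  note ne = edge_domain_neq[OF assms]
  have np: "(z - a) / (b - a) \<notin> \<real>\<^sub>\<le>\<^sub>0" "(b - z) / (b - a) \<notin> \<real>\<^sub>\<le>\<^sub>0" "(z - c) / (a - c) \<notin> \<real>\<^sub>\<le>\<^sub>0"
    using assms by (auto simp: edge_domain_def)
  have d1: "((\<lambda>z. Ln ((z - a) / (b - a))) has_field_derivative 1 / (z - a)) (at z)"
    using np(1) ne by (intro has_field_derivative_Ln_quotient) auto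
  have "(b - z) / (b - a) = (z - b) / (a - b)" for z
    using minus_divide_divide[of "z - b" "a - b"] by simp
  hence d2: "((\<lambda>z. Ln ((b - z) / (b - a))) has_field_derivative 1 / (z - b)) (at z)"
    using np(2) ne has_field_derivative_Ln_quotient[of "a - b" z b] by simp
  have d3: "((\<lambda>z. Ln ((z - c) / (a - c))) has_field_derivative 1 / (z - c)) (at z)"
    using np(3) ne by (intro has_field_derivative_Ln_quotient) auto
  have "((\<lambda>z. exp (\<alpha> * Ln ((z - a) / (b - a)) + \<beta> * Ln ((b - z) / (b - a)) + \<gamma> * Ln ((z - c) / (a - c))))
      has_field_derivative exp (\<alpha> * Ln ((z - a) / (b - a)) + \<beta> * Ln ((b - z) / (b - a)) + \<gamma> * Ln ((z - c) / (a - c)))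
        * (\<alpha> * (1 / (z - a)) + \<beta> * (1 / (z - b)) + \<gamma> * (1 / (z - c)))) (at z)"
    by (intro DERIV_fun_exp DERIV_add DERIV_cmult d1 d2 d3)
  thus ?thesis by (simp add: edge_branch_def[abs_def] exp_add)
qed

text \<open>
  Both \<open>f\<close> and the branch have the same logarithmic derivative, so their quotient is constant on the part of \<open>H\<close>
  in a small disc around each point of the edge. Discs around neighbouring points overlap inside
  \<open>H\<close>, so the constant is locally constant along the edge, and the edge is connected. This avoids any appeal to
  the global shape of the domain of \<open>f\<close>.
\<close>
lemma one_sided_branch_limit:
  assumes ab: "a \<noteq> b" "c \<notin> closed_segment a b"
    and H: "convex H" "open H" "\<And>z. z \<in> open_segment a b \<Longrightarrow> at z within H \<noteq> bot"
    and R: "closed R" "open_segment a b \<inter> R = {}"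
    and der: "\<And>z. z \<in> H - R \<Longrightarrow>
      (f has_field_derivative f z * (\<alpha> / (z - a) + \<beta> / (z - b) + \<gamma> / (z - c))) (at z)"
  shows "\<exists>C. \<forall>z\<in>open_segment a b. (f \<longlongrightarrow> C * edge_branch a b c \<alpha> \<beta> \<gamma> z) (at z within H)"
proof -
  let ?B = "edge_branch a b c \<alpha> \<beta> \<gamma>" and ?S = "open_segment a b"
  have "\<forall>z0\<in>?S. \<exists>r C. r > 0 \<and> (\<forall>z\<in>ball z0 r \<inter> H. f z = C * ?B z)"
  proof
    fix z0 assume z0: "z0 \<in> ?S"
    have "open (edge_domain a b c - R)" using open_edge_domain R(1) by (rule open_Diff)
    moreover have "z0 \<in> edge_domain a b c - R"
      using z0 R(2) open_segment_edge_domain[OF ab] by auto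
    ultimately obtain r where r: "r > 0" "ball z0 r \<subseteq> edge_domain a b c - R" by (rule openE)
    have "\<exists>C. \<forall>z\<in>ball z0 r \<inter> H. f z / ?B z = C"
    proof (rule has_field_derivative_zero_constant)
      show "convex (ball z0 r \<inter> H)" using H(1) by (intro convex_Int convex_ball)
      fix z assume z: "z \<in> ball z0 r \<inter> H"
      define s where "s = \<alpha> / (z - a) + \<beta> / (z - b) + \<gamma> / (z - c)"
      have "(f has_field_derivative f z * s) (at z)" "(?B has_field_derivative ?B z * s) (at z)"
        unfolding s_def using z r by (auto intro!: der has_field_derivative_edge_branch)
      hence "((\<lambda>z. f z / ?B z) has_field_derivative (f z * s * ?B z - f z * (?B z * s)) / (?B z * ?B z)) (at z)"
        using edge_branch_nonzero by (intro DERIV_divide) auto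
      hence "((\<lambda>z. f z / ?B z) has_field_derivative 0) (at z)" by (simp add: mult_ac)
      thus "((\<lambda>z. f z / ?B z) has_field_derivative 0) (at z within ball z0 r \<inter> H)"
        by (rule has_field_derivative_at_within)
    qed
    then obtain C where "\<forall>z\<in>ball z0 r \<inter> H. f z / ?B z = C" by blast
    thus "\<exists>r C. r > 0 \<and> (\<forall>z\<in>ball z0 r \<inter> H. f z = C * ?B z)"
      using r(1) edge_branch_nonzero by (intro exI[of _ r] exI[of _ C]) (auto simp: field_simps)
  qed
  from bchoice[OF this] obtain r where "\<forall>z0\<in>?S. \<exists>C. r z0 > 0 \<and> (\<forall>z\<in>ball z0 (r z0) \<inter> H. f z = C * ?B z)" by blast
  from bchoice[OF this] obtain C where rC: "\<forall>z0\<in>?S. r z0 > 0 \<and> (\<forall>z\<in>ball z0 (r z0) \<inter> H. f z = C z0 * ?B z)" by blast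
  have ev: "\<forall>\<^sub>F z in at z1 within H. z \<in> ball z0 (r z0) \<inter> H" if "z1 \<in> ball z0 (r z0)" for z0 z1
    using that unfolding eventually_at_topological by (intro exI[of _ "ball z0 (r z0)"]) auto
  have "C constant_on ?S"
  proof (rule locally_constant_imp_constant)
    show "connected ?S" by (intro convex_connected) simp
    fix z0 assume z0: "z0 \<in> ?S"
    have "C z1 = C z0" if z1: "z1 \<in> ?S" "z1 \<in> ball z0 (r z0)" for z1
    proof -
      have "z1 \<in> ball z1 (r z1)" using rC z1 by auto
      from eventually_conj[OF ev[OF z1(2)] ev[OF this]] obtain z where
        "z \<in> ball z0 (r z0) \<inter> H" "z \<in> ball z1 (r z1) \<inter> H"
        using eventually_happens'[OF H(3)[OF z1(1)]] by blast
      hence "C z0 * ?B z = C z1 * ?B z" using rC z0 z1 by metis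
      thus ?thesis using edge_branch_nonzero by simp
    qed
    hence "\<forall>z\<in>?S \<inter> ball z0 (r z0). C z = C z0" by blast
    moreover have "openin (top_of_set ?S) (?S \<inter> ball z0 (r z0))" by (intro openin_open_Int) auto
    moreover have "z0 \<in> ?S \<inter> ball z0 (r z0)" using rC z0 by simp
    ultimately show "\<exists>T. openin (top_of_set ?S) T \<and> z0 \<in> T \<and> (\<forall>z\<in>T. C z = C z0)" by blast
  qed
  then obtain K where K: "\<forall>z\<in>?S. C z = K" unfolding constant_on_def by blast
  show ?thesis
  proof (intro exI[of _ K] ballI)
    fix z0 assume z0: "z0 \<in> ?S"
    have "isCont ?B z0"
      using z0 open_segment_edge_domain[OF ab]
      by (intro DERIV_isCont[OF has_field_derivative_edge_branch]) auto
    hence "((\<lambda>z. K * ?B z) \<longlongrightarrow> K * ?B z0) (at z0)" by (intro tendsto_intros) (simp add: isCont_def)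
    hence lim: "((\<lambda>z. K * ?B z) \<longlongrightarrow> K * ?B z0) (at z0 within H)" by (rule Lim_at_imp_Lim_at_within)
    have "\<forall>\<^sub>F z in at z0 within H. K * ?B z = f z"
      using ev[of z0 z0] rC z0 K by (auto elim!: eventually_mono)
    from Lim_transform_eventually[OF lim this] show "(f \<longlongrightarrow> K * ?B z0) (at z0 within H)" .
  qed
qed

lemma edge_branch_power_density:
  assumes ab: "a \<noteq> b" "c \<notin> closed_segment a b"
    and F: "\<And>z. z \<in> open_segment a b \<Longrightarrow> F z = C * edge_branch a b c \<mu> \<nu> \<kappa> z"
  shows "power_density a b \<mu> \<nu> F"
  unfolding power_density_def
proof (intro exI conjI ballI)
  have "{z. (z - c) / (a - c) \<notin> \<real>\<^sub>\<le>\<^sub>0} = {z. (- c / (a - c) + 1 / (a - c) * z) \<notin> \<real>\<^sub>\<le>\<^sub>0}"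
    by (simp add: diff_divide_distrib)
  thus "open {z. (z - c) / (a - c) \<notin> \<real>\<^sub>\<le>\<^sub>0}" by (simp only: open_nonpos_vimage)
  show "closed_segment a b \<subseteq> {z. (z - c) / (a - c) \<notin> \<real>\<^sub>\<le>\<^sub>0}"
    using third_point_nonpos[OF ab(2)] by blast
  have "a \<noteq> c" using ab(2) by auto
  thus "(\<lambda>z. C * exp (\<kappa> * Ln ((z - c) / (a - c)))) holomorphic_on {z. (z - c) / (a - c) \<notin> \<real>\<^sub>\<le>\<^sub>0}"
    by (intro holomorphic_intros) auto
  fix t :: real assume t: "t \<in> {0<..<1}"
  have "(b - linepath a b t) / (b - a) = 1 - of_real t"
    using ab(1) by (simp add: linepath_affine field_simps)
  thus "F (linepath a b t) = end_powers \<mu> \<nu> t * (C * exp (\<kappa> * Ln ((linepath a b t - c) / (a - c))))"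
    unfolding F[OF linepath_in_open_segment[OF ab(1) t]] edge_branch_def affine_coordinate[OF ab(1)]
    by simp
qed

text \<open>
  The integrand is the derivative of \<open>(\<zeta> - a) (\<zeta> - b) (\<zeta> - c) F \<zeta> q \<zeta>\<close>, which vanishes at both ends because
  \<open>F\<close> is bounded.
\<close>
lemma edge_pearson:
  assumes ab: "a \<noteq> b" "c \<notin> closed_segment a b"
    and F: "\<And>z. z \<in> open_segment a b \<Longrightarrow> F z = C * edge_branch a b c \<mu> \<nu> \<kappa> z"
    and \<mu>\<nu>: "0 \<le> Re \<mu>" "0 \<le> Re \<nu>"
    and q: "q holomorphic_on UNIV"
  shows "edge_integral a b (\<lambda>\<zeta>. F \<zeta> * ((\<zeta> - a) * (\<zeta> - b) * (\<zeta> - c) * deriv q \<zeta> +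
    ((1 + \<mu>) * ((\<zeta> - b) * (\<zeta> - c)) + (1 + \<nu>) * ((\<zeta> - a) * (\<zeta> - c)) + (1 + \<kappa>) * ((\<zeta> - a) * (\<zeta> - b))) * q \<zeta>)) = 0"
    (is "edge_integral a b (\<lambda>\<zeta>. F \<zeta> * ?Q \<zeta>) = 0")
proof -
  have PD: "power_density a b \<mu> \<nu> F" by (rule edge_branch_power_density[OF ab F])
  define G where "G z = C * edge_branch a b c \<mu> \<nu> \<kappa> z" for z
  define W where "W z = (z - a) * (z - b) * (z - c)" for z
  define P where "P z = W z * (G z * q z)" for z
  have dP: "(P has_field_derivative F z * ?Q z) (at z)" if z: "z \<in> open_segment a b" for z
  proof -
    have zd: "z \<in> edge_domain a b c" using z open_segment_edge_domain[OF ab] by blast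
    note ne = edge_domain_neq[OF zd]
    have G': "(G has_field_derivative G z * (\<mu> / (z - a) + \<nu> / (z - b) + \<kappa> / (z - c))) (at z)"
      unfolding G_def mult.assoc by (intro DERIV_cmult has_field_derivative_edge_branch zd)
    have q': "(q has_field_derivative deriv q z) (at z)"
      using q by (intro holomorphic_derivI[of q UNIV]) auto
    have W': "(W has_field_derivative ((z - b) * (z - c) + (z - a) * (z - c) + (z - a) * (z - b))) (at z)"
      unfolding W_def by (auto intro!: derivative_eq_intros simp: algebra_simps)
    define D where "D = (z - b) * (z - c) + (z - a) * (z - c) + (z - a) * (z - b)"
    define S where "S = \<mu> / (z - a) + \<nu> / (z - b) + \<kappa> / (z - c)"
    have WS: "W z * S = \<mu> * ((z - b) * (z - c)) + \<nu> * ((z - a) * (z - c)) + \<kappa> * ((z - a) * (z - b))"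
      using ne by (simp add: W_def S_def divide_simps) (simp add: algebra_simps)
    have "(P has_field_derivative D * (G z * q z) + (G z * S * q z + deriv q z * G z) * W z) (at z)"
      unfolding P_def D_def S_def by (intro DERIV_mult W' G' q')
    also have "D * (G z * q z) + (G z * S * q z + deriv q z * G z) * W z
        = G z * (W z * deriv q z + (D + W z * S) * q z)" by (simp add: algebra_simps)
    also have "\<dots> = G z * ?Q z" unfolding WS by (simp add: W_def D_def algebra_simps)
    finally show ?thesis using F[OF z] by (simp add: G_def)
  qed
  have cont: "continuous_on {0..1} (\<lambda>t. P (linepath a b t))"
  proof -
    obtain B where B: "\<forall>t\<in>{0<..<1}. norm (F (linepath a b t) * q (linepath a b t)) \<le> B"
      using power_density_bounded[OF power_density_mult[OF PD q] \<mu>\<nu>] unfolding bounded_density_def by blast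
    have B0: "0 \<le> B" using order_trans[OF norm_ge_zero bspec[OF B, of "1/2"]] by simp
    have bound: "norm (P (linepath a b t)) \<le> norm (W (linepath a b t)) * B" if "t \<in> {0..1}" for t
    proof (cases "t \<in> {0<..<1}")
      case True
      show ?thesis using bspec[OF B True] F[OF linepath_in_open_segment[OF ab(1) True]]
        unfolding P_def norm_mult[of "W _"] by (intro mult_left_mono) (simp_all add: G_def)
    next
      case False
      hence "t = 0 \<or> t = 1" using that by auto
      hence "W (linepath a b t) = 0" by (auto simp: W_def linepath_affine)
      thus ?thesis by (simp add: P_def)
    qed
    have contW: "continuous_on UNIV (\<lambda>t. norm (W (linepath a b t)) * B)"
      unfolding W_def by (intro continuous_intros continuous_on_linepath)
    show ?thesis unfolding continuous_on_eq_continuous_within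
    proof
      fix t :: real assume t: "t \<in> {0..1}"
      show "continuous (at t within {0..1}) (\<lambda>t. P (linepath a b t))"
      proof (cases "t \<in> {0<..<1}")
        case True
        have "isCont P (linepath a b t)"
          by (rule DERIV_isCont[OF dP[OF linepath_in_open_segment[OF ab(1) True]]])
        hence "isCont (\<lambda>t. P (linepath a b t)) t"
          using isCont_o2[OF _ , of t "linepath a b" P] continuous_linepath_at by blast
        thus ?thesis by (rule continuous_at_imp_continuous_at_within)
      next
        case False
        hence "t = 0 \<or> t = 1" using t by auto
        hence W0: "W (linepath a b t) = 0" by (auto simp: W_def linepath_affine)
        have "((\<lambda>t. norm (W (linepath a b t)) * B) \<longlongrightarrow> norm (W (linepath a b t)) * B) (at t within {0..1})"
          using contW by (meson UNIV_I continuous_on_def tendsto_within_subset subset_UNIV)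
        moreover have "\<forall>\<^sub>F t in at t within {0..1}. norm (P (linepath a b t)) \<le> norm (W (linepath a b t)) * B"
          using bound by (auto simp: eventually_at_filter intro!: always_eventually)
        ultimately have "((\<lambda>t. P (linepath a b t)) \<longlongrightarrow> 0) (at t within {0..1})"
          using W0 by (intro Lim_null_comparison[of "\<lambda>t. P (linepath a b t)" "\<lambda>t. norm (W (linepath a b t)) * B"]) auto
        thus ?thesis using W0 by (simp add: continuous_within P_def)
      qed
    qed
  qed
  have "((\<lambda>t. F (linepath a b t) * ?Q (linepath a b t) * (b - a)) has_integral
      P (linepath a b 1) - P (linepath a b 0)) {0..1}"
  proof (rule fundamental_theorem_of_calculus_interior[OF _ cont])
    fix t :: real assume "t \<in> {0<..<1}"
    from dP[OF linepath_in_open_segment[OF ab(1) this]]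
    have "(P has_field_derivative F (linepath a b t) * ?Q (linepath a b t)) (at (linepath a b t))" .
    moreover have "(linepath a b has_vector_derivative (b - a)) (at t)"
      using has_vector_derivative_linepath_within .
    ultimately have "((P \<circ> linepath a b) has_vector_derivative (b - a) * (F (linepath a b t) * ?Q (linepath a b t))) (at t)"
      by (intro field_vector_diff_chain_at)
    thus "((\<lambda>t. P (linepath a b t)) has_vector_derivative F (linepath a b t) * ?Q (linepath a b t) * (b - a)) (at t)"
      by (simp add: o_def mult.commute)
  qed simp
  moreover have "P (linepath a b 1) = 0" "P (linepath a b 0) = 0"
    by (simp_all add: P_def W_def linepath_affine)
  ultimately have "((\<lambda>\<zeta>. F \<zeta> * ?Q \<zeta>) has_contour_integral 0) (linepath a b)"
    by (simp add: has_contour_integral_linepath)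
  moreover have "?Q holomorphic_on UNIV"
    using q by (intro holomorphic_intros holomorphic_deriv) auto
  hence "bounded_density (\<lambda>t. F (linepath a b t) * ?Q (linepath a b t))"
    by (intro power_density_bounded[OF power_density_mult[OF PD] \<mu>\<nu>])
  hence "((\<lambda>\<zeta>. F \<zeta> * ?Q \<zeta>) has_contour_integral edge_integral a b (\<lambda>\<zeta>. F \<zeta> * ?Q \<zeta>)) (linepath a b)"
    by (rule has_contour_integral_edge)
  ultimately show ?thesis using has_contour_integral_unique by blast
qed


lemma log_branch_derivative:
  assumes L: "log_branch x a L" and z: "z \<in> - broken_line x"
    and op: "open (- broken_line x)"
  shows "(L has_field_derivative 1 / (z - a)) (at z)"
proof -
  have hol: "L holomorphic_on - broken_line x" and ex: "\<And>z. z \<in> - broken_line x \<Longrightarrow> exp (L z) = z - a"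
    using L by (auto simp: log_branch_def)
  have L': "(L has_field_derivative deriv L z) (at z)"
    by (rule holomorphic_derivI[OF hol op z])
  hence "((\<lambda>z. exp (L z)) has_field_derivative exp (L z) * deriv L z) (at z)"
    by (rule DERIV_fun_exp)
  moreover have "((\<lambda>z. exp (L z)) has_field_derivative 1) (at z)"
  proof (rule has_field_derivative_transform_within_open[OF _ op z])
    show "((\<lambda>z. z - a) has_field_derivative 1) (at z)" by (auto intro!: derivative_eq_intros)
  qed (use ex in auto)
  ultimately have "exp (L z) * deriv L z = 1" by (rule DERIV_unique)
  hence "deriv L z = 1 / (z - a)" using ex[OF z] by (metis exp_not_eq_zero nonzero_eq_divide_eq mult.commute)
  thus ?thesis using L' by simp
qed

lemma closed_of_real_ray: "closed (complex_of_real ` {1..})"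
proof -
  have "complex_of_real ` {1..} = {z. Im z = 0} \<inter> {z. 1 \<le> Re z}"
    by (auto simp: complex_eq_iff image_iff intro!: bexI[of _ "Re _"])
  thus ?thesis by (simp add: closed_Int closed_halfspace_Im_eq closed_halfspace_Re_ge)
qed

lemma closed_short_line: "closed (short_line x)"
  unfolding short_line_def by (intro closed_Un) auto

lemma closed_broken_line: "closed (broken_line x)"
  unfolding broken_line_def by (intro closed_Un closed_short_line closed_of_real_ray)

lemma power_product_derivative:
  assumes "power_product x \<alpha>1 \<alpha>2 \<alpha>3 f" "z \<in> - broken_line x"
  shows "(f has_field_derivative f z * (\<alpha>1 / z + \<alpha>2 / (z - x) + \<alpha>3 / (z - 1))) (at z)"
proof -
  have op: "open (- broken_line x)" using closed_broken_line by auto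
  obtain L1 L2 L3 where L: "log_branch x 0 L1" "log_branch x x L2" "log_branch x 1 L3"
    and f: "\<forall>z\<in>- broken_line x. f z = exp (\<alpha>1 * L1 z) * exp (\<alpha>2 * L2 z) * exp (\<alpha>3 * L3 z)"
    using assms(1) unfolding power_product_def by blast
  note d = L[THEN log_branch_derivative, OF assms(2) op]
  let ?E = "\<lambda>z. exp (\<alpha>1 * L1 z + \<alpha>2 * L2 z + \<alpha>3 * L3 z)"
  have "(?E has_field_derivative ?E z * (\<alpha>1 * (1 / (z - 0)) + \<alpha>2 * (1 / (z - x)) + \<alpha>3 * (1 / (z - 1)))) (at z)"
    by (intro DERIV_fun_exp DERIV_add DERIV_cmult d)
  hence "(f has_field_derivative ?E z * (\<alpha>1 * (1 / (z - 0)) + \<alpha>2 * (1 / (z - x)) + \<alpha>3 * (1 / (z - 1)))) (at z)"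
    by (rule has_field_derivative_transform_within_open[OF _ op assms(2)]) (use f in \<open>auto simp: exp_add\<close>)
  thus ?thesis using f assms(2) by (simp add: exp_add)
qed

lemma side_not_closed_segment:
  assumes "z \<in> left_side a b \<or> z \<in> right_side a b" "a \<noteq> b"
  shows "z \<notin> closed_segment a b"
proof
  assume "z \<in> closed_segment a b"
  hence "(z - a) / (b - a) \<in> unit_segment" by (rule mem_closed_segment_coordinate[OF assms(2), THEN iffD2])
  thus False using assms(1) by (auto simp: left_side_def right_side_def)
qed

lemma open_segment_on_line:
  assumes "z \<in> open_segment a b"
  shows "Im ((z - a) / (b - a)) = 0"
proof -
  have "a \<noteq> b" "z \<in> closed_segment a b" using assms by (auto simp: open_segment_def)
  hence "(z - a) / (b - a) \<in> unit_segment" using mem_closed_segment_coordinate by blast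
  thus ?thesis by auto
qed

lemma convex_left_side: "a \<noteq> b \<Longrightarrow> convex (left_side a b)" "a \<noteq> b \<Longrightarrow> open (left_side a b)"
  by (auto simp: left_side_halfplane convex_halfspace_gt open_halfspace_gt)

lemma convex_right_side: "a \<noteq> b \<Longrightarrow> convex (right_side a b)" "a \<noteq> b \<Longrightarrow> open (right_side a b)"
  by (auto simp: right_side_halfplane convex_halfspace_lt open_halfspace_lt)

text \<open>
  The two one-sided limits are multiples of the same branch, so their product is a multiple of the branch
  with doubled exponents.
\<close>
lemma boundary_value_product:
  assumes ab: "a \<noteq> b" "c \<notin> closed_segment a b"
    and R: "closed R" "open_segment a b \<inter> R = {}"
    and der: "\<And>z. z \<notin> closed_segment a b \<union> R \<Longrightarrow>
      (f has_field_derivative f z * (\<alpha> / (z - a) + \<beta> / (z - b) + \<gamma> / (z - c))) (at z)"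
  shows "\<exists>C. \<forall>z\<in>open_segment a b.
    Lim (at z within left_side a b) f * Lim (at z within right_side a b) f =
      C * edge_branch a b c (2 * \<alpha>) (2 * \<beta>) (2 * \<gamma>) z"
proof -
  note nl = left_side_islimpt[OF ab(1) open_segment_on_line]
  note nr = right_side_islimpt[OF ab(1) open_segment_on_line]
  have "\<exists>C. \<forall>z\<in>open_segment a b. (f \<longlongrightarrow> C * edge_branch a b c \<alpha> \<beta> \<gamma> z) (at z within left_side a b)"
    (is "\<exists>C. ?PCL C")
  proof (rule one_sided_branch_limit[OF ab convex_left_side[OF ab(1)] nl R])
    fix z assume "z \<in> left_side a b - R"
    hence "z \<notin> closed_segment a b \<union> R" using side_not_closed_segment[OF _ ab(1), of z] by blast
    thus "(f has_field_derivative f z * (\<alpha> / (z - a) + \<beta> / (z - b) + \<gamma> / (z - c))) (at z)" by (rule der)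
  qed
  then obtain CL where CL: "?PCL CL" by blast
  have "\<exists>C. \<forall>z\<in>open_segment a b. (f \<longlongrightarrow> C * edge_branch a b c \<alpha> \<beta> \<gamma> z) (at z within right_side a b)"
    (is "\<exists>C. ?PCR C")
  proof (rule one_sided_branch_limit[OF ab convex_right_side[OF ab(1)] nr R])
    fix z assume "z \<in> right_side a b - R"
    hence "z \<notin> closed_segment a b \<union> R" using side_not_closed_segment[OF _ ab(1), of z] by blast
    thus "(f has_field_derivative f z * (\<alpha> / (z - a) + \<beta> / (z - b) + \<gamma> / (z - c))) (at z)" by (rule der)
  qed
  then obtain CR where CR: "?PCR CR" by blast
  show ?thesis
  proof (intro exI[of _ "CL * CR"] ballI)
    fix z assume z: "z \<in> open_segment a b"
    have "Lim (at z within left_side a b) f = CL * edge_branch a b c \<alpha> \<beta> \<gamma> z"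
      by (rule tendsto_Lim[OF nl[OF z] bspec[OF CL z]])
    moreover have "Lim (at z within right_side a b) f = CR * edge_branch a b c \<alpha> \<beta> \<gamma> z"
      by (rule tendsto_Lim[OF nr[OF z] bspec[OF CR z]])
    ultimately show "Lim (at z within left_side a b) f * Lim (at z within right_side a b) f =
        CL * CR * edge_branch a b c (2 * \<alpha>) (2 * \<beta>) (2 * \<gamma>) z"
      by (simp add: edge_branch_square[symmetric] power2_eq_square)
  qed
qed

text \<open>
  A common point of two of the pieces would express \<open>x\<close> as a real number that is at most \<open>0\<close> or at least \<open>1\<close>.
\<close>
lemma edges_disjoint:
  assumes x: "x \<notin> complex_of_real ` ({..0} \<union> {1..})"
  shows "x \<noteq> 0" "x \<noteq> 1" "1 \<notin> closed_segment 0 x" "0 \<notin> closed_segment x 1"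
    "open_segment 0 x \<inter> closed_segment x 1 = {}" "open_segment x 1 \<inter> closed_segment 0 x = {}"
    "closed_segment 0 x \<inter> complex_of_real ` {1..} = {}" "open_segment x 1 \<inter> complex_of_real ` {1..} = {}"
proof -
  have xr: "0 < r \<and> r < 1" if "x = of_real r" for r
    using x that by force
  show x01: "x \<noteq> 0" "x \<noteq> 1" using xr[of 0] xr[of 1] by auto
  have A: False if "of_real s * x = of_real r" "1 \<le> r" "0 \<le> s" "s \<le> 1" for s r :: real
  proof -
    have "s \<noteq> 0" using that by auto
    hence "x = of_real (r / s)" using that(1) by (simp add: field_simps)
    from xr[OF this] have "r < s" using that \<open>s \<noteq> 0\<close> by (simp add: field_simps)
    thus False using that by simp
  qed
  show 1: "closed_segment 0 x \<inter> complex_of_real ` {1..} = {}"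
  proof (rule ccontr)
    assume "closed_segment 0 x \<inter> complex_of_real ` {1..} \<noteq> {}"
    then obtain r s where "1 \<le> r" "0 \<le> s" "s \<le> 1" "complex_of_real s * x = complex_of_real r"
      by (auto simp: closed_segment_def scaleR_conv_of_real) metis
    thus False using A[of s r] by simp
  qed
  have "complex_of_real 1 \<in> complex_of_real ` {1..}" by blast
  thus "1 \<notin> closed_segment 0 x" using 1 by auto
  have B: False if "of_real (1 - t) * x = of_real (r - t)" "t < 1" "r \<le> 0 \<or> 1 \<le> r" "0 \<le> t" for t r :: real
  proof -
    have "1 - complex_of_real t \<noteq> 0" using that(2) by (metis eq_iff_diff_eq_0 less_irrefl of_real_eq_1_iff)
    hence "x = of_real ((r - t) / (1 - t))" using that(1) by (simp add: field_simps)
    from xr[OF this] have "0 < r - t" "r - t < 1 - t" using that by (auto simp: field_simps zero_less_divide_iff)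
    thus False using that by linarith
  qed
  have segx1: "z \<in> closed_segment x 1 \<Longrightarrow> \<exists>t\<in>{0..1}. z = of_real (1 - t) * x + of_real t" for z
    by (auto simp: closed_segment_def scaleR_conv_of_real)
  have osegx1: "z \<in> open_segment x 1 \<Longrightarrow> \<exists>t\<in>{0<..<1}. z = of_real (1 - t) * x + of_real t" for z
    by (auto simp: in_segment scaleR_conv_of_real)
  have seg0x: "z \<in> closed_segment 0 x \<Longrightarrow> \<exists>s\<in>{0..1}. z = of_real s * x" for z
    by (auto simp: closed_segment_def scaleR_conv_of_real)
  have oseg0x: "z \<in> open_segment 0 x \<Longrightarrow> \<exists>s\<in>{0<..<1}. z = of_real s * x" for z
    by (auto simp: in_segment scaleR_conv_of_real)
  show "0 \<notin> closed_segment x 1"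
  proof
    assume "0 \<in> closed_segment x 1"
    then obtain t where t: "t \<in> {0..1}" "0 = of_real (1 - t) * x + of_real t" using segx1 by blast
    hence "t \<noteq> 1" by auto
    moreover have "of_real (1 - t) * x = of_real (0 - t)" using t(2) by (simp add: eq_neg_iff_add_eq_0)
    ultimately show False using B[of t 0] t by auto
  qed
  show "open_segment x 1 \<inter> complex_of_real ` {1..} = {}"
  proof (rule ccontr)
    assume "open_segment x 1 \<inter> complex_of_real ` {1..} \<noteq> {}"
    then obtain r t where "1 \<le> r" "t \<in> {0<..<1}" "complex_of_real r = of_real (1 - t) * x + of_real t"
      using osegx1 by blast
    thus False using B[of t r] by (auto simp: algebra_simps)
  qed
  have C: False if "of_real s * x = of_real (1 - t) * x + of_real t" "0 \<le> s" "s \<le> 1" "0 \<le> t" "t \<le> 1"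
     "s < 1 \<or> 0 < t" "s > 0 \<or> t < 1" for s t :: real
  proof -
    have eq: "of_real (s - 1 + t) * x = of_real t" using that(1) by (simp add: algebra_simps)
    show False
    proof (cases "s - 1 + t = 0")
      case True
      hence "t = 0" using eq by simp
      thus False using True that by simp
    next
      case False
      hence "complex_of_real (s - 1 + t) \<noteq> 0" unfolding of_real_eq_0_iff .
      hence "x = of_real (t / (s - 1 + t))"
        using eq unfolding of_real_divide by (metis nonzero_mult_div_cancel_left)
      from xr[OF this] have "0 < t / (s - 1 + t)" "t / (s - 1 + t) < 1" by auto
      hence "0 < s - 1 + t" "t < s - 1 + t" using that by (auto simp: zero_less_divide_iff field_simps)
      thus False using that by simp
    qed
  qed
  show "open_segment 0 x \<inter> closed_segment x 1 = {}"
  proof (rule ccontr)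
    assume "open_segment 0 x \<inter> closed_segment x 1 \<noteq> {}"
    then obtain s t where "s \<in> {0<..<1}" "t \<in> {0..1}" "complex_of_real s * x = of_real (1 - t) * x + of_real t"
      using oseg0x segx1 by (metis Int_iff ex_in_conv)
    thus False using C[of s t] by auto
  qed
  show "open_segment x 1 \<inter> closed_segment 0 x = {}"
  proof (rule ccontr)
    assume "open_segment x 1 \<inter> closed_segment 0 x \<noteq> {}"
    then obtain s t where "s \<in> {0..1}" "t \<in> {0<..<1}" "complex_of_real s * x = of_real (1 - t) * x + of_real t"
      using osegx1 seg0x by (metis Int_iff ex_in_conv)
    thus False using C[of s t] by auto
  qed
qed

lemma weight_on_edges:
  assumes x: "x \<notin> complex_of_real ` ({..0} \<union> {1..})"
    and f: "power_product x \<alpha>1 \<alpha>2 \<alpha>3 f"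
  obtains C1 C2 where
    "\<And>z. z \<in> open_segment 0 x \<Longrightarrow>
       weight x \<delta> s1 s3 f z = C1 * edge_branch 0 x 1 (2 * \<alpha>1) (2 * \<alpha>2) (2 * \<alpha>3) z"
    "\<And>z. z \<in> open_segment x 1 \<Longrightarrow>
       weight x \<delta> s1 s3 f z = C2 * edge_branch x 1 0 (2 * \<alpha>2) (2 * \<alpha>3) (2 * \<alpha>1) z"
proof -
  note edges = edges_disjoint[OF x]
  have der: "(f has_field_derivative f z * (\<alpha>1 / z + \<alpha>2 / (z - x) + \<alpha>3 / (z - 1))) (at z)"
    if "z \<notin> broken_line x" for z
    using that by (intro power_product_derivative[OF f]) auto
  have "\<exists>C1. \<forall>z\<in>open_segment 0 x.
    Lim (at z within left_side 0 x) f * Lim (at z within right_side 0 x) f =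
      C1 * edge_branch 0 x 1 (2 * \<alpha>1) (2 * \<alpha>2) (2 * \<alpha>3) z" (is "\<exists>C. ?PC1 C")
  proof (rule boundary_value_product[of 0 x 1 "closed_segment x 1 \<union> complex_of_real ` {1..}" f \<alpha>1 \<alpha>2 \<alpha>3])
    show "open_segment 0 x \<inter> (closed_segment x 1 \<union> complex_of_real ` {1..}) = {}"
      using edges(5,7) unfolding open_segment_def by blast
    show "(f has_field_derivative f z * (\<alpha>1 / (z - 0) + \<alpha>2 / (z - x) + \<alpha>3 / (z - 1))) (at z)"
      if "z \<notin> closed_segment 0 x \<union> (closed_segment x 1 \<union> complex_of_real ` {1..})" for z
      using der[of z] that by (simp add: broken_line_def short_line_def)
  qed (use edges closed_of_real_ray in auto)
  then obtain C1 where C1: "?PC1 C1" by blast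
  have "\<exists>C2. \<forall>z\<in>open_segment x 1.
    Lim (at z within left_side x 1) f * Lim (at z within right_side x 1) f =
      C2 * edge_branch x 1 0 (2 * \<alpha>2) (2 * \<alpha>3) (2 * \<alpha>1) z" (is "\<exists>C. ?PC2 C")
  proof (rule boundary_value_product[of x 1 0 "closed_segment 0 x \<union> complex_of_real ` {1..}" f \<alpha>2 \<alpha>3 \<alpha>1])
    show "open_segment x 1 \<inter> (closed_segment 0 x \<union> complex_of_real ` {1..}) = {}"
      using edges(6,8) by blast
    show "(f has_field_derivative f z * (\<alpha>2 / (z - x) + \<alpha>3 / (z - 1) + \<alpha>1 / (z - 0))) (at z)"
      if "z \<notin> closed_segment x 1 \<union> (closed_segment 0 x \<union> complex_of_real ` {1..})" for z
      using der[of z] that by (simp add: broken_line_def short_line_def add_ac)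
  qed (use edges closed_of_real_ray in auto)
  then obtain C2 where C2: "?PC2 C2" by blast
  show ?thesis
  proof (rule that[of "s1 * C1" "- s3 * exp (2 * pi * \<i> * \<delta>) * C2"])
    show "weight x \<delta> s1 s3 f z = s1 * C1 * edge_branch 0 x 1 (2 * \<alpha>1) (2 * \<alpha>2) (2 * \<alpha>3) z"
      if "z \<in> open_segment 0 x" for z
      using that bspec[OF C1 that] by (simp add: weight_def mult.assoc)
    show "weight x \<delta> s1 s3 f z = - s3 * exp (2 * pi * \<i> * \<delta>) * C2 * edge_branch x 1 0 (2 * \<alpha>2) (2 * \<alpha>3) (2 * \<alpha>1) z"
      if z: "z \<in> open_segment x 1" for z
    proof -
      have "z \<notin> open_segment 0 x" using z edges(6) by (auto simp: open_segment_def)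
      thus ?thesis using z bspec[OF C2 z] by (simp add: weight_def mult.assoc)
    qed
  qed
qed

section \<open>Orthogonal polynomials and the Heun operator\<close>
lemma hankel_kernel:
  fixes h :: "nat \<Rightarrow> complex"
  shows "Determinant.det (Matrix.mat m m (\<lambda>(i, j). h (i + j))) = 0 \<longleftrightarrow>
    (\<exists>c. (\<exists>j<m. c j \<noteq> 0) \<and> (\<forall>i<m. (\<Sum>j<m. c j * h (i + j)) = 0))" (is "Determinant.det ?A = 0 \<longleftrightarrow> ?R")
proof -
  have A: "?A \<in> carrier_mat m m" by simp
  have row: "vec_index (?A *\<^sub>v v) i = (\<Sum>j<m. vec_index v j * h (i + j))"
    if "v \<in> carrier_vec m" "i < m" for v i
    using that by (auto simp: scalar_prod_def atLeast0LessThan mult.commute intro!: sum.cong)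
  show ?thesis unfolding det_0_iff_vec_prod_zero_field[OF A]
  proof
    assume "\<exists>v. v \<in> carrier_vec m \<and> v \<noteq> 0\<^sub>v m \<and> ?A *\<^sub>v v = 0\<^sub>v m"
    then obtain v where v: "v \<in> carrier_vec m" "v \<noteq> 0\<^sub>v m" "?A *\<^sub>v v = 0\<^sub>v m" by blast
    have "\<exists>j<m. vec_index v j \<noteq> 0"
      using v(1,2) by (metis carrier_vecD eq_vecI index_zero_vec)
    moreover have "\<forall>i<m. (\<Sum>j<m. vec_index v j * h (i + j)) = 0"
      using row[OF v(1)] v(3) by (metis index_zero_vec(1))
    ultimately show ?R by blast
  next
    assume ?R
    then obtain c where c: "\<exists>j<m. c j \<noteq> 0" "\<forall>i<m. (\<Sum>j<m. c j * h (i + j)) = 0" by blast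
    let ?v = "Matrix.vec m c"
    have "?v \<noteq> 0\<^sub>v m" using c(1) by (metis index_vec index_zero_vec(1))
    moreover have "?A *\<^sub>v ?v = 0\<^sub>v m"
    proof (rule eq_vecI)
      fix i assume i: "i < dim_vec (0\<^sub>v m :: complex Matrix.vec)"
      hence "vec_index (?A *\<^sub>v ?v) i = (\<Sum>j<m. vec_index ?v j * h (i + j))" by (intro row) auto
      also have "\<dots> = (\<Sum>j<m. c j * h (i + j))" by (intro sum.cong) auto
      finally show "vec_index (?A *\<^sub>v ?v) i = vec_index (0\<^sub>v m) i" using c(2) i by simp
    qed simp
    ultimately show "\<exists>v. v \<in> carrier_vec m \<and> v \<noteq> 0\<^sub>v m \<and> ?A *\<^sub>v v = 0\<^sub>v m"
      by (intro exI[of _ ?v]) simp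
  qed
qed

text \<open>
  The coefficients are a column of the adjugate matrix divided by the determinant.
\<close>
lemma hankel_solve:
  fixes h :: "nat \<Rightarrow> complex"
  assumes "Determinant.det (Matrix.mat m m (\<lambda>(i, j). h (i + j))) \<noteq> 0" "k < m"
  shows "\<exists>c. \<forall>i<m. (\<Sum>j<m. c j * h (i + j)) = (if i = k then 1 else 0)"
proof -
  let ?A = "Matrix.mat m m (\<lambda>(i, j). h (i + j))"
  have A: "?A \<in> carrier_mat m m" by simp
  note adj = adj_mat[OF A]
  have "(\<Sum>j<m. (adj_mat ?A $$ (j, k) / Determinant.det ?A) * h (i + j)) = (if i = k then 1 else 0)" if i: "i < m" for i
  proof -
    have "(\<Sum>j<m. h (i + j) * adj_mat ?A $$ (j, k)) = (?A * adj_mat ?A) $$ (i, k)"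
      using i assms(2) adj(1) by (auto simp: scalar_prod_def atLeast0LessThan intro!: sum.cong)
    also have "\<dots> = Determinant.det ?A * (if i = k then 1 else 0)"
      unfolding adj(2) using i assms(2) by simp
    finally have "(\<Sum>j<m. h (i + j) * adj_mat ?A $$ (j, k)) / Determinant.det ?A = (if i = k then 1 else 0)"
      using assms(1) by simp
    thus ?thesis by (simp add: sum_divide_distrib mult.commute)
  qed
  thus ?thesis by (intro exI[of _ "\<lambda>j. adj_mat ?A $$ (j, k) / Determinant.det ?A"]) blast
qed

lemma edge_integral_add:
  assumes "bounded_density (\<lambda>t. F (linepath a b t))" "bounded_density (\<lambda>t. G (linepath a b t))"
  shows "edge_integral a b (\<lambda>\<zeta>. F \<zeta> + G \<zeta>) = edge_integral a b F + edge_integral a b G"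
  unfolding edge_integral_def
  using assms[THEN bounded_density_integrable] by (simp add: distrib_right)

lemma edge_integral_cmult: "edge_integral a b (\<lambda>\<zeta>. c * F \<zeta>) = c * edge_integral a b F"
  unfolding edge_integral_def by simp

lemma eq_times_two_pi_i:
  assumes "- (1 / (2 * pi * \<i>)) * X = (Y :: complex)"
  shows "X = - 2 * pi * \<i> * Y"
proof -
  have "X = - 2 * pi * \<i> * (- (1 / (2 * pi * \<i>)) * X)" by simp
  thus ?thesis unfolding assms .
qed

text \<open>
  The constants on the two edges are free: the integration by parts and the boundedness at the common endpoint
  \<open>x\<close> hold for each edge separately.
\<close>
locale edge_weight =
  fixes x \<mu>1 \<mu>2 \<mu>3 C1 C2 :: complex and g :: "complex \<Rightarrow> complex"
  assumes x: "x \<notin> complex_of_real ` ({..0} \<union> {1..})"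
    and g_first: "\<And>z. z \<in> open_segment 0 x \<Longrightarrow> g z = C1 * edge_branch 0 x 1 \<mu>1 \<mu>2 \<mu>3 z"
    and g_second: "\<And>z. z \<in> open_segment x 1 \<Longrightarrow> g z = C2 * edge_branch x 1 0 \<mu>2 \<mu>3 \<mu>1 z"
    and Re_nonneg: "0 \<le> Re \<mu>1" "0 \<le> Re \<mu>2" "0 \<le> Re \<mu>3"
    and nonint: "\<mu>1 \<notin> \<int>" "\<mu>2 \<notin> \<int>" "\<mu>3 \<notin> \<int>"
begin

lemmas edges = edges_disjoint[OF x]

abbreviation weighted :: "complex poly \<Rightarrow> complex \<Rightarrow> complex" where
  "weighted r \<equiv> \<lambda>\<zeta>. g \<zeta> * poly r \<zeta>"

definition functional :: "complex poly \<Rightarrow> complex" where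
  "functional r = edge_integral 0 x (weighted r) + edge_integral x 1 (weighted r)"

lemma poly_holomorphic: "poly r holomorphic_on (A :: complex set)"
  by (intro holomorphic_intros)

lemma density_first: "power_density 0 x \<mu>1 \<mu>2 (weighted r)"
  using edges by (intro power_density_mult edge_branch_power_density[OF _ _ g_first] poly_holomorphic) auto

lemma density_second: "power_density x 1 \<mu>2 \<mu>3 (weighted r)"
  using edges by (intro power_density_mult edge_branch_power_density[OF _ _ g_second] poly_holomorphic) auto

lemma bounded_first: "bounded_density (\<lambda>t. g (linepath 0 x t) * poly r (linepath 0 x t))"
  by (rule power_density_bounded[OF density_first Re_nonneg(1,2)])

lemma bounded_second: "bounded_density (\<lambda>t. g (linepath x 1 t) * poly r (linepath x 1 t))"
  by (rule power_density_bounded[OF density_second Re_nonneg(2,3)])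

lemma functional_add: "functional (p + q) = functional p + functional q"
  unfolding functional_def poly_add distrib_left
  by (simp add: edge_integral_add[OF bounded_first bounded_first] edge_integral_add[OF bounded_second bounded_second])

lemma functional_smult: "functional (Polynomial.smult c p) = c * functional p"
  unfolding functional_def poly_smult mult.left_commute[of _ c]
  by (simp add: edge_integral_cmult distrib_left)

lemma functional_0 [simp]: "functional 0 = 0"
  using functional_smult[of 0 0] by simp

lemma functional_diff: "functional (p - q) = functional p - functional q"
  using functional_add[of "p - q" q] by simp

lemma functional_sum: "functional (\<Sum>i\<in>A. p i) = (\<Sum>i\<in>A. functional (p i))"
  by (induction A rule: infinite_finite_induct) (auto simp: functional_add)

lemma functional_mult_expand:
  assumes "degree r < m"
  shows "functional (s * r) = (\<Sum>j<m. coeff r j * functional (s * monom 1 j))"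
proof -
  have "r = (\<Sum>j<m. Polynomial.smult (coeff r j) (monom 1 j))"
    using assms by (intro poly_eqI) (auto simp: coeff_sum smult_monom intro!: coeff_eq_0)
  hence "s * r = (\<Sum>j<m. Polynomial.smult (coeff r j) (s * monom 1 j))"
    by (metis (no_types, lifting) mult_smult_right sum.cong sum_distrib_left)
  thus ?thesis by (simp add: functional_sum functional_smult)
qed

lemma moment_eq: "moment x g (k + 1) = - (1 / (2 * pi * \<i>)) * functional (monom 1 k)"
proof -
  have "(weighted (monom 1 k) has_contour_integral functional (monom 1 k)) (linepath 0 x +++ linepath x 1)"
    unfolding functional_def
    by (intro has_contour_integral_join has_contour_integral_edge bounded_first bounded_second) auto
  thus ?thesis by (simp add: moment_def poly_monom contour_integral_unique)
qed

lemma hankel_eq: "hankel x g m =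
    Determinant.det (Matrix.mat m m (\<lambda>(i, j). - (1 / (2 * pi * \<i>)) * functional (monom 1 (i + j))))"
  unfolding hankel_def using moment_eq by (simp add: add.assoc)

text \<open>
  The coefficient vector of an orthogonal polynomial is a null vector of the Hankel matrix.
\<close>
lemma hankel_orthogonal_zero:
  assumes "hankel x g m \<noteq> 0" "r = 0 \<or> degree r < m" "\<And>i. i < m \<Longrightarrow> functional (monom 1 i * r) = 0"
  shows "r = 0"
proof (rule ccontr)
  assume r: "r \<noteq> 0"
  hence deg: "degree r < m" using assms(2) by simp
  have "(\<Sum>j<m. coeff r j * (- (1 / (2 * pi * \<i>)) * functional (monom 1 (i + j)))) = 0" if "i < m" for i
  proof -
    have "(\<Sum>j<m. coeff r j * functional (monom 1 (i + j))) = 0"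
      using functional_mult_expand[OF deg, of "monom 1 i"] assms(3)[OF that] by (simp add: mult_monom)
    hence "- (1 / (2 * pi * \<i>)) * (\<Sum>j<m. coeff r j * functional (monom 1 (i + j))) = 0" by simp
    thus ?thesis by (simp add: sum_distrib_left sum_negf mult_ac)
  qed
  moreover have "coeff r (degree r) \<noteq> 0" using r by simp
  ultimately have "hankel x g m = 0"
    unfolding hankel_eq hankel_kernel[of m "\<lambda>k. - (1 / (2 * pi * \<i>)) * functional (monom 1 k)"]
    using deg by (intro exI[of _ "coeff r"]) auto
  thus False using assms(1) by simp
qed

lemma coeff_sum_monom: "coeff (\<Sum>j<m. monom (c j) j) k = (if k < m then c k else 0)"
  by (simp add: coeff_sum)

lemma degree_sum_monom: "m > 0 \<Longrightarrow> degree (\<Sum>j<m. monom (c j) j) < m"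
  by (intro le_less_trans[OF degree_le[of "m - 1"]]) (auto simp: coeff_sum_monom)

lemma functional_sum_monom:
  assumes "m > 0"
  shows "functional (monom 1 i * (\<Sum>j<m. monom (c j) j)) = (\<Sum>j<m. c j * functional (monom 1 (i + j)))"
  using functional_mult_expand[OF degree_sum_monom[OF assms], of "monom 1 i" c]
  by (simp add: coeff_sum_monom mult_monom)

text \<open>
  The null vector of the larger Hankel matrix cannot have a vanishing last entry: it would then give
  a null vector of the smaller one.
\<close>
lemma orthogonal_polynomial_exists:
  assumes "hankel x g n \<noteq> 0" "hankel x g (n + 1) = 0"
  obtains p where "degree p = n" "lead_coeff p = 1" "\<And>s. degree s \<le> n \<Longrightarrow> functional (s * p) = 0"
proof -
  let ?h = "\<lambda>k. - (1 / (2 * pi * \<i>)) * functional (monom 1 k)"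
  obtain c where c: "\<exists>j<n+1. c j \<noteq> 0" "\<forall>i<n+1. (\<Sum>j<n+1. c j * ?h (i + j)) = 0"
    using assms(2) unfolding hankel_eq hankel_kernel[of "n+1" ?h] by blast
  define r where "r = (\<Sum>j<n+1. monom (c j) j)"
  have coeffr: "coeff r k = (if k < n + 1 then c k else 0)" for k
    unfolding r_def by (rule coeff_sum_monom)
  have r0: "r \<noteq> 0" using c(1) coeffr by (metis coeff_0)
  have deg: "degree r < n + 1" unfolding r_def by (rule degree_sum_monom) simp
  have orth: "functional (monom 1 i * r) = 0" if "i < n + 1" for i
  proof -
    have "- (1 / (2 * pi * \<i>)) * functional (monom 1 i * r) = (\<Sum>j<n+1. c j * ?h (i + j))"
      unfolding r_def by (subst functional_sum_monom) (simp_all add: sum_distrib_left sum_negf mult_ac del: sum.lessThan_Suc)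
    thus ?thesis using c(2) that by simp
  qed
  have degr: "degree r = n"
  proof (rule ccontr)
    assume "degree r \<noteq> n"
    hence "r = 0 \<or> degree r < n" using deg by simp
    hence "r = 0" using assms(1) orth by (intro hankel_orthogonal_zero[of n r]) auto
    thus False using r0 by simp
  qed
  define p where "p = Polynomial.smult (1 / lead_coeff r) r"
  have 1: "degree p = n" "lead_coeff p = 1" using r0 degr by (auto simp: p_def)
  have "functional (s * p) = 0" if "degree s \<le> n" for s
  proof -
    have "functional (p * s) = (\<Sum>j<n+1. coeff s j * functional (p * monom 1 j))"
      using that by (intro functional_mult_expand) simp
    also have "\<dots> = 0"
      using orth by (intro sum.neutral) (auto simp: p_def mult.commute[of r] functional_smult)
    finally show ?thesis by (simp add: mult.commute)
  qed
  thus ?thesis using that 1 by blast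
qed

lemma second_row_exists:
  assumes "hankel x g n \<noteq> 0" "n \<ge> 1"
  obtains q where "degree q < n" "\<And>i. i < n - 1 \<Longrightarrow> functional (monom 1 i * q) = 0"
    "functional (monom 1 (n - 1) * q) = - 2 * pi * \<i>"
proof -
  let ?h = "\<lambda>k. - (1 / (2 * pi * \<i>)) * functional (monom 1 k)"
  have "\<exists>c. \<forall>i<n. (\<Sum>j<n. c j * ?h (i + j)) = (if i = n - 1 then 1 else 0)"
    using assms by (intro hankel_solve) (auto simp: hankel_eq)
  then obtain c where c: "\<forall>i<n. (\<Sum>j<n. c j * ?h (i + j)) = (if i = n - 1 then 1 else 0)" by blast
  define q where "q = (\<Sum>j<n. monom (c j) j)"
  have f: "functional (monom 1 i * q) = - 2 * pi * \<i> * (if i = n - 1 then 1 else 0)" if "i < n" for i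
  proof -
    have "- (1 / (2 * pi * \<i>)) * functional (monom 1 i * q) = (\<Sum>j<n. c j * ?h (i + j))"
      unfolding q_def using assms(2) by (subst functional_sum_monom) (simp_all add: sum_distrib_left sum_negf mult_ac)
    also have "\<dots> = (if i = n - 1 then 1 else 0)" using c that by blast
    finally have "- (1 / (2 * pi * \<i>)) * functional (monom 1 i * q) = (if i = n - 1 then 1 else 0)" .
    thus ?thesis by (rule eq_times_two_pi_i)
  qed
  show ?thesis
  proof (rule that[of q])
    show "degree q < n" unfolding q_def using assms(2) by (intro degree_sum_monom) simp
    show "functional (monom 1 i * q) = 0" if "i < n - 1" for i using f[of i] that by simp
    show "functional (monom 1 (n - 1) * q) = - 2 * pi * \<i>" using f[of "n - 1"] assms(2) by simp
  qed
qed

definition W :: "complex poly" where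
  "W = [:0, 1:] * [:- x, 1:] * [:- 1, 1:]"

text \<open>
  The polynomial \<open>(W g)' / g\<close>.
\<close>
definition V :: "complex poly" where
  "V = Polynomial.smult (1 + \<mu>1) ([:- x, 1:] * [:- 1, 1:]) + Polynomial.smult (1 + \<mu>2) ([:0, 1:] * [:- 1, 1:])
     + Polynomial.smult (1 + \<mu>3) ([:0, 1:] * [:- x, 1:])"

definition heun_operator :: "complex poly \<Rightarrow> complex poly" where
  "heun_operator p = W * pderiv (pderiv p) + V * pderiv p"

lemma deriv_poly_eq: "deriv (poly q) = poly (pderiv q :: complex poly)"
  by (rule ext) (rule DERIV_imp_deriv[OF poly_DERIV])

lemma pearson: "functional (W * pderiv q + V * q) = 0"
proof -
  have "edge_integral 0 x (weighted (W * pderiv q + V * q)) = 0"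
    using edge_pearson[OF _ edges(3) g_first Re_nonneg(1,2) poly_holomorphic, of q] edges(1)
    by (simp add: W_def V_def deriv_poly_eq algebra_simps)
  moreover have "edge_integral x 1 (weighted (W * pderiv q + V * q)) = 0"
    using edge_pearson[OF _ edges(4) g_second Re_nonneg(2,3) poly_holomorphic, of q] edges(2)
    by (simp add: W_def V_def deriv_poly_eq algebra_simps)
  ultimately show ?thesis by (simp add: functional_def)
qed

text \<open>
  The commutator \<open>s L p - p L s\<close> is \<open>W u' + V u\<close> for the Wronskian \<open>u = p' s - p s'\<close>.
\<close>
lemma heun_operator_symmetric: "functional (s * heun_operator p) = functional (heun_operator s * p)"
proof -
  let ?u = "pderiv p * s - p * pderiv s"
  have "s * heun_operator p - heun_operator s * p = W * pderiv ?u + V * ?u"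
    by (simp add: heun_operator_def pderiv_mult pderiv_diff algebra_simps)
  hence "functional (s * heun_operator p - heun_operator s * p) = 0" using pearson[of ?u] by simp
  thus ?thesis by (simp add: functional_diff)
qed

lemma W_eq: "W = [:0, x, - (1 + x), 1:]"
  by (simp add: W_def)

lemma V_eq: "\<exists>v0 v1. V = [:v0, v1, 3 + (\<mu>1 + \<mu>2 + \<mu>3):]"
  by (intro exI[of _ "(1 + \<mu>1) * x"] exI[of _ "- ((1 + \<mu>1) * (1 + x) + (1 + \<mu>2) + (1 + \<mu>3) * x)"])
    (simp add: V_def algebra_simps)

lemma coeff_heun_operator_top:
  assumes "degree p \<le> Suc m"
  shows "coeff (heun_operator p) (Suc (Suc m)) =
    of_nat (Suc m) * (of_nat m + 3 + (\<mu>1 + \<mu>2 + \<mu>3)) * coeff p (Suc m)"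
proof -
  obtain v0 v1 where V: "V = [:v0, v1, 3 + (\<mu>1 + \<mu>2 + \<mu>3):]" using V_eq by blast
  have z: "coeff p k = 0" if "k > Suc m" for k using assms that by (intro coeff_eq_0) simp
  show ?thesis
    by (cases m) (simp_all add: heun_operator_def W_eq V coeff_pCons coeff_pderiv z algebra_simps)
qed

lemma degree_heun_operator: "degree (heun_operator p) \<le> degree p + 1"
proof (rule degree_le, intro allI impI)
  fix k assume k: "degree p + 1 < k"
  then obtain j where j: "k = Suc (Suc j)" "degree p < Suc j" by (cases k; cases "k - 1") auto
  have "coeff (heun_operator p) (Suc (Suc j)) = 0"
    using j by (subst coeff_heun_operator_top) (auto simp: coeff_eq_0)
  thus "coeff (heun_operator p) k = 0" using j by simp
qed

text \<open>
  Orthogonality up to degree \<open>n\<close>, one more than an orthogonal polynomial has in general, enters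
  twice: \<open>L\<close> maps degree \<open>n - 1\<close> to degree \<open>n\<close>, and so does multiplication by \<open>a \<zeta> + b\<close>.
\<close>
theorem orthogonal_polynomial_heun:
  assumes n: "n \<ge> 1" and nz: "hankel x g n \<noteq> 0"
    and p: "degree p = n" "lead_coeff p = 1" and orth: "\<And>s. degree s \<le> n \<Longrightarrow> functional (s * p) = 0"
  obtains b where "heun_operator p = [:b, of_nat n * (of_nat n + 2 + (\<mu>1 + \<mu>2 + \<mu>3)):] * p"
proof -
  define a where "a = of_nat n * (of_nat n + 2 + (\<mu>1 + \<mu>2 + \<mu>3))"
  obtain m where m: "n = Suc m" using n by (cases n) auto
  \<comment> \<open>The factor \<open>a\<close> removes the coefficient of degree \<open>n + 1\<close> of the difference below, and \<open>b\<close> that of degree \<open>n\<close>.\<close>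
  define b where "b = coeff (heun_operator p) n - a * coeff p m"
  define r where "r = heun_operator p - [:b, a:] * p"
  have cp: "coeff p (Suc m) = 1" using p m by simp
  have top: "coeff (heun_operator p) (Suc (Suc m)) = a"
    using p m cp by (subst coeff_heun_operator_top) (simp_all add: a_def algebra_simps)
  have "coeff r k = 0" if k: "k \<ge> n" for k
  proof -
    consider "k = Suc m" | "k = Suc (Suc m)" | "k > Suc (Suc m)" using k m by linarith
    thus ?thesis
    proof cases
      case 1
      thus ?thesis using m cp by (simp add: r_def b_def coeff_pCons)
    next
      case 2
      thus ?thesis using m cp p top by (simp add: r_def coeff_pCons coeff_eq_0)
    next
      case 3
      then obtain j where "k = Suc j" "j > Suc m" by (cases k) auto
      thus ?thesis using m p degree_heun_operator[of p]
        by (simp add: r_def coeff_pCons coeff_eq_0)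
    qed
  qed
  hence "degree r \<le> n - 1" using n by (intro degree_le) auto
  hence deg: "degree r < n" using n by simp
  have "functional (monom 1 i * r) = 0" if "i < n" for i
  proof -
    have "functional (monom 1 i * heun_operator p) = functional (heun_operator (monom 1 i) * p)"
      by (rule heun_operator_symmetric)
    also have "\<dots> = 0"
      using that degree_heun_operator[of "monom 1 i"] by (intro orth) (simp add: degree_monom_eq)
    finally have "functional (monom 1 i * heun_operator p) = 0" .
    moreover have "degree (monom 1 i * [:b, a:]) \<le> n"
      using degree_mult_le[of "monom 1 i" "[:b, a:]"] that
      by (simp add: degree_monom_eq split: if_splits)
    hence "functional (monom 1 i * [:b, a:] * p) = 0" by (rule orth)
    ultimately show ?thesis by (simp only: r_def right_diff_distrib functional_diff mult.assoc[symmetric]) simp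
  qed
  hence "r = 0" using nz deg by (intro hankel_orthogonal_zero[of n r]) auto
  thus ?thesis using that[of b] by (simp add: r_def a_def)
qed

end

section \<open>Uniqueness for the Riemann--Hilbert problem\<close>
lemma mat2_nth [simp]:
  "mat2 a b c d $ 1 $ 1 = a" "mat2 a b c d $ 1 $ 2 = b" "mat2 a b c d $ 2 $ 1 = c" "mat2 a b c d $ 2 $ 2 = d"
  by (simp_all add: mat2_def vector_def)

lemma tendsto_matrix2:
  fixes \<Phi> :: "'a \<Rightarrow> complex^2^2"
  assumes "((\<lambda>z. \<Phi> z $ 1 $ 1) \<longlongrightarrow> A $ 1 $ 1) F" "((\<lambda>z. \<Phi> z $ 1 $ 2) \<longlongrightarrow> A $ 1 $ 2) F"
    "((\<lambda>z. \<Phi> z $ 2 $ 1) \<longlongrightarrow> A $ 2 $ 1) F" "((\<lambda>z. \<Phi> z $ 2 $ 2) \<longlongrightarrow> A $ 2 $ 2) F"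
  shows "(\<Phi> \<longlongrightarrow> A) F"
proof (rule vec_tendstoI)
  fix i :: 2
  show "((\<lambda>z. \<Phi> z $ i) \<longlongrightarrow> A $ i) F"
  proof (rule vec_tendstoI)
    fix j :: 2
    show "((\<lambda>z. \<Phi> z $ i $ j) \<longlongrightarrow> A $ i $ j) F"
      using exhaust_2[of i] exhaust_2[of j] assms by auto
  qed
qed

lemma matrix2_eqI:
  fixes A B :: "complex^2^2"
  assumes "A $ 1 $ 1 = B $ 1 $ 1" "A $ 1 $ 2 = B $ 1 $ 2" "A $ 2 $ 1 = B $ 2 $ 1" "A $ 2 $ 2 = B $ 2 $ 2"
  shows "A = B"
  using assms by (simp add: Finite_Cartesian_Product.vec_eq_iff forall_2)

lemma matrix2_mult_nth:
  fixes A B :: "complex^2^2"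
  shows "(A ** B) $ i $ j = A $ i $ 1 * B $ 1 $ j + A $ i $ 2 * B $ 2 $ j"
  by (simp add: matrix_matrix_mult_def sum_2)

lemma norm_matrix2_le:
  fixes A :: "complex^2^2"
  shows "norm A \<le> norm (A $ 1 $ 1) + norm (A $ 1 $ 2) + (norm (A $ 2 $ 1) + norm (A $ 2 $ 2))"
proof -
  have v: "norm v \<le> norm (v $ 1) + norm (v $ 2)" for v :: "'a::real_normed_vector^2"
    unfolding norm_vec_def using L2_set_le_sum[of UNIV "\<lambda>i. norm (v $ i)"] by (simp add: sum_2)
  show ?thesis using v[of A] v[of "A $ 1"] v[of "A $ 2"] by linarith
qed

lemma norm_matrix_entry_le:
  fixes A :: "complex^2^2"
  shows "norm (A $ i $ j) \<le> norm A"
  by (meson Finite_Cartesian_Product.norm_nth_le order_trans)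

text \<open>
  Away from the three endpoints the function extends by its limits, locally across one edge at a
  time; the endpoints are then removable singularities.
\<close>
lemma short_line_entire:
  assumes x: "x \<notin> complex_of_real ` ({..0} \<union> {1..})"
    and hol: "h holomorphic_on - short_line x"
    and jump: "\<And>a b z. (a, b) \<in> {(0, x), (x, 1)} \<Longrightarrow> z \<in> open_segment a b \<Longrightarrow>
      \<exists>l. (h \<longlongrightarrow> l) (at z within left_side a b) \<and> (h \<longlongrightarrow> l) (at z within right_side a b)"
    and bdd: "\<And>a. a \<in> {0, x, 1} \<Longrightarrow> Bfun h (at a within - short_line x)"
  obtains F where "F holomorphic_on UNIV" "\<And>z. z \<notin> short_line x \<Longrightarrow> F z = h z"
proof -
  note edges = edges_disjoint[OF x]
  let ?P = "- short_line x"
  have openP: "open ?P" using closed_short_line by auto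
  define F where "F z = (if z \<in> ?P then h z else Lim (at z within ?P) h)" for z
  have loc: "\<exists>S G. open S \<and> z0 \<in> S \<and> G holomorphic_on S \<and> (\<forall>z\<in>S. z \<in> ?P \<longrightarrow> G z = h z) \<and>
      (\<forall>z\<in>S. at z within ?P \<noteq> bot)" if z0: "z0 \<notin> {0, x, 1}" for z0
  proof (cases "z0 \<in> ?P")
    case True
    show ?thesis
    proof (intro exI[of _ ?P] exI[of _ h] conjI ballI)
      fix z assume "z \<in> ?P"
      thus "at z within ?P \<noteq> bot" by (subst at_within_open[OF _ openP]) auto
    qed (use True openP hol in auto)
  next
    case False
    have edge: ?thesis if ab: "(a, b) \<in> {(0, x), (x, 1)}" "a \<noteq> b" and z0: "z0 \<in> open_segment a b"
      and R: "closed R" "z0 \<notin> R" "short_line x = closed_segment a b \<union> R" for a b R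
    proof -
      have "open (- (R \<union> {a, b}))" using R(1) by (intro open_Compl closed_Un) auto
      moreover have "z0 \<in> - (R \<union> {a, b})" using R(2) z0 by (auto simp: open_segment_def)
      ultimately obtain r0 where r0: "r0 > 0" "ball z0 r0 \<subseteq> - (R \<union> {a, b})" by (rule openE)
      \<comment> \<open>A neighbourhood of the open edge in which the line through it meets only the edge itself.\<close>
      define D where "D = - \<real>\<^sub>\<le>\<^sub>0 \<inter> (\<lambda>w. 1 - w) -` (- \<real>\<^sub>\<le>\<^sub>0 :: complex set)"
      have "open ((\<lambda>z. (z - a) / (b - a)) -` D)"
        unfolding D_def using ab(2)
        by (intro open_vimage open_Int) (auto intro!: continuous_intros simp: open_Compl)
      moreover obtain t where t: "t \<in> {0<..<1}" "z0 = linepath a b t" using z0 by (rule open_segmentE)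
      have "z0 \<in> (\<lambda>z. (z - a) / (b - a)) -` D"
        using t ab(2) by (auto simp: D_def affine_coordinate complex_nonpos_Reals_iff)
      ultimately obtain r1 where r1: "r1 > 0" "ball z0 r1 \<subseteq> (\<lambda>z. (z - a) / (b - a)) -` D" by (rule openE)
      define S where "S = ball z0 (min r0 r1)"
      have seg: "z \<in> open_segment a b" if "z \<in> S" "Im ((z - a) / (b - a)) = 0" for z
      proof -
        define s where "s = Re ((z - a) / (b - a))"
        have eq: "(z - a) / (b - a) = of_real s" using that(2) by (simp add: s_def complex_eq_iff)
        have "(z - a) / (b - a) \<in> D" using that(1) r1(2) by (auto simp: S_def)
        hence "s \<in> {0<..<1}" unfolding eq D_def by (auto simp: complex_nonpos_Reals_iff)
        moreover have "z = linepath a b s" using eq ab(2) by (simp add: linepath_affine field_simps)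
        ultimately show ?thesis using ab(2) linepath_in_open_segment by blast
      qed
      have off: "z \<in> ?P \<longleftrightarrow> Im ((z - a) / (b - a)) \<noteq> 0" if "z \<in> S" for z
      proof
        assume "z \<in> ?P"
        hence "z \<notin> open_segment a b" using R(3) by (auto simp: open_segment_def)
        thus "Im ((z - a) / (b - a)) \<noteq> 0" using seg[OF that] by blast
      next
        assume "Im ((z - a) / (b - a)) \<noteq> 0"
        hence "z \<in> left_side a b \<or> z \<in> right_side a b"
          unfolding left_side_def right_side_def mem_Collect_eq by linarith
        hence "z \<notin> closed_segment a b" using ab(2) by (rule side_not_closed_segment)
        moreover have "z \<notin> R" using that r0(2) by (auto simp: S_def)
        ultimately show "z \<in> ?P" using R(3) by blast
      qed
      have hol': "h holomorphic_on S - {z. Im ((z - a) / (b - a)) = 0}"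
        using hol by (rule holomorphic_on_subset) (use off in blast)
      obtain G where G: "G holomorphic_on S" "\<And>z. z \<in> S \<Longrightarrow> Im ((z - a) / (b - a)) \<noteq> 0 \<Longrightarrow> G z = h z"
        using holomorphic_extension_across_line[OF _ ab(2) hol'] jump[OF ab(1) seg]
        by (metis S_def open_ball)
      have "at z within ?P \<noteq> bot" if "z \<in> S" for z
      proof (cases "z \<in> ?P")
        case True
        thus ?thesis by (subst at_within_open[OF _ openP]) auto
      next
        case False
        hence "Im ((z - a) / (b - a)) = 0" using off[OF that] by blast
        hence nb: "at z within left_side a b \<noteq> bot" by (rule left_side_islimpt[OF ab(2)])
        have "at z within (S \<inter> left_side a b) = at z within left_side a b"
          using that by (intro at_within_nhd[of z S]) (auto simp: S_def)
        moreover have "S \<inter> left_side a b \<subseteq> ?P" using off by (auto simp: left_side_def)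
        hence "at z within (S \<inter> left_side a b) \<le> at z within ?P" by (rule at_le)
        ultimately show ?thesis using nb by (metis bot.extremum_uniqueI)
      qed
      moreover have "open S" "z0 \<in> S" using r0 r1 by (auto simp: S_def)
      moreover have "\<forall>z\<in>S. z \<in> ?P \<longrightarrow> G z = h z" using G(2) off by blast
      ultimately show ?thesis using G(1) by blast
    qed
    from False z0 consider "z0 \<in> open_segment 0 x" | "z0 \<in> open_segment x 1"
      by (auto simp: short_line_def open_segment_def)
    thus ?thesis
    proof cases
      case 1
      show ?thesis
        by (rule edge[of 0 x "closed_segment x 1"]) (use 1 edges in \<open>auto simp: short_line_def\<close>)
    next
      case 2
      show ?thesis
        by (rule edge[of x 1 "closed_segment 0 x"]) (use 2 edges in \<open>auto simp: short_line_def\<close>)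
    qed
  qed
  have Fh: "F z = h z" if "z \<notin> short_line x" for z using that by (simp add: F_def)
  have holF: "\<exists>S. open S \<and> z0 \<in> S \<and> F holomorphic_on S" if z0: "z0 \<notin> {0, x, 1}" for z0
  proof -
    obtain S G where SG: "open S" "z0 \<in> S" "G holomorphic_on S" "\<forall>z\<in>S. z \<in> ?P \<longrightarrow> G z = h z"
      "\<forall>z\<in>S. at z within ?P \<noteq> bot" using loc[OF z0] by blast
    have "G z = F z" if z: "z \<in> S" for z
    proof (cases "z \<in> ?P")
      case False
      have "isCont G z"
        using SG(1,3) z by (intro holomorphic_on_imp_isCont)
      hence "(G \<longlongrightarrow> G z) (at z within ?P)"
        unfolding isCont_def by (rule Lim_at_imp_Lim_at_within)
      moreover have "\<forall>\<^sub>F w in at z within ?P. G w = h w"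
        using SG(1,4) z unfolding eventually_at_topological by blast
      ultimately have "(h \<longlongrightarrow> G z) (at z within ?P)" by (rule Lim_transform_eventually)
      thus ?thesis using False SG(5) z by (simp add: F_def tendsto_Lim)
    qed (use SG(4) z in \<open>auto simp: F_def\<close>)
    with SG(3) have "F holomorphic_on S" by (rule holomorphic_transform)
    thus ?thesis using SG by blast
  qed
  have hol0: "F holomorphic_on UNIV - {0, x, 1}"
    unfolding holomorphic_on_def
  proof
    fix z assume "z \<in> UNIV - {0, x, 1}"
    then obtain S where "open S" "z \<in> S" "F holomorphic_on S" using holF[of z] by blast
    hence "F field_differentiable at z" by (metis holomorphic_on_imp_differentiable_at)
    thus "F field_differentiable at z within UNIV - {0, x, 1}" by (rule field_differentiable_at_within)
  qed
  have "F \<in> O[at a](\<lambda>_. 1)" if a: "a \<in> {0, x, 1}" for a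
  proof -
    obtain K where K: "\<forall>\<^sub>F z in at a within ?P. norm (h z) \<le> K" using bdd[OF a] by (auto elim: BfunE)
    then obtain U where U: "open U" "a \<in> U" "\<And>z. z \<in> U \<Longrightarrow> z \<noteq> a \<Longrightarrow> z \<in> ?P \<Longrightarrow> norm (h z) \<le> K"
      unfolding eventually_at_topological by blast
    let ?U = "U - ({0, x, 1} - {a})"
    have U': "open ?U" "a \<in> ?U" using U by (auto intro!: open_Diff finite_imp_closed)
    have "norm (F z) \<le> K" if z: "z \<in> ?U" "z \<noteq> a" for z
    proof -
      have z0: "z \<notin> {0, x, 1}" using z by auto
      obtain S G where SG: "open S" "z \<in> S" "\<forall>z\<in>S. at z within ?P \<noteq> bot" using loc[OF z0] by blast
      obtain S' where S': "open S'" "z \<in> S'" "F holomorphic_on S'" using holF[OF z0] by blast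
      have "isCont F z"
        using S' by (intro holomorphic_on_imp_isCont)
      hence "(F \<longlongrightarrow> F z) (at z within ?P)" unfolding isCont_def by (rule Lim_at_imp_Lim_at_within)
      hence "((\<lambda>w. norm (F w)) \<longlongrightarrow> norm (F z)) (at z within ?P)" by (rule tendsto_norm)
      moreover have "\<forall>\<^sub>F w in at z within ?P. norm (F w) \<le> K"
        unfolding eventually_at_topological
        using z U Fh by (intro exI[of _ "U - {a}"]) (auto intro: open_delete)
      ultimately show ?thesis using SG(2,3) by (intro tendsto_upperbound) auto
    qed
    hence "\<forall>\<^sub>F z in at a. norm (F z) \<le> K * norm (1 :: complex)"
      using U' unfolding eventually_at_topological by (intro exI[of _ ?U]) auto
    thus ?thesis by (rule bigoI)
  qed
  then obtain F' where "F' holomorphic_on UNIV" "\<forall>z\<in>UNIV - {0, x, 1}. F' z = F z"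
    using removable_singularities[of "{0, x, 1}" UNIV F] hol0 by auto
  moreover have "{0, x, 1} \<subseteq> short_line x" by (auto simp: short_line_def)
  ultimately show ?thesis using that Fh by (metis DiffI UNIV_I subsetD)
qed

lemma Bfun_add:
  fixes f g :: "'a \<Rightarrow> 'b::real_normed_vector"
  assumes "Bfun f F" "Bfun g F"
  shows "Bfun (\<lambda>z. f z + g z) F"
proof -
  obtain A B where "\<forall>\<^sub>F z in F. norm (f z) \<le> A" "\<forall>\<^sub>F z in F. norm (g z) \<le> B"
    using assms by (auto elim!: BfunE)
  hence "\<forall>\<^sub>F z in F. norm (f z + g z) \<le> A + B"
    by eventually_elim (rule norm_triangle_mono)
  thus ?thesis by (rule BfunI)
qed

lemma Bfun_mult:
  fixes f g :: "'a \<Rightarrow> complex"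
  assumes "Bfun f F" "Bfun g F"
  shows "Bfun (\<lambda>z. f z * g z) F"
proof -
  obtain A B where AB: "A > 0" "\<forall>\<^sub>F z in F. norm (f z) \<le> A" "\<forall>\<^sub>F z in F. norm (g z) \<le> B"
    using assms by (auto elim!: BfunE)
  from AB(2,3) have "\<forall>\<^sub>F z in F. norm (f z * g z) \<le> A * B"
    by eventually_elim (use AB(1) in \<open>auto simp: norm_mult intro!: mult_mono\<close>)
  thus ?thesis by (rule BfunI)
qed

lemma Bfun_cmult: "Bfun f F \<Longrightarrow> Bfun (\<lambda>z. c * f z :: complex) F"
  by (rule Bfun_mult) (auto simp: Bfun_const)

lemma Bfun_tendsto:
  fixes f :: "'a \<Rightarrow> 'b::real_normed_vector"
  assumes "(f \<longlongrightarrow> l) F"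
  shows "Bfun f F"
proof -
  have "\<forall>\<^sub>F z in F. norm (f z) < norm l + 1"
    by (rule order_tendstoD[OF tendsto_norm[OF assms]]) simp
  hence "\<forall>\<^sub>F z in F. norm (f z) \<le> norm l + 1" by (rule eventually_mono) simp
  thus ?thesis by (rule BfunI)
qed

lemma Bfun_subset:
  fixes f :: "complex \<Rightarrow> complex"
  shows "Bfun f (at a within S) \<Longrightarrow> T \<subseteq> S \<Longrightarrow> Bfun f (at a within T)"
proof -
  assume "Bfun f (at a within S)" and sub: "T \<subseteq> S"
  then obtain K where "\<forall>\<^sub>F z in at a within S. norm (f z) \<le> K" by (elim BfunE)
  hence "\<forall>\<^sub>F z in at a within T. norm (f z) \<le> K" by (rule filter_leD[OF at_le[OF sub]])
  thus "Bfun f (at a within T)" by (rule BfunI)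
qed

lemma Bfun_matrix_entry:
  fixes \<Phi> :: "'a \<Rightarrow> complex^2^2"
  assumes "Bfun \<Phi> F"
  shows "Bfun (\<lambda>z. \<Phi> z $ i $ j) F"
proof -
  obtain A where "\<forall>\<^sub>F z in F. norm (\<Phi> z) \<le> A" using assms by (auto elim!: BfunE)
  hence "\<forall>\<^sub>F z in F. norm (\<Phi> z $ i $ j) \<le> A"
    by eventually_elim (rule order_trans[OF norm_matrix_entry_le])
  thus ?thesis by (rule BfunI)
qed

lemma Bfun_mat2:
  assumes "Bfun a F" "Bfun b F" "Bfun c F" "Bfun d F"
  shows "Bfun (\<lambda>z. mat2 (a z) (b z) (c z) (d z)) F"
proof -
  obtain A where A: "\<forall>\<^sub>F z in F. norm (a z) \<le> A" using assms(1) by (auto elim!: BfunE)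
  obtain B where B: "\<forall>\<^sub>F z in F. norm (b z) \<le> B" using assms(2) by (auto elim!: BfunE)
  obtain C where C: "\<forall>\<^sub>F z in F. norm (c z) \<le> C" using assms(3) by (auto elim!: BfunE)
  obtain D where D: "\<forall>\<^sub>F z in F. norm (d z) \<le> D" using assms(4) by (auto elim!: BfunE)
  from A B C D have "\<forall>\<^sub>F z in F. norm (mat2 (a z) (b z) (c z) (d z)) \<le> A + B + (C + D)"
  proof eventually_elim
    case (elim z)
    thus ?case using norm_matrix2_le[of "mat2 (a z) (b z) (c z) (d z)"] by simp
  qed
  thus ?thesis by (rule BfunI)
qed

lemma eventually_not_short_line: "\<forall>\<^sub>F z in at_infinity. z \<notin> short_line x"
proof -
  have "bounded (short_line x)" unfolding short_line_def by (intro bounded_Un[THEN iffD2] conjI compact_imp_bounded) auto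
  then obtain B where "\<forall>z\<in>short_line x. norm z \<le> B" unfolding bounded_iff by blast
  thus ?thesis unfolding eventually_at_infinity by (intro exI[of _ "B + 1"]) force
qed

lemma identity_matrix_nth:
  "(Finite_Cartesian_Product.mat 1 :: complex^2^2) $ 1 $ 1 = 1"
  "(Finite_Cartesian_Product.mat 1 :: complex^2^2) $ 1 $ 2 = 0"
  "(Finite_Cartesian_Product.mat 1 :: complex^2^2) $ 2 $ 1 = 0"
  "(Finite_Cartesian_Product.mat 1 :: complex^2^2) $ 2 $ 2 = 1"
  by (simp_all add: Finite_Cartesian_Product.mat_def)

text \<open>
  The form of the asymptotic condition that is convenient in products: the powers of \<open>z\<close> sit in the columns,
  and the matrix left over tends to the identity.
\<close>
lemma solves_RHP_asymptotics:
  assumes "solves_RHP n x g \<Phi>"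
  obtains E where "\<And>i j. ((\<lambda>z. E z $ i $ j) \<longlongrightarrow> Finite_Cartesian_Product.mat 1 $ i $ j) at_infinity"
    "\<forall>\<^sub>F z in at_infinity. \<forall>i. \<Phi> z $ i $ 1 = E z $ i $ 1 * z ^ n \<and> \<Phi> z $ i $ 2 = E z $ i $ 2 * inverse (z ^ n)"
proof -
  obtain E where E: "(\<lambda>z. norm (E z)) \<in> O[at_infinity](\<lambda>z. 1 / norm z)"
    and eq: "\<forall>\<^sub>F z in at_infinity.
      \<Phi> z = (Finite_Cartesian_Product.mat 1 + E z) ** mat2 (z ^ n) 0 0 (inverse (z ^ n))"
    using assms unfolding solves_RHP_def by blast
  obtain c where c: "\<forall>\<^sub>F z in at_infinity. norm (norm (E z)) \<le> c * norm (1 / norm z)"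
    using landau_o.bigE[OF E] by blast
  have lim: "((\<lambda>z. E z $ i $ j) \<longlongrightarrow> 0) at_infinity" for i j
  proof (rule Lim_null_comparison)
    show "\<forall>\<^sub>F z in at_infinity. norm (E z $ i $ j) \<le> c * norm (inverse z)"
      using c
    proof eventually_elim
      case (elim z)
      thus ?case using norm_matrix_entry_le[of "E z" i j] by (simp add: norm_inverse divide_inverse)
    qed
    have "((\<lambda>z::complex. c * norm (inverse z)) \<longlongrightarrow> c * norm (0::complex)) at_infinity"
      by (intro tendsto_intros tendsto_inverse_0)
    thus "((\<lambda>z::complex. c * norm (inverse z)) \<longlongrightarrow> 0) at_infinity" by simp
  qed
  show ?thesis
  proof (rule that[of "\<lambda>z. Finite_Cartesian_Product.mat 1 + E z"])
    show "((\<lambda>z. (Finite_Cartesian_Product.mat 1 + E z) $ i $ j) \<longlongrightarrow> Finite_Cartesian_Product.mat 1 $ i $ j) at_infinity" for i j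
      using tendsto_add[OF tendsto_const lim, of "Finite_Cartesian_Product.mat 1 $ i $ j" i j] by simp
    show "\<forall>\<^sub>F z in at_infinity. \<forall>i. \<Phi> z $ i $ 1 = (Finite_Cartesian_Product.mat 1 + E z) $ i $ 1 * z ^ n \<and>
        \<Phi> z $ i $ 2 = (Finite_Cartesian_Product.mat 1 + E z) $ i $ 2 * inverse (z ^ n)"
      using eq by eventually_elim (simp add: matrix2_mult_nth)
  qed
qed

text \<open>
  The jump adds a multiple of the first column to the second, which leaves these determinants
  unchanged; the powers \<open>z\<^sup>n\<close> and \<open>z\<^sup>-\<^sup>n\<close> of the two columns cancel. So the determinant extends to an
  entire function with a limit at infinity, and Liouville's theorem applies.
\<close>
lemma RHP_bracket_constant:
  assumes x: "x \<notin> complex_of_real ` ({..0} \<union> {1..})"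
    and X: "solves_RHP n x g X" and Y: "solves_RHP n x g Y" and z: "z \<notin> short_line x"
  shows "X z $ i $ 1 * Y z $ j $ 2 - X z $ i $ 2 * Y z $ j $ 1 =
    Finite_Cartesian_Product.mat 1 $ i $ 1 * Finite_Cartesian_Product.mat 1 $ j $ 2
    - Finite_Cartesian_Product.mat 1 $ i $ 2 * Finite_Cartesian_Product.mat 1 $ j $ 1" (is "_ = ?c")
proof -
  define h where "h z = X z $ i $ 1 * Y z $ j $ 2 - X z $ i $ 2 * Y z $ j $ 1" for z
  obtain F where F: "F holomorphic_on UNIV" "\<And>z. z \<notin> short_line x \<Longrightarrow> F z = h z"
  proof (rule short_line_entire[OF x, of h])
    show "h holomorphic_on - short_line x"
      unfolding h_def using X Y by (intro holomorphic_intros) (auto simp: solves_RHP_def)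
  next
    fix a b z assume ab: "(a, b) \<in> {(0, x), (x, 1)}" and z: "z \<in> open_segment a b"
    have "has_jump a b g X" "has_jump a b g Y" using X Y ab by (auto simp: solves_RHP_def)
    then obtain Xp Xm Yp Ym where
      Xl: "(X \<longlongrightarrow> Xp) (at z within left_side a b)" "(X \<longlongrightarrow> Xm) (at z within right_side a b)"
        "Xp = Xm ** mat2 1 (g z) 0 1" and
      Yl: "(Y \<longlongrightarrow> Yp) (at z within left_side a b)" "(Y \<longlongrightarrow> Ym) (at z within right_side a b)"
        "Yp = Ym ** mat2 1 (g z) 0 1"
      using z unfolding has_jump_def by meson
    have "(h \<longlongrightarrow> Xp $ i $ 1 * Yp $ j $ 2 - Xp $ i $ 2 * Yp $ j $ 1) (at z within left_side a b)"
      unfolding h_def by (intro tendsto_intros Xl Yl)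
    moreover have "(h \<longlongrightarrow> Xm $ i $ 1 * Ym $ j $ 2 - Xm $ i $ 2 * Ym $ j $ 1) (at z within right_side a b)"
      unfolding h_def by (intro tendsto_intros Xl Yl)
    moreover have "Xp $ i $ 1 * Yp $ j $ 2 - Xp $ i $ 2 * Yp $ j $ 1 = Xm $ i $ 1 * Ym $ j $ 2 - Xm $ i $ 2 * Ym $ j $ 1"
      unfolding Xl(3) Yl(3) by (simp add: matrix2_mult_nth algebra_simps)
    ultimately show "\<exists>l. (h \<longlongrightarrow> l) (at z within left_side a b) \<and> (h \<longlongrightarrow> l) (at z within right_side a b)"
      by auto
  next
    fix a assume "a \<in> {0, x, 1}"
    hence "Bfun X (at a within - short_line x)" "Bfun Y (at a within - short_line x)"
      using X Y unfolding solves_RHP_def by blast+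
    note B = this[THEN Bfun_matrix_entry]
    have "Bfun (\<lambda>z. X z $ i $ 1 * Y z $ j $ 2 + (- 1) * (X z $ i $ 2 * Y z $ j $ 1)) (at a within - short_line x)"
      by (intro Bfun_add Bfun_mult Bfun_cmult B)
    thus "Bfun h (at a within - short_line x)" by (simp add: h_def[abs_def])
  qed blast
  obtain E where E: "\<And>i j. ((\<lambda>z. E z $ i $ j) \<longlongrightarrow> Finite_Cartesian_Product.mat 1 $ i $ j) at_infinity"
    and XE: "\<forall>\<^sub>F z in at_infinity. \<forall>i. X z $ i $ 1 = E z $ i $ 1 * z ^ n \<and> X z $ i $ 2 = E z $ i $ 2 * inverse (z ^ n)"
    by (rule solves_RHP_asymptotics[OF X]) blast
  obtain E' where E': "\<And>i j. ((\<lambda>z. E' z $ i $ j) \<longlongrightarrow> Finite_Cartesian_Product.mat 1 $ i $ j) at_infinity"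
    and YE: "\<forall>\<^sub>F z in at_infinity. \<forall>i. Y z $ i $ 1 = E' z $ i $ 1 * z ^ n \<and> Y z $ i $ 2 = E' z $ i $ 2 * inverse (z ^ n)"
    by (rule solves_RHP_asymptotics[OF Y]) blast
  have "((\<lambda>z. E z $ i $ 1 * E' z $ j $ 2 - E z $ i $ 2 * E' z $ j $ 1) \<longlongrightarrow> ?c) at_infinity"
    by (intro tendsto_intros E E')
  moreover have "\<forall>\<^sub>F z in at_infinity. z \<noteq> (0::complex)"
    unfolding eventually_at_infinity by (intro exI[of _ 1]) auto
  with XE YE eventually_not_short_line[of x]
  have "\<forall>\<^sub>F z in at_infinity. E z $ i $ 1 * E' z $ j $ 2 - E z $ i $ 2 * E' z $ j $ 1 = F z"
  proof eventually_elim
    case (elim z)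
    hence "z ^ n \<noteq> 0" by simp
    hence e: "z ^ n * inverse (z ^ n) = 1" by (rule right_inverse)
    have c: "(u * z ^ n) * (v * inverse (z ^ n)) = u * v" "(u * inverse (z ^ n)) * (v * z ^ n) = u * v" for u v
    proof -
      have "(u * z ^ n) * (v * inverse (z ^ n)) = u * v * (z ^ n * inverse (z ^ n))"
        "(u * inverse (z ^ n)) * (v * z ^ n) = u * v * (z ^ n * inverse (z ^ n))" by (simp_all only: mult_ac)
      thus "(u * z ^ n) * (v * inverse (z ^ n)) = u * v" "(u * inverse (z ^ n)) * (v * z ^ n) = u * v"
        unfolding e by simp_all
    qed
    show ?case
      unfolding F(2)[OF elim(3)] h_def
        elim(1)[rule_format, THEN conjunct1] elim(1)[rule_format, THEN conjunct2]
        elim(2)[rule_format, THEN conjunct1] elim(2)[rule_format, THEN conjunct2] c ..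
  qed
  ultimately have "(F \<longlongrightarrow> ?c) at_infinity" by (rule Lim_transform_eventually)
  hence "F z = ?c" by (rule Liouville_weak[OF F(1)])
  thus ?thesis using F(2)[OF z] by (simp add: h_def)
qed

text \<open>
  Expansion of the row \<open>(a, b)\<close> in the rows of a matrix of determinant one.
\<close>
lemma row_expansion:
  fixes a b :: complex
  assumes "y11 * y22 - y12 * y21 = 1"
  shows "a = (a * y22 - b * y21) * y11 - (a * y12 - b * y11) * y21"
    and "b = (a * y22 - b * y21) * y12 - (a * y12 - b * y11) * y22"
proof -
  have "(a * y22 - b * y21) * y11 - (a * y12 - b * y11) * y21 = a * (y11 * y22 - y12 * y21)"
    by (simp add: algebra_simps)
  thus "a = (a * y22 - b * y21) * y11 - (a * y12 - b * y11) * y21" using assms by simp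
  have "(a * y22 - b * y21) * y12 - (a * y12 - b * y11) * y22 = b * (y11 * y22 - y12 * y21)"
    by (simp add: algebra_simps)
  thus "b = (a * y22 - b * y21) * y12 - (a * y12 - b * y11) * y22" using assms by simp
qed

theorem RHP_unique:
  assumes x: "x \<notin> complex_of_real ` ({..0} \<union> {1..})"
    and X: "solves_RHP n x g X" and Y: "solves_RHP n x g Y" and z: "z \<notin> short_line x"
  shows "X z = Y z"
proof -
  note c = RHP_bracket_constant[OF x _ _ z] and m = identity_matrix_nth
  have YY: "Y z $ 1 $ 1 * Y z $ 2 $ 2 - Y z $ 1 $ 2 * Y z $ 2 $ 1 = 1"
    using c[OF Y Y, of 1 2] by (simp add: m)
  have X12: "X z $ 1 $ 1 * Y z $ 2 $ 2 - X z $ 1 $ 2 * Y z $ 2 $ 1 = 1"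
    using c[OF X Y, of 1 2] by (simp add: m)
  have X11: "X z $ 1 $ 1 * Y z $ 1 $ 2 - X z $ 1 $ 2 * Y z $ 1 $ 1 = 0"
    using c[OF X Y, of 1 1] by (simp add: m)
  have X22: "X z $ 2 $ 1 * Y z $ 2 $ 2 - X z $ 2 $ 2 * Y z $ 2 $ 1 = 0"
    using c[OF X Y, of 2 2] by (simp add: m)
  have X21: "X z $ 2 $ 1 * Y z $ 1 $ 2 - X z $ 2 $ 2 * Y z $ 1 $ 1 = - 1"
    using c[OF X Y, of 2 1] by (simp add: m)
  show ?thesis
  proof (rule matrix2_eqI)
    show "X z $ 1 $ 1 = Y z $ 1 $ 1"
      using row_expansion(1)[OF YY, of "X z $ 1 $ 1" "X z $ 1 $ 2"] unfolding X12 X11 by simp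
    show "X z $ 1 $ 2 = Y z $ 1 $ 2"
      using row_expansion(2)[OF YY, of "X z $ 1 $ 2" "X z $ 1 $ 1"] unfolding X12 X11 by simp
    show "X z $ 2 $ 1 = Y z $ 2 $ 1"
      using row_expansion(1)[OF YY, of "X z $ 2 $ 1" "X z $ 2 $ 2"] unfolding X22 X21 by simp
    show "X z $ 2 $ 2 = Y z $ 2 $ 2"
      using row_expansion(2)[OF YY, of "X z $ 2 $ 2" "X z $ 2 $ 1"] unfolding X22 X21 by simp
  qed
qed

section \<open>Existence and the Heun equation\<close>
lemma polynomial_over_power_bounded:
  fixes r :: "complex poly"
  assumes "degree r < n"
  shows "Bfun (\<lambda>z. z * (poly r z / z ^ n)) at_infinity"
proof -
  have "norm (z * (poly r z / z ^ n)) \<le> (\<Sum>i\<le>degree r. norm (coeff r i))" if z: "norm z \<ge> 1" for z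
  proof -
    have "norm (poly r z) \<le> (\<Sum>i\<le>degree r. norm (coeff r i) * norm z ^ i)"
      unfolding poly_altdef by (rule order_trans[OF norm_sum]) (simp add: norm_mult norm_power)
    also have "\<dots> \<le> (\<Sum>i\<le>degree r. norm (coeff r i) * norm z ^ (n - 1))"
      using z assms by (intro sum_mono mult_left_mono power_increasing) auto
    also have "\<dots> = (\<Sum>i\<le>degree r. norm (coeff r i)) * norm z ^ (n - 1)"
      by (simp add: sum_distrib_right)
    finally have "norm z * norm (poly r z) \<le> norm z * ((\<Sum>i\<le>degree r. norm (coeff r i)) * norm z ^ (n - 1))"
      by (intro mult_left_mono) auto
    also have "\<dots> = (\<Sum>i\<le>degree r. norm (coeff r i)) * norm z ^ n"
      using assms by (cases n) (auto simp: mult_ac)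
    finally have "norm z * norm (poly r z) \<le> (\<Sum>i\<le>degree r. norm (coeff r i)) * norm z ^ n" .
    moreover have "0 < norm z ^ n" using z by (intro zero_less_power) auto
    ultimately show ?thesis by (simp add: norm_mult norm_divide norm_power divide_le_eq)
  qed
  hence "\<forall>\<^sub>F z in at_infinity. norm (z * (poly r z / z ^ n)) \<le> (\<Sum>i\<le>degree r. norm (coeff r i))"
    unfolding eventually_at_infinity by blast
  thus ?thesis by (rule BfunI)
qed

context edge_weight
begin

lemma poly_heun_operator:
  "poly (heun_operator p) z = z * (z - x) * (z - 1) * poly (pderiv (pderiv p)) z +
    ((1 + \<mu>1) * ((z - x) * (z - 1)) + (1 + \<mu>2) * (z * (z - 1)) + (1 + \<mu>3) * (z * (z - x))) * poly (pderiv p) z"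
  by (simp add: heun_operator_def W_def V_def algebra_simps)

definition cauchy :: "complex poly \<Rightarrow> complex \<Rightarrow> complex" where
  "cauchy r z = (1 / (2 * pi * \<i>)) *
     (edge_cauchy 0 x (weighted r) z + edge_cauchy x 1 (weighted r) z)"

lemma end_points: "0 \<noteq> x" "x \<noteq> 1"
  using edges(1,2) by auto

lemmas edge_holomorphic = edge_cauchy_holomorphic[OF bounded_first end_points(1)]
  edge_cauchy_holomorphic[OF bounded_second end_points(2)]

lemmas edge_tendsto = edge_cauchy_tendsto[OF bounded_first end_points(1)]
  edge_cauchy_tendsto[OF bounded_second end_points(2)]

lemma cauchy_holomorphic: "cauchy r holomorphic_on - short_line x"
  unfolding cauchy_def[abs_def]
  by (intro holomorphic_intros holomorphic_on_subset[OF edge_holomorphic(1)]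
      holomorphic_on_subset[OF edge_holomorphic(2)]) (auto simp: short_line_def)

text \<open>
  Only the edge containing the point contributes to the jump; the transform along the other edge is
  continuous there.
\<close>
lemma cauchy_jump:
  assumes ab: "(a, b) \<in> {(0, x), (x, 1)}" and z: "z \<in> open_segment a b"
  shows "\<exists>lp lm. (cauchy r \<longlongrightarrow> lp) (at z within left_side a b) \<and>
    (cauchy r \<longlongrightarrow> lm) (at z within right_side a b) \<and> lp = lm + g z * poly r z"
proof -
  let ?c = "1 / (2 * pi * \<i>)" and ?G = "\<lambda>\<zeta>. g \<zeta> * poly r \<zeta>"
  have c: "?c * lp = ?c * lm + w" if "lp - lm = 2 * pi * \<i> * w" for lp lm w :: complex
  proof -
    have "lp = lm + 2 * pi * \<i> * w" using that by (simp add: algebra_simps)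
    thus ?thesis by (simp add: distrib_left)
  qed
  from ab consider "a = 0" "b = x" | "a = x" "b = 1" by auto
  thus ?thesis
  proof cases
    case 1
    obtain lp lm where l: "(edge_cauchy 0 x ?G \<longlongrightarrow> lp) (at z within left_side 0 x)"
      "(edge_cauchy 0 x ?G \<longlongrightarrow> lm) (at z within right_side 0 x)" "lp - lm = 2 * pi * \<i> * ?G z"
      by (rule edge_cauchy_jump[OF density_first Re_nonneg(1,2)]) (use edges(1) z 1 in auto)
    have z': "z \<notin> closed_segment x 1" using z 1 edges(5) by blast
    let ?k = "edge_cauchy x 1 ?G z"
    have "(cauchy r \<longlongrightarrow> ?c * (lp + ?k)) (at z within left_side 0 x)"
      "(cauchy r \<longlongrightarrow> ?c * (lm + ?k)) (at z within right_side 0 x)"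
      unfolding cauchy_def[abs_def] by (intro tendsto_intros l edge_tendsto z')+
    moreover have "?c * (lp + ?k) = ?c * (lm + ?k) + ?G z" by (rule c) (use l(3) in simp)
    ultimately show ?thesis using 1 by blast
  next
    case 2
    obtain lp lm where l: "(edge_cauchy x 1 ?G \<longlongrightarrow> lp) (at z within left_side x 1)"
      "(edge_cauchy x 1 ?G \<longlongrightarrow> lm) (at z within right_side x 1)" "lp - lm = 2 * pi * \<i> * ?G z"
      by (rule edge_cauchy_jump[OF density_second Re_nonneg(2,3)]) (use edges(2) z 2 in auto)
    have z': "z \<notin> closed_segment 0 x" using z 2 edges(6) by blast
    let ?k = "edge_cauchy 0 x ?G z"
    have "(cauchy r \<longlongrightarrow> ?c * (?k + lp)) (at z within left_side x 1)"
      "(cauchy r \<longlongrightarrow> ?c * (?k + lm)) (at z within right_side x 1)"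
      unfolding cauchy_def[abs_def] by (intro tendsto_intros l edge_tendsto z')+
    moreover have "?c * (?k + lp) = ?c * (?k + lm) + ?G z" by (rule c) (use l(3) in simp)
    ultimately show ?thesis using 2 by blast
  qed
qed

lemma cauchy_bounded:
  assumes "a \<in> {0, x, 1}"
  shows "Bfun (cauchy r) (at a within - short_line x)"
proof -
  let ?G = "\<lambda>\<zeta>. g \<zeta> * poly r \<zeta>" and ?F = "at a within - short_line x"
  have sub: "- short_line x \<subseteq> - closed_segment 0 x" "- short_line x \<subseteq> - closed_segment x 1"
    by (auto simp: short_line_def)
  consider "a = 0" | "a = x" | "a = 1" using assms by auto
  hence "Bfun (edge_cauchy 0 x ?G) ?F \<and> Bfun (edge_cauchy x 1 ?G) ?F"
  proof cases
    case 1
    show ?thesis unfolding 1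
      by (intro conjI Bfun_subset[OF edge_cauchy_bounded_at_start[OF density_first Re_nonneg(1,2) nonint(1) end_points(1)] sub(1)]
          Bfun_tendsto[OF edge_tendsto(2)[OF edges(4)]])
  next
    case 2
    show ?thesis unfolding 2
      by (intro conjI Bfun_subset[OF edge_cauchy_bounded_at_end[OF density_first Re_nonneg(1,2) nonint(2) end_points(1)] sub(1)]
          Bfun_subset[OF edge_cauchy_bounded_at_start[OF density_second Re_nonneg(2,3) nonint(2) end_points(2)] sub(2)])
  next
    case 3
    show ?thesis unfolding 3
      by (intro conjI Bfun_subset[OF edge_cauchy_bounded_at_end[OF density_second Re_nonneg(2,3) nonint(3) end_points(2)] sub(2)]
          Bfun_tendsto[OF edge_tendsto(1)[OF edges(3)]])
  qed
  thus ?thesis unfolding cauchy_def[abs_def] by (intro Bfun_cmult Bfun_add) auto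
qed

lemma cauchy_times:
  assumes z: "z \<notin> short_line x"
  shows "z * cauchy r z = cauchy ([:0, 1:] * r) z - (1 / (2 * pi * \<i>)) * functional r"
proof -
  have z': "z \<notin> closed_segment 0 x" "z \<notin> closed_segment x 1" using z by (auto simp: short_line_def)
  have G: "weighted ([:0, 1:] * r) = (\<lambda>\<zeta>. g \<zeta> * poly r \<zeta> * \<zeta>)"
    by (simp add: fun_eq_iff mult_ac)
  show ?thesis
    unfolding cauchy_def functional_def G
      edge_cauchy_times[OF bounded_first end_points(1) z'(1)] edge_cauchy_times[OF bounded_second end_points(2) z'(2)]
    by (simp add: algebra_simps add_divide_distrib)
qed

lemma cauchy_power:
  assumes z: "z \<notin> short_line x" and "\<And>i. i < k \<Longrightarrow> functional (monom 1 i * r) = 0"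
  shows "z ^ k * cauchy r z = cauchy (monom 1 k * r) z"
  using assms(2)
proof (induction k)
  case 0
  thus ?case by (simp add: monom_0)
next
  case (Suc k)
  have "z ^ Suc k * cauchy r z = z * cauchy (monom 1 k * r) z"
    using Suc by (simp add: mult.assoc)
  also have "\<dots> = cauchy ([:0, 1:] * (monom 1 k * r)) z"
    using cauchy_times[OF z] Suc.prems[of k] by simp
  also have "[:0, 1:] * (monom 1 k * r) = monom 1 (Suc k) * r" by (simp add: monom_Suc)
  finally show ?case .
qed

lemma cauchy_decay: "Bfun (\<lambda>z. z * cauchy r z) at_infinity"
proof -
  have "Bfun (cauchy ([:0, 1:] * r)) at_infinity"
    unfolding cauchy_def[abs_def] using end_points
    by (intro Bfun_cmult Bfun_add edge_cauchy_bounded_far bounded_first bounded_second) auto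
  hence "Bfun (\<lambda>z. cauchy ([:0, 1:] * r) z + - ((1 / (2 * pi * \<i>)) * functional r)) at_infinity"
    by (intro Bfun_add) auto
  then obtain K where "\<forall>\<^sub>F z in at_infinity. norm (cauchy ([:0, 1:] * r) z + - ((1 / (2 * pi * \<i>)) * functional r)) \<le> K"
    by (elim BfunE)
  with eventually_not_short_line[of x]
  have "\<forall>\<^sub>F z in at_infinity. norm (z * cauchy r z) \<le> K"
    by eventually_elim (simp add: cauchy_times)
  thus ?thesis by (rule BfunI)
qed

text \<open>
  Multiplied by \<open>z\<^sup>n\<close>, the second column becomes the Cauchy transforms of \<open>g \<zeta>\<^sup>n p\<close> and \<open>g \<zeta>\<^sup>n q\<close>, because the
  intermediate moments vanish. The one moment of \<open>q\<close> that does not vanish produces the entry \<open>1\<close> of the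
  identity matrix.
\<close>
theorem RHP_solution:
  assumes p: "degree p = n" "lead_coeff p = 1" "\<And>i. i < n \<Longrightarrow> functional (monom 1 i * p) = 0"
    and q: "degree q < n" "\<And>i. i < n - 1 \<Longrightarrow> functional (monom 1 i * q) = 0"
      "functional (monom 1 (n - 1) * q) = - 2 * pi * \<i>"
  shows "solves_RHP n x g (\<lambda>z. mat2 (poly p z) (cauchy p z) (poly q z) (cauchy q z))"
    (is "solves_RHP n x g ?\<Phi>")
  unfolding solves_RHP_def
proof (intro conjI allI ballI)
  have n: "n \<ge> 1" using q(1) by simp
  fix i j :: 2
  show "(\<lambda>z. ?\<Phi> z $ i $ j) holomorphic_on - short_line x"
    using exhaust_2[of i] exhaust_2[of j]
    by (auto intro!: cauchy_holomorphic poly_holomorphic)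
next
  fix a assume "a \<in> {0, x, 1}"
  moreover have "Bfun (poly r) (at a within - short_line x)" for r
    by (rule Bfun_tendsto[OF tendsto_poly[OF tendsto_ident_at]])
  ultimately show "Bfun ?\<Phi> (at a within - short_line x)"
    by (intro Bfun_mat2 cauchy_bounded)
next
  have jump: "has_jump a b g ?\<Phi>" if ab: "(a, b) \<in> {(0, x), (x, 1)}" for a b
    unfolding has_jump_def
  proof
    fix z assume z: "z \<in> open_segment a b"
    obtain pp pm where P: "(cauchy p \<longlongrightarrow> pp) (at z within left_side a b)"
      "(cauchy p \<longlongrightarrow> pm) (at z within right_side a b)" "pp = pm + g z * poly p z"
      using cauchy_jump[OF ab z] by blast
    obtain qp qm where Q: "(cauchy q \<longlongrightarrow> qp) (at z within left_side a b)"
      "(cauchy q \<longlongrightarrow> qm) (at z within right_side a b)" "qp = qm + g z * poly q z"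
      using cauchy_jump[OF ab z] by blast
    have "(?\<Phi> \<longlongrightarrow> mat2 (poly p z) pp (poly q z) qp) (at z within left_side a b)"
      by (rule tendsto_matrix2) (simp_all add: P(1,2) Q(1,2) tendsto_intros)
    moreover have "(?\<Phi> \<longlongrightarrow> mat2 (poly p z) pm (poly q z) qm) (at z within right_side a b)"
      by (rule tendsto_matrix2) (simp_all add: P(1,2) Q(1,2) tendsto_intros)
    moreover have "mat2 (poly p z) pp (poly q z) qp = mat2 (poly p z) pm (poly q z) qm ** mat2 1 (g z) 0 1"
      by (rule matrix2_eqI) (simp_all add: matrix2_mult_nth P(3) Q(3))
    ultimately show "\<exists>\<Phi>p \<Phi>m. (?\<Phi> \<longlongrightarrow> \<Phi>p) (at z within left_side a b) \<and>
        (?\<Phi> \<longlongrightarrow> \<Phi>m) (at z within right_side a b) \<and> \<Phi>p = \<Phi>m ** mat2 1 (g z) 0 1" by blast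
  qed
  show "has_jump 0 x g ?\<Phi>" "has_jump x 1 g ?\<Phi>" by (rule jump, simp)+
next
  have n: "n \<ge> 1" using q(1) by simp
  define E where "E z = mat2 (poly (p - monom 1 n) z / z ^ n) (cauchy (monom 1 n * p) z)
    (poly q z / z ^ n) (cauchy (monom 1 n * q) z)" for z
  have degp: "degree (p - monom 1 n) < n"
  proof -
    have "coeff (p - monom 1 n) k = 0" if "k > n - 1" for k
      using that p(1,2) by (cases "k = n") (auto simp: coeff_eq_0)
    hence "degree (p - monom 1 n) \<le> n - 1" by (intro degree_le) auto
    thus ?thesis using n by simp
  qed
  let ?M = "\<lambda>z. mat2 (z * (poly (p - monom 1 n) z / z ^ n)) (z * cauchy (monom 1 n * p) z)
    (z * (poly q z / z ^ n)) (z * cauchy (monom 1 n * q) z)"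
  have "Bfun ?M at_infinity"
    by (intro Bfun_mat2 cauchy_decay polynomial_over_power_bounded degp q(1))
  then obtain K where K: "\<forall>\<^sub>F z in at_infinity. norm (?M z) \<le> K" by (elim BfunE)
  have nz: "\<forall>\<^sub>F z in at_infinity. z \<noteq> (0::complex)"
    unfolding eventually_at_infinity by (intro exI[of _ 1]) auto
  from K nz have "\<forall>\<^sub>F z in at_infinity. norm (norm (E z)) \<le> 4 * K * norm (1 / norm z)"
  proof eventually_elim
    case (elim z)
    have e: "norm (E z $ i $ j) * norm z \<le> K" for i j
    proof -
      have "z * E z $ i $ j = ?M z $ i $ j"
        using exhaust_2[of i] exhaust_2[of j] by (auto simp: E_def)
      hence "norm (E z $ i $ j) * norm z = norm (?M z $ i $ j)" by (metis norm_mult mult.commute)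
      thus ?thesis using norm_matrix_entry_le[of "?M z" i j] elim(1) by linarith
    qed
    have "norm (E z) * norm z \<le> (norm (E z $ 1 $ 1) + norm (E z $ 1 $ 2) + (norm (E z $ 2 $ 1) + norm (E z $ 2 $ 2))) * norm z"
      by (intro mult_right_mono norm_matrix2_le) auto
    also have "\<dots> \<le> 4 * K" using e[of 1 1] e[of 1 2] e[of 2 1] e[of 2 2] by (simp add: distrib_right)
    finally show ?case using elim(2) by (simp add: field_simps)
  qed
  hence "(\<lambda>z. norm (E z)) \<in> O[at_infinity](\<lambda>z. 1 / norm z)" by (rule bigoI)
  moreover from nz eventually_not_short_line[of x]
  have "\<forall>\<^sub>F z in at_infinity. ?\<Phi> z = (Finite_Cartesian_Product.mat 1 + E z) ** mat2 (z ^ n) 0 0 (inverse (z ^ n))"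
  proof eventually_elim
    case (elim z)
    have cp: "cauchy (monom 1 n * p) z = z ^ n * cauchy p z"
      using elim p(3) by (intro cauchy_power[symmetric]) auto
    have "z ^ n * cauchy q z = z * (z ^ (n - 1) * cauchy q z)"
      using n by (cases n) auto
    also have "\<dots> = z * cauchy (monom 1 (n - 1) * q) z" using cauchy_power[OF elim(2) q(2)] by simp
    also have "\<dots> = cauchy ([:0, 1:] * (monom 1 (n - 1) * q)) z + 1"
      unfolding cauchy_times[OF elim(2)] q(3) by simp
    also have "[:0, 1:] * (monom 1 (n - 1) * q) = monom 1 n * q"
      using n by (cases n) (auto simp: monom_Suc)
    finally have cq: "cauchy (monom 1 n * q) z = z ^ n * cauchy q z - 1" by simp
    have Ez: "E z = mat2 (poly p z / z ^ n - 1) (z ^ n * cauchy p z) (poly q z / z ^ n) (z ^ n * cauchy q z - 1)"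
      unfolding E_def cp cq using elim by (simp add: poly_monom diff_divide_distrib)
    show ?case
      by (rule matrix2_eqI)
        (use elim in \<open>simp_all add: matrix2_mult_nth identity_matrix_nth Ez\<close>)
  qed
  ultimately show "\<exists>E. (\<lambda>z. norm (E z)) \<in> O[at_infinity](\<lambda>z. 1 / norm z) \<and>
      (\<forall>\<^sub>F z in at_infinity. ?\<Phi> z = (Finite_Cartesian_Product.mat 1 + E z) ** mat2 (z ^ n) 0 0 (inverse (z ^ n)))"
    by blast
qed

end

theorem proposition3p15:
  fixes n :: nat
    and x \<alpha>1 \<alpha>2 \<alpha>3 \<delta> s1 s2 s3 :: complex
    and f :: "complex \<Rightarrow> complex"
  assumes "n \<ge> 1"
    and "x \<notin> complex_of_real ` ({..0} \<union> {1..})"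
    and "\<forall>\<alpha>\<in>{\<alpha>1, \<alpha>2, \<alpha>3}. 0 \<le> Re \<alpha> \<and> Re \<alpha> < 1 / 2 \<and> 2 * \<alpha> \<notin> \<int>"
    and "2 * \<delta> \<notin> \<int>"
    and "\<alpha>1 + \<alpha>2 + \<alpha>3 + \<delta> = - of_nat n"
    and "s1 \<noteq> 0" and "s2 \<noteq> 0" and "s3 \<noteq> 0"
    and "s1 * exp (2 * pi * \<i> * \<alpha>2) + s2 * exp (- 2 * pi * \<i> * \<alpha>1) + s3 * exp (2 * pi * \<i> * \<delta>) = 0"
    and "power_product x \<alpha>1 \<alpha>2 \<alpha>3 f"
    and "hankel x (weight x \<delta> s1 s3 f) n \<noteq> 0"
    and "hankel x (weight x \<delta> s1 s3 f) (n + 1) = 0"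
  shows "\<exists>\<Phi>. solves_RHP n x (weight x \<delta> s1 s3 f) \<Phi> \<and>
    (\<forall>\<Psi>. solves_RHP n x (weight x \<delta> s1 s3 f) \<Psi> \<longrightarrow> (\<forall>z\<in>- short_line x. \<Psi> z = \<Phi> z)) \<and>
    (\<exists>p \<nu>. degree p = n \<and>
      (\<forall>z\<in>- short_line x. \<Phi> z $ 1 $ 1 = poly p z) \<and>
      (\<forall>z\<in>- {0, x, 1}.
        deriv (deriv (poly p)) z
        + ((1 + 2 * \<alpha>1) / z + (1 + 2 * \<alpha>2) / (z - x) + (1 + 2 * \<alpha>3) / (z - 1)) * deriv (poly p) z
        + (of_nat n * (of_nat n + 2 * \<delta> - 2) * z + \<nu>) / (z * (z - 1) * (z - x)) * poly p z = 0))"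
proof -
  let ?g = "weight x \<delta> s1 s3 f"
  obtain C1 C2 where
    "\<And>z. z \<in> open_segment 0 x \<Longrightarrow> ?g z = C1 * edge_branch 0 x 1 (2 * \<alpha>1) (2 * \<alpha>2) (2 * \<alpha>3) z"
    "\<And>z. z \<in> open_segment x 1 \<Longrightarrow> ?g z = C2 * edge_branch x 1 0 (2 * \<alpha>2) (2 * \<alpha>3) (2 * \<alpha>1) z"
    using weight_on_edges[OF assms(2,10), of \<delta> s1 s3] by metis
  then interpret edge_weight x "2 * \<alpha>1" "2 * \<alpha>2" "2 * \<alpha>3" C1 C2 ?g
    using assms(2,3) by unfold_locales auto
  obtain p where p: "degree p = n" "lead_coeff p = 1"
    and orth: "\<forall>s. degree s \<le> n \<longrightarrow> functional (s * p) = 0"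
    using orthogonal_polynomial_exists[OF assms(11,12)] by metis
  obtain q where q: "degree q < n" "\<forall>i<n - 1. functional (monom 1 i * q) = 0"
    "functional (monom 1 (n - 1) * q) = - 2 * pi * \<i>"
    using second_row_exists[OF assms(11,1)] by metis
  let ?\<Phi> = "\<lambda>z. mat2 (poly p z) (cauchy p z) (poly q z) (cauchy q z)"
  have sol: "solves_RHP n x ?g ?\<Phi>"
  proof (rule RHP_solution[OF p _ q(1) _ q(3)])
    show "functional (monom 1 i * p) = 0" if "i < n" for i
      using orth that by (simp add: degree_monom_eq)
  qed (use q(2) in blast)
  obtain b where b: "heun_operator p = [:b, of_nat n * (of_nat n + 2 + (2 * \<alpha>1 + 2 * \<alpha>2 + 2 * \<alpha>3)):] * p"
    using orthogonal_polynomial_heun[OF assms(1,11) p] orth by metis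
  have \<delta>: "\<delta> = - of_nat n - \<alpha>1 - \<alpha>2 - \<alpha>3" using assms(5) by (simp add: algebra_simps eq_neg_iff_add_eq_0)
  have heun: "deriv (deriv (poly p)) z
        + ((1 + 2 * \<alpha>1) / z + (1 + 2 * \<alpha>2) / (z - x) + (1 + 2 * \<alpha>3) / (z - 1)) * deriv (poly p) z
        + (of_nat n * (of_nat n + 2 * \<delta> - 2) * z + (- b)) / (z * (z - 1) * (z - x)) * poly p z = 0"
    if "z \<in> - {0, x, 1}" for z
  proof -
    let ?V = "((1 + 2 * \<alpha>1) * ((z - x) * (z - 1)) + (1 + 2 * \<alpha>2) * (z * (z - 1)) + (1 + 2 * \<alpha>3) * (z * (z - x)))"
    let ?a = "of_nat n * (of_nat n + 2 + (2 * \<alpha>1 + 2 * \<alpha>2 + 2 * \<alpha>3))"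
    define P0 P1 P2 where "P0 = poly p z" and "P1 = poly (pderiv p) z" and "P2 = poly (pderiv (pderiv p)) z"
    have z: "z \<noteq> 0" "z - 1 \<noteq> 0" "z - x \<noteq> 0" using that by auto
    have "poly (heun_operator p) z = (b + z * ?a) * P0"
      unfolding b by (simp add: P0_def algebra_simps)
    moreover have "poly (heun_operator p) z = z * (z - x) * (z - 1) * P2 +
        ?V * P1"
      unfolding P1_def P2_def by (rule poly_heun_operator)
    ultimately have eq: "z * (z - x) * (z - 1) * P2 +
        ?V * P1
        = (b + z * ?a) * P0" by simp
    have "(P2 + ((1 + 2 * \<alpha>1) / z + (1 + 2 * \<alpha>2) / (z - x) + (1 + 2 * \<alpha>3) / (z - 1)) * P1
        + (of_nat n * (of_nat n + 2 * \<delta> - 2) * z + (- b)) / (z * (z - 1) * (z - x)) * P0) * (z * (z - x) * (z - 1))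
      = (z * (z - x) * (z - 1) * P2 +
        ?V * P1)
        + (of_nat n * (of_nat n + 2 * \<delta> - 2) * z + (- b)) * P0"
      using z by (simp add: divide_simps) (simp add: algebra_simps)
    also have "\<dots> = 0" unfolding eq \<delta> by (simp add: algebra_simps)
    finally show ?thesis
      using z by (simp add: deriv_poly_eq P0_def P1_def P2_def)
  qed
  show ?thesis
  proof (intro exI[of _ ?\<Phi>] conjI allI impI ballI exI[of _ p] exI[of _ "- b"])
    show "\<Psi> z = ?\<Phi> z" if "solves_RHP n x ?g \<Psi>" "z \<in> - short_line x" for \<Psi> z
      using RHP_unique[OF assms(2) that(1) sol] that(2) by simp
  qed (use sol p heun in auto)
qed

end
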